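(* Let $\mathcal D$ be the diagram of $\mathfrak g$-modules described in the context. At every vertex of $\mathcal D$ the homology (kernel of the outgoing arrow modulo the image of the incoming arrow) is zero, except at the vertices $M_A^{0,0}\cong M(0,0,0,0)$ and $M_C^{-1,-1}\cong M(1,1,3,0)$, where the homology is isomorphic to the one-dimensional trivial $\mathfrak g$-module.
   Context: Let $\Lambda(4)$ be the Grassmann superalgebra on odd generators $\xi_1,\dots,\xi_4$; for $I=i_1\cdots i_r$ write $\xi_I=\xi_{i_1}\cdots\xi_{i_r}$, $|I|=r$, $\xi_{ij}=\xi_i\xi_j$. Let $K(1,4)_+=\mathbb C[t]\otimes\Lambda(4)$ ($t$ even) with Lie superalgebra bracket $[f,g]=(2f-\sum_i\xi_i\partial_{\xi_i}f)\partial_tg-\partial_tf\,(2g-\sum_i\xi_i\partial_{\xi_i}g)+(-1)^{p(f)}\sum_i\partial_{\xi_i}f\,\partial_{\xi_i}g$. Let $\mathfrak g=K(1,4)_+\oplus\mathbb CC$ with bracket $[f,g]+\psi(f,g)C$, $C$ central, where $\psi$ is the skew-symmetric 2-cocycle whose only nonzero values on the basis $\{t^m\xi_I\}$ are (up to skew-symmetry) $\psi(1,\xi_1\xi_2\xi_3\xi_4)=-2$ and $\psi(\xi_i,\partial_{\xi_i}(\xi_1\xi_2\xi_3\xi_4))=-1$; $\mathfrak g$ is the annihilation superalgebra of the conformal superalgebra $K_4'$. Grade $\mathfrak g$ by $\deg t^m\xi_I=2m+|I|-2$, $\deg C=0$; so $\mathfrak g_{-2}=\mathbb C1$, $\mathfrak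 g_{-1}=\langle\xi_1,\dots,\xi_4\rangle$, $\mathfrak g_0=\langle C,t,\xi_{ij}\rangle$. Let $\eta_i$ be the image of $\xi_i$ in $U(\mathfrak g_{<0})$ and put $w_{11}=\eta_2+i\eta_1$, $w_{22}=\eta_2-i\eta_1$, $w_{12}=-\eta_4+i\eta_3$, $w_{21}=\eta_4+i\eta_3$. Let $h_x=-i\xi_{12}+i\xi_{34}$, $h_y=-i\xi_{12}-i\xi_{34}$, $e_x=\frac12(-\xi_{13}-\xi_{24}-i\xi_{14}+i\xi_{23})$, $f_x=\frac12(\xi_{13}+\xi_{24}-i\xi_{14}+i\xi_{23})$, $e_y=\frac12(-\xi_{13}+\xi_{24}+i\xi_{14}+i\xi_{23})$, $f_y=\frac12(\xi_{13}-\xi_{24}+i\xi_{14}+i\xi_{23})$; they span $\mathfrak g_0^{ss}\cong\mathfrak{sl}_2\oplus\mathfrak{sl}_2$, identified with $\langle x_1\partial_{x_2},x_2\partial_{x_1},x_1\partial_{x_1}-x_2\partial_{x_2}\rangle\oplus\langle y_1\partial_{y_2},y_2\partial_{y_1},y_1\partial_{y_1}-y_2\partial_{y_2}\rangle$ via $e_x\mapsto x_1\partial_{x_2}$, $f_x\mapsto x_2\partial_{x_1}$, $h_x\mapsto x_1\partial_{x_1}-x_2\partial_{x_2}$ and likewise for $y$. For $\mu=(m,n,\mu_t,\mu_C)$, $F(\mu)$ is the irreducible finite-dimensional $\mathfrak g_0$-module with a highest weight vector (killed by $e_x,e_y$) on which $h_x,h_y,t,C$ act by $m,n,\mu_t,\mu_C$,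 extended to $\mathfrak g_{\ge0}$ by letting $\mathfrak g_{>0}$ act trivially, and $M(\mu)=U(\mathfrak g)\otimes_{U(\mathfrak g_{\ge0})}F(\mu)\cong U(\mathfrak g_{<0})\otimes F(\mu)$. Let $V_A=\mathbb C[x_1,x_2,y_1,y_2]$, $V_B=\mathbb C[\partial_{x_1},\partial_{x_2},y_1,y_2]$, $V_C=\mathbb C[\partial_{x_1},\partial_{x_2},\partial_{y_1},\partial_{y_2}]$, $V_D=\mathbb C[x_1,x_2,\partial_{y_1},\partial_{y_2}]$ (polynomial algebras in the indicated commuting variables). $\mathfrak g_0^{ss}$ acts by derivations with $x_i\partial_{x_j}(x_k)=\delta_{jk}x_i$, $x_i\partial_{x_j}(\partial_{x_k})=-\delta_{ik}\partial_{x_j}$, $x_i\partial_{x_j}$ killing $y$- and $\partial_y$-variables, and symmetrically for $y_i\partial_{y_j}$. Let $E_x$ (resp. $E_y$) be the derivation $x_1\partial_{x_1}+x_2\partial_{x_2}$ (resp. $y_1\partial_{y_1}+y_2\partial_{y_2}$) with the same rule ($+1$ on $x_k$, $-1$ on $\partial_{x_k}$). $t$ acts on $V_X$ as $-\frac12(E_x+E_y)+i_X$ and $C$ as $\frac12(E_x-E_y)+j_X$, with $(i_X,j_X)=(0,0),(1,-1),(2,0),(1,1)$ for $X=A,B,C,D$. $V_X^{m,n}$ is the subspace where $E_x=m$, $E_y=n$; for $m,n\ge0$: $V_A^{m,n}\cong F(m,n,-\frac{m+n}2,\frac{m-n}2)$, $V_B^{-m,n}\cong F(m,n,1+\frac{m-n}2,-\frac{m+n}2-1)$,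 $V_C^{-m,-n}\cong F(m,n,\frac{m+n}2+2,\frac{n-m}2)$, $V_D^{m,-n}\cong F(m,n,1+\frac{n-m}2,\frac{m+n}2+1)$. Set $M_X^{m,n}=U(\mathfrak g)\otimes_{U(\mathfrak g_{\ge0})}V_X^{m,n}=U(\mathfrak g_{<0})\otimes V_X^{m,n}$ ($\mathfrak g_{>0}$ acting trivially on $V_X^{m,n}$). For $u\in U(\mathfrak g_{<0})$ and linear $\phi:V_X\to V_Y$ define $(u\otimes\phi)(u'\otimes v)=u'u\otimes\phi(v)$. On $V_X$, $\partial_{x_j}$ means differentiation in $x_j$ if $X\in\{A,D\}$ and multiplication by $\partial_{x_j}$ if $X\in\{B,C\}$; $\partial_{y_j}$ means differentiation in $y_j$ if $X\in\{A,B\}$ and multiplication by $\partial_{y_j}$ if $X\in\{C,D\}$. Define $\nabla=\sum_{a,b\in\{1,2\}}w_{ab}\otimes\partial_{x_a}\partial_{y_b}$, mapping $M_X^{m,n}\to M_X^{m-1,n-1}$. Define $\nabla_2:M_A^{m,0}\to M_D^{m-2,0}$ ($m\ge2$) and $\nabla_2:M_B^{-m,0}\to M_C^{-m-2,0}$ ($m\ge0$) by $\nabla_2(u\otimes p)=uw_{11}w_{12}\otimes\partial_{x_1}^2p+u(w_{11}w_{22}+w_{21}w_{12})\otimes\partial_{x_1}\partial_{x_2}p+uw_{21}w_{22}\otimes\partial_{x_2}^2p$, the resulting polynomial in $x_1,x_2$ (resp. $\partial_{x_1},\partial_{x_2}$) regarded as an element of $V_D^{m-2,0}=\mathbb C[x_1,x_2]_{m-2}$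 (resp. $V_C^{-m-2,0}$). Define $\widetilde\nabla_2:M_A^{0,n}\to M_B^{0,n-2}$ ($n\ge2$) and $\widetilde\nabla_2:M_D^{0,-n}\to M_C^{0,-n-2}$ ($n\ge0$) by $\widetilde\nabla_2(u\otimes p)=uw_{11}w_{21}\otimes\partial_{y_1}^2p+u(w_{12}w_{21}+w_{11}w_{22})\otimes\partial_{y_1}\partial_{y_2}p+uw_{12}w_{22}\otimes\partial_{y_2}^2p$, regarded analogously. Define $\nabla_3:M_A^{0,1}\to M_C^{-1,0}$ by $\nabla_3(u\otimes(ay_1+by_2))=a\,uw_{11}w_{21}w_{12}\otimes\partial_{x_1}+a\,uw_{11}w_{21}w_{22}\otimes\partial_{x_2}+b\,u(w_{12}w_{21}+w_{11}w_{22})w_{12}\otimes\partial_{x_1}+b\,u(w_{12}w_{21}+w_{11}w_{22})w_{22}\otimes\partial_{x_2}$ and $\widetilde\nabla_3:M_A^{1,0}\to M_C^{0,-1}$ by $\widetilde\nabla_3(u\otimes(ax_1+bx_2))=a\,uw_{11}w_{12}w_{21}\otimes\partial_{y_1}+a\,uw_{11}w_{12}w_{22}\otimes\partial_{y_2}+b\,u(w_{21}w_{12}+w_{11}w_{22})w_{21}\otimes\partial_{y_1}+b\,u(w_{21}w_{12}+w_{11}w_{22})w_{22}\otimes\partial_{y_2}$ ($a,b\in\mathbb C$, $u\in U(\mathfrak g_{<0})$). The diagram $\mathcal D$ has vertices $M_A^{m,n},M_B^{-m,n},M_C^{-m,-n},M_D^{m,-n}$ ($m,n\ge0$) and arrows: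 $\nabla:M_A^{m,n}\to M_A^{m-1,n-1}$ ($m,n\ge1$); $\nabla:M_B^{-m,n}\to M_B^{-m-1,n-1}$ ($m\ge0,n\ge1$); $\nabla:M_C^{-m,-n}\to M_C^{-m-1,-n-1}$ ($m,n\ge0$); $\nabla:M_D^{m,-n}\to M_D^{m-1,-n-1}$ ($m\ge1,n\ge0$); the maps $\nabla_2,\widetilde\nabla_2$ on the ranges above; $\nabla_3$; $\widetilde\nabla_3$. These are $\mathfrak g$-module homomorphisms and composites of consecutive arrows are zero. Every vertex except $M_A^{0,0}$ has exactly one outgoing arrow and every vertex except $M_C^{0,0}$ has exactly one incoming arrow; missing arrows are taken to be zero maps when computing homology. *)

theory Defs
  imports Complex_Main
begin

text \<open>Vectors are finitely supported complex-valued functions on a basis.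
  Linear maps are given on basis vectors and extended linearly by \<open>lin\<close>.\<close>

definition dlt :: "'a \<Rightarrow> 'a \<Rightarrow> complex" where
  "dlt a = (\<lambda>b. if b = a then 1 else 0)"

definition lin :: "('a \<Rightarrow> 'b \<Rightarrow> complex) \<Rightarrow> ('a \<Rightarrow> complex) \<Rightarrow> 'b \<Rightarrow> complex" where
  "lin \<phi> f = (\<lambda>b'. \<Sum>b\<in>{b. f b \<noteq> 0}. f b * \<phi> b b')"

definition nless :: "nat set \<Rightarrow> nat \<Rightarrow> nat" where
  "nless J i = card {j\<in>J. j < i}"

definition ngt :: "nat set \<Rightarrow> nat \<Rightarrow> nat" where
  "ngt J i = card {j\<in>J. i < j}"

text \<open>\<open>\<xi>\<^sub>I \<xi>\<^sub>J = gsign I J \<xi>\<^sub>(I\<union>J)\<close> for disjoint \<open>I,J\<close>\<close>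
definition gsign :: "nat set \<Rightarrow> nat set \<Rightarrow> complex" where
  "gsign I J = (-1) ^ card {(i,j). i \<in> I \<and> j \<in> J \<and> j < i}"

subsection \<open>The Lie superalgebra g = K(1,4)_+ + CC\<close>

text \<open>Basis: \<open>GK m I\<close> stands for \<open>t^m \<xi>\<^sub>I\<close> (\<open>I \<subseteq> {1..4}\<close>), \<open>GC\<close> for the central element C.\<close>
datatype gb = GK nat "nat set" | GC

definition is_gbasis :: "gb \<Rightarrow> bool" where
  "is_gbasis x \<longleftrightarrow> x = GC \<or> (\<exists>m I. x = GK m I \<and> I \<subseteq> {1..4})"

fun gdeg :: "gb \<Rightarrow> int" where
  "gdeg (GK m I) = 2 * int m + int (card I) - 2"
| "gdeg GC = 0"

fun gpar :: "gb \<Rightarrow> nat" where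
  "gpar (GK m I) = card I mod 2"
| "gpar GC = 0"

text \<open>The cocycle psi on basis elements (super skew-symmetric extension of the
  given values).  Note \<open>\<partial>\<^sub>\<xi>\<^sub>i(\<xi>\<^sub>1\<^sub>2\<^sub>3\<^sub>4) = (-1)^(i-1) \<xi>\<^bsub>{1..4}-{i}\<^esub>\<close>.\<close>
fun psi :: "gb \<Rightarrow> gb \<Rightarrow> complex" where
  "psi (GK a I) (GK b J) =
     (if a = 0 \<and> b = 0 then
        (if I = {} \<and> J = {1,2,3,4} then -2
         else if I = {1,2,3,4} \<and> J = {} then 2
         else if card I = 1 \<and> I \<subseteq> {1..4} \<and> J = {1..4} - I then - ((-1) ^ nless {1..4} (Min I))
         else if card J = 1 \<and> J \<subseteq> {1..4} \<and> I = {1..4} - J then - ((-1) ^ nless {1..4} (Min J))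
         else 0)
      else 0)"
| "psi _ _ = 0"

text \<open>The bracket \<open>[x,y] + psi(x,y) C\<close> of two basis elements, as a vector in the basis \<open>gb\<close>.
  For \<open>f = t^a \<xi>\<^sub>I\<close>, \<open>g = t^b \<xi>\<^sub>J\<close>: \<open>[f,g] = ((2-|I|) b - a (2-|J|)) t^(a+b-1) \<xi>\<^sub>I\<xi>\<^sub>J
  + (-1)^|I| \<Sum>\<^sub>i t^(a+b) \<partial>\<^sub>i\<xi>\<^sub>I \<partial>\<^sub>i\<xi>\<^sub>J\<close>.\<close>
fun gbr :: "gb \<Rightarrow> gb \<Rightarrow> gb \<Rightarrow> complex" where
  "gbr (GK a I) (GK b J) = (\<lambda>z.
     (if I \<inter> J = {} \<and> 1 \<le> a + b \<and> z = GK (a + b - 1) (I \<union> J)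
      then of_int ((2 - int (card I)) * int b - int a * (2 - int (card J))) * gsign I J else 0)
   + (\<Sum>i\<in>I \<inter> J. if (I - {i}) \<inter> (J - {i}) = {} \<and> z = GK (a + b) ((I - {i}) \<union> (J - {i}))
        then (-1) ^ card I * (-1) ^ nless I i * (-1) ^ nless J i * gsign (I - {i}) (J - {i}) else 0)
   + (if z = GC then psi (GK a I) (GK b J) else 0))"
| "gbr _ _ = (\<lambda>z. 0)"

subsection \<open>U(g_{<0})\<close>

text \<open>PBW basis \<open>(k,J)\<close> = \<open>\<Theta>^k \<eta>\<^sub>J\<close>, \<open>\<Theta>\<close> the image of \<open>1\<in>g\<^sub>-\<^sub>2\<close> (central), \<open>\<eta>\<^sub>J\<close> the
  increasingly ordered product; relations \<open>\<eta>\<^sub>i\<eta>\<^sub>j + \<eta>\<^sub>j\<eta>\<^sub>i = [\<xi>\<^sub>i,\<xi>\<^sub>j] = -\<delta>\<^sub>i\<^sub>j \<Theta>\<close>.\<close>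
type_synonym ue = "nat \<times> nat set \<Rightarrow> complex"

definition lmul_eta_mono :: "nat \<Rightarrow> nat \<times> nat set \<Rightarrow> ue" where
  "lmul_eta_mono j kJ = (case kJ of (k, J) \<Rightarrow>
     (if j \<notin> J then (\<lambda>z. (-1) ^ nless J j * dlt (k, insert j J) z)
      else (\<lambda>z. (-1) ^ nless J j * (- 1 / 2) * dlt (k + 1, J - {j}) z)))"

definition rmul_eta_mono :: "nat \<times> nat set \<Rightarrow> nat \<Rightarrow> ue" where
  "rmul_eta_mono kJ j = (case kJ of (k, J) \<Rightarrow>
     (if j \<notin> J then (\<lambda>z. (-1) ^ ngt J j * dlt (k, insert j J) z)
      else (\<lambda>z. (-1) ^ ngt J j * (- 1 / 2) * dlt (k + 1, J - {j}) z)))"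

definition rmul_eta :: "nat \<Rightarrow> ue \<Rightarrow> ue" where
  "rmul_eta j u = lin (\<lambda>kJ. rmul_eta_mono kJ j) u"

definition umul_mono :: "nat \<times> nat set \<Rightarrow> nat \<times> nat set \<Rightarrow> ue" where
  "umul_mono p q = fold rmul_eta (sorted_list_of_set (snd q)) (dlt (fst p + fst q, snd p))"

definition umul :: "ue \<Rightarrow> ue \<Rightarrow> ue" where
  "umul u v = (\<lambda>z. \<Sum>p\<in>{p. u p \<noteq> 0}. \<Sum>q\<in>{q. v q \<noteq> 0}. u p * v q * umul_mono p q z)"

definition eta :: "nat \<Rightarrow> ue" where
  "eta j = dlt (0, {j})"

definition wgen :: "nat \<Rightarrow> nat \<Rightarrow> ue" where
  "wgen a b =
    (if a = 1 \<and> b = 1 then (\<lambda>z. eta 2 z + \<i> * eta 1 z)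
     else if a = 2 \<and> b = 2 then (\<lambda>z. eta 2 z - \<i> * eta 1 z)
     else if a = 1 \<and> b = 2 then (\<lambda>z. - eta 4 z + \<i> * eta 3 z)
     else (\<lambda>z. eta 4 z + \<i> * eta 3 z))"

datatype vlab = VA | VB | VC | VD

text \<open>Monomial \<open>(a1,a2,b1,b2)\<close>: exponents of the x-type variables (\<open>x\<^sub>1,x\<^sub>2\<close> or
  \<open>\<partial>\<^sub>x\<^sub>1,\<partial>\<^sub>x\<^sub>2\<close>) and the y-type variables (\<open>y\<^sub>1,y\<^sub>2\<close> or \<open>\<partial>\<^sub>y\<^sub>1,\<partial>\<^sub>y\<^sub>2\<close>).\<close>
type_synonym mono = "nat \<times> nat \<times> nat \<times> nat"

definition xpoly :: "vlab \<Rightarrow> bool" where "xpoly X \<longleftrightarrow> X = VA \<or> X = VD"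
definition ypoly :: "vlab \<Rightarrow> bool" where "ypoly X \<longleftrightarrow> X = VA \<or> X = VB"

datatype sl2op = Ee | Ff | Hh

text \<open>Action of \<open>e = z\<^sub>1\<partial>\<^sub>z\<^sub>2, f = z\<^sub>2\<partial>\<^sub>z\<^sub>1, h = z\<^sub>1\<partial>\<^sub>z\<^sub>1 - z\<^sub>2\<partial>\<^sub>z\<^sub>2\<close> on a monomial in
  \<open>z\<^sub>1,z\<^sub>2\<close> (if the flag is True) or in \<open>\<partial>\<^sub>z\<^sub>1,\<partial>\<^sub>z\<^sub>2\<close> (if False), as derivations.\<close>
fun sl2 :: "bool \<Rightarrow> sl2op \<Rightarrow> nat \<times> nat \<Rightarrow> nat \<times> nat \<Rightarrow> complex" where
  "sl2 True Ee (a1, a2) = (\<lambda>z. of_nat a2 * dlt (a1 + 1, a2 - 1) z)"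
| "sl2 True Ff (a1, a2) = (\<lambda>z. of_nat a1 * dlt (a1 - 1, a2 + 1) z)"
| "sl2 True Hh (a1, a2) = (\<lambda>z. (of_nat a1 - of_nat a2) * dlt (a1, a2) z)"
| "sl2 False Ee (a1, a2) = (\<lambda>z. - of_nat a1 * dlt (a1 - 1, a2 + 1) z)"
| "sl2 False Ff (a1, a2) = (\<lambda>z. - of_nat a2 * dlt (a1 + 1, a2 - 1) z)"
| "sl2 False Hh (a1, a2) = (\<lambda>z. (of_nat a2 - of_nat a1) * dlt (a1, a2) z)"

definition opx :: "vlab \<Rightarrow> sl2op \<Rightarrow> mono \<Rightarrow> mono \<Rightarrow> complex" where
  "opx X s \<alpha> = (case \<alpha> of (a1, a2, b1, b2) \<Rightarrow>
     (\<lambda>(c1, c2, d1, d2). if d1 = b1 \<and> d2 = b2 then sl2 (xpoly X) s (a1, a2) (c1, c2) else 0))"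

definition opy :: "vlab \<Rightarrow> sl2op \<Rightarrow> mono \<Rightarrow> mono \<Rightarrow> complex" where
  "opy X s \<alpha> = (case \<alpha> of (a1, a2, b1, b2) \<Rightarrow>
     (\<lambda>(c1, c2, d1, d2). if c1 = a1 \<and> c2 = a2 then sl2 (ypoly X) s (b1, b2) (d1, d2) else 0))"

definition Exv :: "vlab \<Rightarrow> mono \<Rightarrow> int" where
  "Exv X \<alpha> = (case \<alpha> of (a1, a2, b1, b2) \<Rightarrow> (if xpoly X then 1 else -1) * int (a1 + a2))"

definition Eyv :: "vlab \<Rightarrow> mono \<Rightarrow> int" where
  "Eyv X \<alpha> = (case \<alpha> of (a1, a2, b1, b2) \<Rightarrow> (if ypoly X then 1 else -1) * int (b1 + b2))"

fun iX :: "vlab \<Rightarrow> int" where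
  "iX VA = 0" | "iX VB = 1" | "iX VC = 2" | "iX VD = 1"

fun jX :: "vlab \<Rightarrow> int" where
  "jX VA = 0" | "jX VB = -1" | "jX VC = 0" | "jX VD = 1"

text \<open>Action of the degree-0 basis elements on \<open>V_X\<close>.  The elements \<open>\<xi>\<^sub>i\<^sub>j\<close> are expressed through
  \<open>e_x,f_x,h_x,e_y,f_y,h_y\<close> by inverting the formulas of the context:
  \<open>\<xi>\<^sub>1\<^sub>2 = \<i>(h_x+h_y)/2\<close>, \<open>\<xi>\<^sub>3\<^sub>4 = -\<i>(h_x-h_y)/2\<close>, \<open>\<xi>\<^sub>1\<^sub>3 = -(e_x-f_x+e_y-f_y)/2\<close>,
  \<open>\<xi>\<^sub>2\<^sub>4 = (e_y-f_y-e_x+f_x)/2\<close>, \<open>\<xi>\<^sub>2\<^sub>3 = -\<i>(e_x+f_x+e_y+f_y)/2\<close>, \<open>\<xi>\<^sub>1\<^sub>4 = \<i>(e_x+f_x-e_y-f_y)/2\<close>.\<close>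
definition g0act :: "vlab \<Rightarrow> gb \<Rightarrow> mono \<Rightarrow> mono \<Rightarrow> complex" where
  "g0act X x \<alpha> =
    (if x = GC then (\<lambda>z. (of_int (Exv X \<alpha> - Eyv X \<alpha>) / 2 + of_int (jX X)) * dlt \<alpha> z)
     else if x = GK 1 {} then (\<lambda>z. (- of_int (Exv X \<alpha> + Eyv X \<alpha>) / 2 + of_int (iX X)) * dlt \<alpha> z)
     else if x = GK 0 {1,2} then (\<lambda>z. \<i> / 2 * (opx X Hh \<alpha> z + opy X Hh \<alpha> z))
     else if x = GK 0 {3,4} then (\<lambda>z. - \<i> / 2 * (opx X Hh \<alpha> z - opy X Hh \<alpha> z))
     else if x = GK 0 {1,3} then (\<lambda>z. - 1 / 2 * (opx X Ee \<alpha> z - opx X Ff \<alpha> z + opy X Ee \<alpha> z - opy X Ff \<alpha> z))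
     else if x = GK 0 {2,4} then (\<lambda>z. 1 / 2 * (opy X Ee \<alpha> z - opy X Ff \<alpha> z - opx X Ee \<alpha> z + opx X Ff \<alpha> z))
     else if x = GK 0 {2,3} then (\<lambda>z. - \<i> / 2 * (opx X Ee \<alpha> z + opx X Ff \<alpha> z + opy X Ee \<alpha> z + opy X Ff \<alpha> z))
     else if x = GK 0 {1,4} then (\<lambda>z. \<i> / 2 * (opx X Ee \<alpha> z + opx X Ff \<alpha> z - opy X Ee \<alpha> z - opy X Ff \<alpha> z))
     else (\<lambda>z. 0))"

text \<open>Basis \<open>(k,J,\<alpha>)\<close> = \<open>\<Theta>^k \<eta>\<^sub>J \<otimes> \<alpha>\<close>.\<close>
type_synonym me = "nat \<times> nat set \<times> mono \<Rightarrow> complex"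

definition ten :: "ue \<Rightarrow> (mono \<Rightarrow> complex) \<Rightarrow> me" where
  "ten u p = (\<lambda>(k, J, \<alpha>). u (k, J) * p \<alpha>)"

text \<open>Left multiplication by a basis element of \<open>g_{<0}\<close> (\<open>\<Theta>\<close> = \<open>GK 0 {}\<close>, \<open>\<eta>\<^sub>j\<close> = \<open>GK 0 {j}\<close>).\<close>
definition lmulM :: "gb \<Rightarrow> me \<Rightarrow> me" where
  "lmulM y m =
    (if y = GK 0 {} then lin (\<lambda>(k, J, \<alpha>). dlt (k + 1, J, \<alpha>)) m
     else lin (\<lambda>(k, J, \<alpha>). ten (lmul_eta_mono (Min (case y of GK a I \<Rightarrow> I | GC \<Rightarrow> {})) (k, J)) (dlt \<alpha>)) m)"

text \<open>Action of a basis element \<open>x\<close> of \<open>g\<close> on the basis vector \<open>\<Theta>^k\<eta>\<^sub>J \<otimes> \<alpha>\<close> of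
  \<open>U(g)\<otimes>\<^bsub>U(g\<^sub>\<ge>\<^sub>0)\<^esub> V_X\<close>, computed by the super commutation rule
  \<open>x (y u \<otimes> v) = [x,y](u \<otimes> v) + (-1)^(p(x)p(y)) y (x (u \<otimes> v))\<close>, with \<open>g\<^sub>>\<^sub>0\<close> acting trivially
  and \<open>g\<^sub>0\<close> acting on \<open>V_X\<close> as given.  The first argument is fuel \<open>= k + |J|\<close>.\<close>
primrec actn :: "nat \<Rightarrow> vlab \<Rightarrow> gb \<Rightarrow> nat \<Rightarrow> nat set \<Rightarrow> mono \<Rightarrow> me" where
  "actn 0 X x k J \<alpha> =
     (if gdeg x < 0 then lmulM x (dlt (k, J, \<alpha>))
      else if gdeg x = 0 then ten (dlt (0, {})) (g0act X x \<alpha>)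
      else (\<lambda>z. 0))"
| "actn (Suc n) X x k J \<alpha> =
     (if gdeg x < 0 then lmulM x (dlt (k, J, \<alpha>))
      else if 0 < k then
        (\<lambda>z. lin (\<lambda>b. actn n X b (k - 1) J \<alpha>) (gbr x (GK 0 {})) z
             + lmulM (GK 0 {}) (actn n X x (k - 1) J \<alpha>) z)
      else
        (\<lambda>z. lin (\<lambda>b. actn n X b k (J - {Min J}) \<alpha>) (gbr x (GK 0 {Min J})) z
             + (-1) ^ gpar x * lmulM (GK 0 {Min J}) (actn n X x k (J - {Min J}) \<alpha>) z))"

definition act :: "vlab \<Rightarrow> gb \<Rightarrow> me \<Rightarrow> me" where
  "act X x m = lin (\<lambda>(k, J, \<alpha>). actn (k + card J) X x k J \<alpha>) m"

text \<open>The subspace \<open>M_X^{m,n}\<close>: vertex \<open>(X,m,n)\<close> (m,n \<ge> 0) stands for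
  \<open>M_A^{m,n}, M_B^{-m,n}, M_C^{-m,-n}, M_D^{m,-n}\<close> resp., i.e. the x-type variables
  have total degree m and the y-type variables total degree n.\<close>
type_synonym vertex = "vlab \<times> nat \<times> nat"

definition Mspace :: "vertex \<Rightarrow> me set" where
  "Mspace v = (case v of (X, m, n) \<Rightarrow>
     {f. finite {z. f z \<noteq> 0} \<and>
         (\<forall>k J a1 a2 b1 b2. f (k, J, (a1, a2, b1, b2)) \<noteq> 0 \<longrightarrow>
             J \<subseteq> {1..4} \<and> a1 + a2 = m \<and> b1 + b2 = n)})"

text \<open>A map \<open>\<Sum> r\<^sub>i \<otimes> \<phi>\<^sub>i\<close>: \<open>u \<otimes> v \<mapsto> \<Sum> u r\<^sub>i \<otimes> \<phi>\<^sub>i(v)\<close>.\<close>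
type_synonym terms = "(ue \<times> (mono \<Rightarrow> mono \<Rightarrow> complex)) list"

definition genmap :: "terms \<Rightarrow> me \<Rightarrow> me" where
  "genmap ts m = lin (\<lambda>(k, J, \<alpha>). (\<lambda>z. \<Sum>t\<leftarrow>ts. ten (umul (dlt (k, J)) (fst t)) (snd t \<alpha>) z)) m"

definition dx :: "vlab \<Rightarrow> nat \<Rightarrow> mono \<Rightarrow> mono \<Rightarrow> complex" where
  "dx X a \<alpha> = (case \<alpha> of (a1, a2, b1, b2) \<Rightarrow>
     (if xpoly X then
        (if a = 1 then (\<lambda>z. of_nat a1 * dlt (a1 - 1, a2, b1, b2) z)
         else (\<lambda>z. of_nat a2 * dlt (a1, a2 - 1, b1, b2) z))
      else
        (if a = 1 then dlt (a1 + 1, a2, b1, b2) else dlt (a1, a2 + 1, b1, b2))))"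

definition dy :: "vlab \<Rightarrow> nat \<Rightarrow> mono \<Rightarrow> mono \<Rightarrow> complex" where
  "dy X a \<alpha> = (case \<alpha> of (a1, a2, b1, b2) \<Rightarrow>
     (if ypoly X then
        (if a = 1 then (\<lambda>z. of_nat b1 * dlt (a1, a2, b1 - 1, b2) z)
         else (\<lambda>z. of_nat b2 * dlt (a1, a2, b1, b2 - 1) z))
      else
        (if a = 1 then dlt (a1, a2, b1 + 1, b2) else dlt (a1, a2, b1, b2 + 1))))"

definition lcomp :: "(mono \<Rightarrow> mono \<Rightarrow> complex) \<Rightarrow> (mono \<Rightarrow> mono \<Rightarrow> complex) \<Rightarrow> mono \<Rightarrow> mono \<Rightarrow> complex" where
  "lcomp \<phi> \<psi> \<alpha> = lin \<psi> (\<phi> \<alpha>)"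

definition uadd :: "ue \<Rightarrow> ue \<Rightarrow> ue" where
  "uadd u v = (\<lambda>z. u z + v z)"

definition nabla :: "vlab \<Rightarrow> terms" where
  "nabla X = [(wgen a b, lcomp (dx X a) (dy X b)). a \<leftarrow> [1,2], b \<leftarrow> [1,2]]"

definition nabla2 :: "vlab \<Rightarrow> terms" where
  "nabla2 X =
    [(umul (wgen 1 1) (wgen 1 2), lcomp (dx X 1) (dx X 1)),
     (uadd (umul (wgen 1 1) (wgen 2 2)) (umul (wgen 2 1) (wgen 1 2)), lcomp (dx X 1) (dx X 2)),
     (umul (wgen 2 1) (wgen 2 2), lcomp (dx X 2) (dx X 2))]"

definition nabla2t :: "vlab \<Rightarrow> terms" where
  "nabla2t X =
    [(umul (wgen 1 1) (wgen 2 1), lcomp (dy X 1) (dy X 1)),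
     (uadd (umul (wgen 1 2) (wgen 2 1)) (umul (wgen 1 1) (wgen 2 2)), lcomp (dy X 1) (dy X 2)),
     (umul (wgen 1 2) (wgen 2 2), lcomp (dy X 2) (dy X 2))]"

definition sel :: "mono \<Rightarrow> mono \<Rightarrow> mono \<Rightarrow> mono \<Rightarrow> complex" where
  "sel \<beta> \<gamma> \<alpha> = (if \<alpha> = \<beta> then dlt \<gamma> else (\<lambda>z. 0))"

text \<open>\<open>\<nabla>\<^sub>3 : M_A^{0,1} \<rightarrow> M_C^{-1,0}\<close>; \<open>y\<^sub>1 = (0,0,1,0)\<close>, \<open>y\<^sub>2 = (0,0,0,1)\<close>,
  \<open>\<partial>\<^sub>x\<^sub>1 = (1,0,0,0)\<close>, \<open>\<partial>\<^sub>x\<^sub>2 = (0,1,0,0)\<close> in \<open>V_C\<close>.\<close>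
definition nabla3 :: terms where
  "nabla3 =
    [(umul (umul (wgen 1 1) (wgen 2 1)) (wgen 1 2), sel (0,0,1,0) (1,0,0,0)),
     (umul (umul (wgen 1 1) (wgen 2 1)) (wgen 2 2), sel (0,0,1,0) (0,1,0,0)),
     (umul (uadd (umul (wgen 1 2) (wgen 2 1)) (umul (wgen 1 1) (wgen 2 2))) (wgen 1 2), sel (0,0,0,1) (1,0,0,0)),
     (umul (uadd (umul (wgen 1 2) (wgen 2 1)) (umul (wgen 1 1) (wgen 2 2))) (wgen 2 2), sel (0,0,0,1) (0,1,0,0))]"

text \<open>\<open>\<nabla>\<^sub>3~ : M_A^{1,0} \<rightarrow> M_C^{0,-1}\<close>; \<open>x\<^sub>1 = (1,0,0,0)\<close>, \<open>x\<^sub>2 = (0,1,0,0)\<close>,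
  \<open>\<partial>\<^sub>y\<^sub>1 = (0,0,1,0)\<close>, \<open>\<partial>\<^sub>y\<^sub>2 = (0,0,0,1)\<close> in \<open>V_C\<close>.\<close>
definition nabla3t :: terms where
  "nabla3t =
    [(umul (umul (wgen 1 1) (wgen 1 2)) (wgen 2 1), sel (1,0,0,0) (0,0,1,0)),
     (umul (umul (wgen 1 1) (wgen 1 2)) (wgen 2 2), sel (1,0,0,0) (0,0,0,1)),
     (umul (uadd (umul (wgen 2 1) (wgen 1 2)) (umul (wgen 1 1) (wgen 2 2))) (wgen 2 1), sel (0,1,0,0) (0,0,1,0)),
     (umul (uadd (umul (wgen 2 1) (wgen 1 2)) (umul (wgen 1 1) (wgen 2 2))) (wgen 2 2), sel (0,1,0,0) (0,0,0,1))]"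

fun outarrow :: "vertex \<Rightarrow> (vertex \<times> terms) option" where
  "outarrow (VA, m, n) =
     (if 1 \<le> m \<and> 1 \<le> n then Some ((VA, m - 1, n - 1), nabla VA)
      else if 2 \<le> m \<and> n = 0 then Some ((VD, m - 2, 0), nabla2 VA)
      else if m = 0 \<and> 2 \<le> n then Some ((VB, 0, n - 2), nabla2t VA)
      else if m = 0 \<and> n = 1 then Some ((VC, 1, 0), nabla3)
      else if m = 1 \<and> n = 0 then Some ((VC, 0, 1), nabla3t)
      else None)"
| "outarrow (VB, m, n) =
     (if 1 \<le> n then Some ((VB, m + 1, n - 1), nabla VB) else Some ((VC, m + 2, 0), nabla2 VB))"
| "outarrow (VC, m, n) = Some ((VC, m + 1, n + 1), nabla VC)"
| "outarrow (VD, m, n) =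
     (if 1 \<le> m then Some ((VD, m - 1, n + 1), nabla VD) else Some ((VC, 0, n + 2), nabla2t VD))"

text \<open>Kernel of the outgoing arrow (the whole space if there is none) and image of the
  incoming arrow(s) (together with 0, so that it is \<open>{0}\<close> if there is none).\<close>
definition Ker :: "vertex \<Rightarrow> me set" where
  "Ker v = {f \<in> Mspace v. case outarrow v of None \<Rightarrow> True | Some (v', ts) \<Rightarrow> genmap ts f = (\<lambda>z. 0)}"

definition Img :: "vertex \<Rightarrow> me set" where
  "Img v = {\<lambda>z. 0} \<union> {genmap ts g | v' ts g. outarrow v' = Some (v, ts) \<and> g \<in> Mspace v'}"

definition homology_zero :: "vertex \<Rightarrow> bool" where
  "homology_zero v \<longleftrightarrow> Ker v \<subseteq> Img v"

text \<open>Homology at \<open>v = (X,m,n)\<close> is isomorphic to the one-dimensional trivial g-module: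
  \<open>Ker v / Img v\<close> is spanned by the class of one vector \<open>w\<close> which is nonzero in the quotient,
  and every basis element of g maps \<open>w\<close> into \<open>Img v\<close>.\<close>
definition homology_trivial1 :: "vertex \<Rightarrow> bool" where
  "homology_trivial1 v \<longleftrightarrow>
     (\<exists>w\<in>Ker v. w \<notin> Img v \<and>
        (\<forall>f\<in>Ker v. \<exists>c g. g \<in> Img v \<and> f = (\<lambda>z. c * w z + g z)) \<and>
        (\<forall>x. is_gbasis x \<longrightarrow> act (fst v) x w \<in> Img v))"

end

(*
Right multiplication by the w_ab makes U(g_<0) a module over a Clifford algebra over C[Theta].  The
operators P_a = sum_b w_ab d/dy_b (a = 1, 2) anticommute and have square zero, so
nabla = d/dx_1 P_1 + d/dx_2 P_2 is a Tate complex of the exterior algebra on P_1, P_2, and the maps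
nabla_2~ = P_1 P_2 splice its two halves.  Such a complex is exact as soon as P_i u = 0 implies
u in im P_i, and P_1 P_2 u = 0 implies u in im P_1 + im P_2.  The first property is the same statement
one level down, for (w_a1, w_a2) in place of (P_1, P_2).  The second follows from the first by induction
on the number of factors w_2b: from P_1 P_2 u = 0 one gets P_1 u = P_2 h with h of lower filtration degree
and P_1 P_2 h = 0.  Exchanging x and y, i.e. w_12 and w_21, gives the maps nabla_2.  At the finitely many
vertices where the degrees are too small for this, a cycle is prolonged to a cycle at a neighbouring
vertex that is already known to be exact.

At M_C^{-1,-1} the prolongation leaves one extra class.  It is generated by the w with
Theta w = nabla(eta_1 eta_2 eta_3 eta_4), and x w = nabla(x eta_1 eta_2 eta_3 eta_4 / Theta) for the basis
elements x of g for which x w is nonzero; the other products are zero by degree or by direct computation.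
*)
theory Submission
  imports Defs "HOL-Library.Function_Algebras"
begin

subsection \<open>Tate complexes of two anticommuting maps\<close>

text \<open>After rescaling by divided powers, differentiation in a polynomial variable lowers an
  index and multiplication by a dual variable raises it. The quadrants A, B, C, D thus become the
  four nestings of \<open>lower\<close> and \<open>raise\<close>: an inner level for the y-variables
  with the w_ab as coefficients, an outer one for the x-variables with two maps of the inner level
  as coefficients. The sum of all anticommutators, w_11 w_22 + w_22 w_11 + w_12 w_21 + w_21 w_12, is
  zero, and this is what makes those two maps anticommute. The anticommutator of w_11 and w_22 alone
  is -2 Theta, which acts injectively, so an element killed by both w_11 and w_22 is zero. The
  obstacle is low degree. Lowering maps are exact only in positive degree, so the statement on im
  P_1 + im P_2 needs y-degree at least two; for raising maps it needs degree at least one. Since x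
  and y may be exchanged, one of the two degrees being large is enough. What remains are the A- and
  C-vertices with m, n <= 1 and the vertices (0,0) of B and D.\<close>

definition lower :: "('a::ab_group_add \<Rightarrow> 'b::ab_group_add) \<Rightarrow> ('a \<Rightarrow> 'b) \<Rightarrow> (nat \<Rightarrow> nat \<Rightarrow> 'a) \<Rightarrow> nat \<Rightarrow> nat \<Rightarrow> 'b" where
  "lower p q f = (\<lambda>i j. p (f (Suc i) j) + q (f i (Suc j)))"

text \<open>With \<open>f i j\<close> as coefficient of X^i Y^j this is multiplication by p X + q Y.
  In the same way \<open>lower\<close> is p d/dX + q d/dY on divided powers, where differentiation
  carries no numerical factor.\<close>

definition raise :: "('a::ab_group_add \<Rightarrow> 'b::ab_group_add) \<Rightarrow> ('a \<Rightarrow> 'b) \<Rightarrow> (nat \<Rightarrow> nat \<Rightarrow> 'a) \<Rightarrow> nat \<Rightarrow> nat \<Rightarrow> 'b" where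
  "raise p q f = (\<lambda>i j. (if i = 0 then 0 else p (f (i - 1) j)) + (if j = 0 then 0 else q (f i (j - 1))))"

definition homog :: "nat \<Rightarrow> 'a set \<Rightarrow> (nat \<Rightarrow> nat \<Rightarrow> 'a::ab_group_add) set" where
  "homog m S = {f. \<forall>i j. (i + j = m \<longrightarrow> f i j \<in> S) \<and> (i + j \<noteq> m \<longrightarrow> f i j = 0)}"

abbreviation "Fam1 n \<equiv> homog n UNIV"
abbreviation "Fam m n \<equiv> homog m (Fam1 n)"

definition subgrp :: "'a::ab_group_add set \<Rightarrow> bool" where
  "subgrp S \<longleftrightarrow> 0 \<in> S \<and> (\<forall>x\<in>S. \<forall>y\<in>S. x - y \<in> S)"

lemma subgrp_zero: "subgrp S \<Longrightarrow> 0 \<in> S"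
  and subgrp_diff: "subgrp S \<Longrightarrow> x \<in> S \<Longrightarrow> y \<in> S \<Longrightarrow> x - y \<in> S"
  by (auto simp: subgrp_def)

lemma subgrp_uminus: "subgrp S \<Longrightarrow> x \<in> S \<Longrightarrow> - x \<in> S"
  by (metis subgrp_def diff_0)

lemma subgrp_add: "subgrp S \<Longrightarrow> x \<in> S \<Longrightarrow> y \<in> S \<Longrightarrow> x + y \<in> S"
  by (metis subgrp_def diff_minus_eq_add subgrp_uminus)

lemma subgrp_UNIV [simp]: "subgrp UNIV"
  by (simp add: subgrp_def)

lemma subgrp_homog: "subgrp S \<Longrightarrow> subgrp (homog m S)"
  by (auto simp: subgrp_def homog_def)

lemma homog_in: "f \<in> homog m S \<Longrightarrow> i + j = m \<Longrightarrow> f i j \<in> S"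
  and homog_out: "f \<in> homog m S \<Longrightarrow> i + j \<noteq> m \<Longrightarrow> f i j = 0"
  by (auto simp: homog_def)

lemma homog_ext:
  assumes "f \<in> homog m S" "g \<in> homog m T" "\<And>i. i \<le> m \<Longrightarrow> f i (m - i) = g i (m - i)"
  shows "f = g"
proof (intro ext)
  fix i j show "f i j = g i j"
  proof (cases "i + j = m")
    case True
    then have "i \<le> m" "j = m - i" by auto
    with assms(3) show ?thesis by simp
  next
    case False with assms(1,2) show ?thesis by (simp add: homog_out)
  qed
qed

locale anticomm_pair =
  fixes p q :: "'a::ab_group_add \<Rightarrow> 'a"
  assumes p_add: "p (x + y) = p x + p y" and q_add: "q (x + y) = q x + q y"
    and pp: "p (p x) = 0" and qq: "q (q x) = 0" and pq: "p (q x) = - q (p x)"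
begin

lemma p_zero [simp]: "p 0 = 0" using p_add[of 0 0] by simp
lemma q_zero [simp]: "q 0 = 0" using q_add[of 0 0] by simp
lemma p_minus: "p (- x) = - p x" using p_add[of x "- x"] by (simp add: eq_neg_iff_add_eq_0 add.commute)
lemma q_minus: "q (- x) = - q x" using q_add[of x "- x"] by (simp add: eq_neg_iff_add_eq_0 add.commute)
lemma p_diff: "p (x - y) = p x - p y" using p_add[of x "- y"] by (simp add: p_minus)
lemma q_diff: "q (x - y) = q x - q y" using q_add[of x "- y"] by (simp add: q_minus)

lemma lower_lower: "lower p q (lower p q f) = 0"
  by (intro ext) (simp add: lower_def p_add q_add pp qq pq)

lemma raise_raise: "raise p q (raise p q f) = 0"
  by (intro ext) (auto simp: raise_def p_add q_add pp qq pq)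

lemma lower_homog:
  assumes "f \<in> homog (Suc m) T" "subgrp S" "\<And>x. x \<in> T \<Longrightarrow> p x \<in> S" "\<And>x. x \<in> T \<Longrightarrow> q x \<in> S"
  shows "lower p q f \<in> homog m S"
  using assms unfolding homog_def lower_def by (auto intro!: subgrp_add)

lemma raise_homog:
  assumes "f \<in> homog m T" "subgrp S" "\<And>x. x \<in> T \<Longrightarrow> p x \<in> S" "\<And>x. x \<in> T \<Longrightarrow> q x \<in> S"
  shows "raise p q f \<in> homog (Suc m) S"
  using assms unfolding homog_def raise_def by (auto intro!: subgrp_add intro: subgrp_zero)

text \<open>The entries of \<open>g\<close> are found from i = 0 upward. Entry 0 lies in the kernel
  of p q, so \<open>ex2\<close> starts the process; each later defect is killed by p, so
  \<open>ex1\<close> continues it. \<open>cyc0\<close> covers the vertex whose outgoing arrow is the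
  splice map instead of \<open>lower\<close>.\<close>

lemma tateA:
  assumes S: "subgrp S" and T: "subgrp T"
    and pT: "\<And>x. x \<in> T \<Longrightarrow> p x \<in> S" and qT: "\<And>x. x \<in> T \<Longrightarrow> q x \<in> S"
    and ex1: "\<And>u. u \<in> S \<Longrightarrow> p u = 0 \<Longrightarrow> \<exists>h\<in>T. u = p h"
    and ex2: "\<And>u. u \<in> S \<Longrightarrow> p (q u) = 0 \<Longrightarrow> \<exists>a\<in>T. \<exists>b\<in>T. u = p a + q b"
    and f: "f \<in> homog m S"
    and cyc0: "m = 0 \<Longrightarrow> p (q (f 0 0)) = 0" and cyc: "m > 0 \<Longrightarrow> lower p q f = 0"
  shows "\<exists>g\<in>homog (Suc m) T. f = lower p q g"
proof -
  \<comment> \<open>For m > 0 the cycle equation at (0, m - 1) says that q (f 0 m) is in the image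
    of p, so the splice condition holds in every degree.\<close>
  have c0: "p (q (f 0 m)) = 0"
  proof (cases "m = 0")
    case True then show ?thesis using cyc0 by simp
  next
    case False
    then have "lower p q f 0 (m - 1) = 0" using cyc by simp
    then have "p (f 1 (m - 1)) + q (f 0 m) = 0" using False by (simp add: lower_def)
    then have "q (f 0 m) = - p (f 1 (m - 1))" by (simp add: eq_neg_iff_add_eq_0 add.commute)
    then show ?thesis by (simp add: p_minus pp)
  qed
  have "\<exists>g\<in>homog (Suc m) T. \<forall>i\<le>r. f i (m - i) = lower p q g i (m - i)" if "r \<le> m" for r
    using that
  proof (induction r)
    case 0
    have "f 0 m \<in> S" using f by (simp add: homog_in)
    from ex2[OF this c0] obtain a b where ab: "a \<in> T" "b \<in> T" "f 0 m = p a + q b" by blast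
    define g where "g = (\<lambda>(i::nat) (j::nat). if i = 1 \<and> j = m then a else if i = 0 \<and> j = Suc m then b else (0::'a))"
    have "g \<in> homog (Suc m) T" using ab subgrp_zero[OF T] by (auto simp: homog_def g_def)
    moreover have "f 0 m = lower p q g 0 m" using ab by (simp add: lower_def g_def)
    ultimately show ?case by (intro bexI[of _ g]) auto
  next
    case (Suc r)
    then obtain g where g: "g \<in> homog (Suc m) T" and eq: "\<forall>i\<le>r. f i (m - i) = lower p q g i (m - i)" by auto
    define k where "k = m - Suc r"
    have mk: "m = Suc (r + k)" using Suc.prems k_def by simp
    define h where "h = f (Suc r) k - lower p q g (Suc r) k"
    have dg: "lower p q g \<in> homog m S" using lower_homog[OF g S pT qT] by blast
    have hS: "h \<in> S" unfolding h_def using f dg mk by (intro subgrp_diff[OF S]) (auto intro: homog_in)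
    \<comment> \<open>Both \<open>f\<close> and \<open>lower p q g\<close> satisfy the cycle
      equation at (r, k) and they agree at (r, Suc k); so p kills their difference at (Suc r,
      k).\<close>
    have "lower p q f r k = 0" using cyc mk by simp
    then have "p (f (Suc r) k) + q (f r (Suc k)) = 0" by (simp add: lower_def)
    moreover have "lower p q (lower p q g) r k = 0" by (simp add: lower_lower)
    then have "p (lower p q g (Suc r) k) + q (lower p q g r (Suc k)) = 0"
      unfolding lower_def[of p q "lower p q g"] .
    moreover have "f r (Suc k) = lower p q g r (Suc k)" using eq[rule_format, of r] mk by simp
    ultimately have "p (f (Suc r) k) = p (lower p q g (Suc r) k)"
      by (simp add: add_eq_0_iff2)
    then have "p h = 0" by (simp add: h_def p_diff)
    then obtain c where c: "c \<in> T" "h = p c" using ex1 hS by blast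
    \<comment> \<open>An entry added at (r + 2, k) contributes p c at index r + 1, and otherwise
      only at index r + 2, so the equations already solved survive.\<close>
    define g' where "g' = (\<lambda>i j. if i = Suc (Suc r) \<and> j = k then g i j + c else g i j)"
    have "g' \<in> homog (Suc m) T" using g c mk by (auto simp: g'_def homog_def intro: subgrp_add[OF T])
    moreover have "f i (m - i) = lower p q g' i (m - i)" if "i \<le> Suc r" for i
    proof (cases "i = Suc r")
      case True
      have "lower p q g' (Suc r) k = lower p q g (Suc r) k + h"
        by (simp add: lower_def g'_def p_add c)
      then show ?thesis using True mk by (simp add: h_def)
    next
      case False
      then have "i \<le> r" using that by simp
      moreover have "lower p q g' i (m - i) = lower p q g i (m - i)" using \<open>i \<le> r\<close> by (auto simp: lower_def g'_def)
      ultimately show ?thesis using eq by simp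
    qed
    ultimately show ?case by blast
  qed
  then obtain g where g: "g \<in> homog (Suc m) T" "\<forall>i\<le>m. f i (m - i) = lower p q g i (m - i)" by blast
  then show ?thesis using homog_ext[OF f lower_homog[OF g(1) S pT qT]] by blast
qed

text \<open>Dual to \<open>tateA\<close>: exactness of q repairs the entries i = 0, ..., n in turn.
  For the last entry, i = Suc n, no free coefficient is left. Its defect is killed by p and by q,
  and \<open>ex3\<close> provides a correction c with q c = 0, which leaves entry n intact.\<close>

lemma tateC:
  assumes S: "subgrp S" and T: "subgrp T"
    and pT: "\<And>x. x \<in> T \<Longrightarrow> p x \<in> S" and qT: "\<And>x. x \<in> T \<Longrightarrow> q x \<in> S"
    and ex1: "\<And>u. u \<in> S \<Longrightarrow> q u = 0 \<Longrightarrow> \<exists>h\<in>T. u = q h"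
    and ex3: "\<And>u. u \<in> S \<Longrightarrow> p u = 0 \<Longrightarrow> q u = 0 \<Longrightarrow> \<exists>h\<in>T. u = p h \<and> q h = 0"
    and f: "f \<in> homog (Suc n) S"
    and cyc: "raise p q f = 0"
  shows "\<exists>g\<in>homog n T. f = raise p q g"
proof -
  have cf: "(if i = 0 then 0 else p (f (i - 1) j)) + (if j = 0 then 0 else q (f i (j - 1))) = 0" for i j
    using fun_cong[OF fun_cong[OF cyc, of i], of j] by (simp only: raise_def zero_fun_def)
  have cg: "(if i = 0 then 0 else p (raise p q g (i - 1) j)) + (if j = 0 then 0 else q (raise p q g i (j - 1))) = 0" for g i j
    using fun_cong[OF fun_cong[OF raise_raise[of g], of i], of j] by (simp only: raise_def[of p q "raise p q g"] zero_fun_def)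
  have qh: "q (f r k - raise p q g r k) = 0"
    if "r > 0 \<Longrightarrow> f (r - 1) (Suc k) = raise p q g (r - 1) (Suc k)" for g r k
    using cf[of r "Suc k"] cg[of r g "Suc k"] that by (cases "r = 0") (auto simp: q_diff add_eq_0_iff)
  have dg: "g \<in> homog n T \<Longrightarrow> raise p q g \<in> homog (Suc n) S" for g using raise_homog[OF _ S pT qT] by blast
  have "\<exists>g\<in>homog n T. \<forall>i<r. f i (Suc n - i) = raise p q g i (Suc n - i)" if "r \<le> Suc n" for r
    using that
  proof (induction r)
    case 0
    show ?case using subgrp_zero[OF subgrp_homog[OF T]] by blast
  next
    case (Suc r)
    then obtain g where g: "g \<in> homog n T" and eq: "\<forall>i<r. f i (Suc n - i) = raise p q g i (Suc n - i)" by auto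
    define k where "k = n - r"
    have nk: "n = r + k" using Suc.prems k_def by simp
    define h where "h = f r (Suc k) - raise p q g r (Suc k)"
    have "h \<in> S" unfolding h_def using f dg[OF g] nk by (intro subgrp_diff[OF S]) (auto intro: homog_in)
    moreover have "q h = 0" unfolding h_def
    proof (rule qh)
      assume "r > 0"
      then show "f (r - 1) (Suc (Suc k)) = raise p q g (r - 1) (Suc (Suc k))"
        using eq[rule_format, of "r - 1"] nk by (simp add: Suc_diff_le)
    qed
    ultimately obtain c where c: "c \<in> T" "h = q c" using ex1 by blast
    define g' where "g' = (\<lambda>i j. if i = r \<and> j = k then g i j + c else g i j)"
    have "g' \<in> homog n T" using g c nk by (auto simp: g'_def homog_def intro: subgrp_add[OF T])
    moreover have "f i (Suc n - i) = raise p q g' i (Suc n - i)" if "i < Suc r" for i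
    proof (cases "i = r")
      case True
      have "raise p q g' r (Suc k) = raise p q g r (Suc k) + h"
        by (simp add: raise_def g'_def q_add c)
      then show ?thesis using True nk by (simp add: h_def)
    next
      case False
      then have "i < r" using that by simp
      moreover have "raise p q g' i (Suc n - i) = raise p q g i (Suc n - i)" using \<open>i < r\<close> by (auto simp: raise_def g'_def)
      ultimately show ?thesis using eq by simp
    qed
    ultimately show ?case by blast
  qed
  then obtain g where g: "g \<in> homog n T" and eq: "\<forall>i<Suc n. f i (Suc n - i) = raise p q g i (Suc n - i)" by blast
  define h where "h = f (Suc n) 0 - raise p q g (Suc n) 0"
  have "h \<in> S" unfolding h_def using f dg[OF g] by (intro subgrp_diff[OF S]) (auto intro: homog_in)
  moreover have "q h = 0" unfolding h_def by (rule qh) (use eq[rule_format, of n] in auto)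
  moreover have "p h = 0" using cf[of "Suc (Suc n)" 0] cg[of "Suc (Suc n)" g 0] by (simp add: h_def p_diff)
  ultimately obtain c where c: "c \<in> T" "h = p c" "q c = 0" using ex3 by blast
  define g' where "g' = (\<lambda>i j. if i = n \<and> j = 0 then g i j + c else g i j)"
  have g': "g' \<in> homog n T" using g c by (auto simp: g'_def homog_def intro: subgrp_add[OF T])
  have "f i (Suc n - i) = raise p q g' i (Suc n - i)" if "i \<le> Suc n" for i
  proof (cases "i = Suc n")
    case True
    have "raise p q g' (Suc n) 0 = raise p q g (Suc n) 0 + h"
      by (simp add: raise_def g'_def p_add c)
    then show ?thesis using True by (simp add: h_def)
  next
    case False
    then have i: "i < Suc n" using that by simp
    moreover have "raise p q g' i (Suc n - i) = raise p q g i (Suc n - i)"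
      using i c(3) by (auto simp: raise_def g'_def q_add)
    ultimately show ?thesis using eq by simp
  qed
  then show ?thesis using homog_ext[OF f dg[OF g']] g' by blast
qed

text \<open>From p (q f) = 0 one gets p f = q h with h one filtration step lower, and again p (q h)
  = 0. If h = p a + q b by induction, then p (f + q a) = 0, hence f + q a = p c. The sets
  \<open>Y j\<close> are separate from \<open>X j\<close> because p changes the degree of a
  family.\<close>

lemma ex2_filtered:
  assumes X0: "X 0 \<subseteq> {0}" and XY: "\<And>j f. f \<in> X j \<Longrightarrow> p f \<in> Y j"
    and exq: "\<And>j y. y \<in> Y (Suc j) \<Longrightarrow> q y = 0 \<Longrightarrow> \<exists>h\<in>X j. y = q h"
    and exp: "\<And>u. u \<in> N \<Longrightarrow> p u = 0 \<Longrightarrow> \<exists>c\<in>Z. u = p c"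
    and XN: "\<And>j. X j \<subseteq> N" and N: "subgrp N" and Z: "subgrp Z"
    and qZ: "\<And>x. x \<in> Z \<Longrightarrow> q x \<in> N"
    and f: "f \<in> X j" "p (q f) = 0"
  shows "\<exists>a\<in>Z. \<exists>b\<in>Z. f = p a + q b"
  using f
proof (induction j arbitrary: f)
  case 0
  then have "f = 0" using X0 by blast
  then show ?case using subgrp_zero[OF Z] by (intro bexI[of _ 0]) auto
next
  case (Suc j)
  have "q (p f) = 0" using Suc.prems(2) pq[of f] by simp
  then obtain h where h: "h \<in> X j" "p f = q h" using exq[OF XY[OF Suc.prems(1)]] by blast
  have "p (q h) = 0" using h(2) pp[of f] by simp
  then obtain a b where ab: "a \<in> Z" "b \<in> Z" "h = p a + q b" using Suc.IH[OF h(1)] by blast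
  have "p (f + q a) = 0" using h(2) by (simp add: p_add ab(3) q_add qq pq)
  moreover have "f + q a \<in> N" using Suc.prems(1) XN qZ[OF ab(1)] by (intro subgrp_add[OF N]) auto
  ultimately obtain c where c: "c \<in> Z" "f + q a = p c" using exp by blast
  have "f = p c + q (- a)" using c(2) by (simp add: q_minus eq_diff_eq)
  then show ?case using c(1) subgrp_uminus[OF Z ab(1)] by blast
qed

end

subsection \<open>Exactness over the Clifford algebra\<close>

text \<open>The \<open>d\<^sub>a\<^sub>b\<close> are contractions dual to the \<open>w\<^sub>a\<^sub>b\<close>; they replace freeness over the exterior subalgebras.\<close>
locale cliff =
  fixes w11 w12 w21 w22 d11 d12 d21 d22 :: "'u::ab_group_add \<Rightarrow> 'u"
  assumes w_add: "w11 (x + y) = w11 x + w11 y" "w12 (x + y) = w12 x + w12 y"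
      "w21 (x + y) = w21 x + w21 y" "w22 (x + y) = w22 x + w22 y"
    and d_add: "d11 (x + y) = d11 x + d11 y" "d12 (x + y) = d12 x + d12 y"
      "d21 (x + y) = d21 x + d21 y" "d22 (x + y) = d22 x + d22 y"
    and w_sq: "w11 (w11 x) = 0" "w12 (w12 x) = 0" "w21 (w21 x) = 0" "w22 (w22 x) = 0"
    and w_anti: "w12 (w11 x) = - w11 (w12 x)" "w21 (w11 x) = - w11 (w21 x)"
      "w22 (w12 x) = - w12 (w22 x)" "w22 (w21 x) = - w21 (w22 x)"
    and w_hyp: "w11 (w22 x) + w22 (w11 x) + (w12 (w21 x) + w21 (w12 x)) = 0"
    and w_tors: "w11 (w22 x) + w22 (w11 x) = 0 \<Longrightarrow> x = 0"
    and dw1: "d11 (w11 x) = x - w11 (d11 x)" "d12 (w12 x) = x - w12 (d12 x)"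
      "d21 (w21 x) = x - w21 (d21 x)" "d22 (w22 x) = x - w22 (d22 x)"
    and dw0: "d11 (w12 x) = - w12 (d11 x)" "d11 (w21 x) = - w21 (d11 x)" "d11 (w22 x) = - w22 (d11 x)"
      "d12 (w11 x) = - w11 (d12 x)" "d12 (w21 x) = - w21 (d12 x)" "d12 (w22 x) = - w22 (d12 x)"
      "d21 (w11 x) = - w11 (d21 x)" "d21 (w12 x) = - w12 (d21 x)" "d21 (w22 x) = - w22 (d21 x)"
      "d22 (w11 x) = - w11 (d22 x)" "d22 (w12 x) = - w12 (d22 x)" "d22 (w21 x) = - w21 (d22 x)"
    and dd: "d21 (d21 x) = 0" "d22 (d22 x) = 0" "d22 (d21 x) = - d21 (d22 x)"
      "d12 (d12 x) = 0" "d22 (d12 x) = - d12 (d22 x)"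
begin

text \<open>This is the exchange of x and y. The relations between \<open>d12\<close> and
  \<open>d22\<close> in the locale are those between \<open>d21\<close> and \<open>d22\<close> after
  the exchange; they carry the filtration of the exchanged structure.\<close>

lemma cliff_swap: "cliff w11 w21 w12 w22 d11 d21 d12 d22"
proof
  fix x
  show "w11 (w22 x) + w22 (w11 x) + (w21 (w12 x) + w12 (w21 x)) = 0"
    using w_hyp[of x] by (simp add: add_ac)
  show "x = 0" if "w11 (w22 x) + w22 (w11 x) = 0" using w_tors that .
qed (fact w_add d_add w_sq w_anti dw1 dw0 dd)+

lemma additive_lemmas:
  fixes f :: "'u \<Rightarrow> 'u"
  assumes "\<And>x y. f (x + y) = f x + f y"
  shows "f 0 = 0" "f (- x) = - f x" "f (x - y) = f x - f y"
proof -
  have "f (0 + 0) = f 0 + f 0" by (rule assms)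
  then have "f 0 = f 0 + f 0" unfolding add_0_right .
  then show z: "f 0 = 0" by (simp only: add_cancel_right_right)
  show m: "f (- x) = - f x" for x
    using assms[of x "- x"] z by (simp add: eq_neg_iff_add_eq_0 add.commute)
  show "f (x - y) = f x - f y" using assms[of x "- y"] by (simp add: m)
qed

lemmas w_lin [simp] = w_add additive_lemmas[of w11, OF w_add(1)] additive_lemmas[of w12, OF w_add(2)]
  additive_lemmas[of w21, OF w_add(3)] additive_lemmas[of w22, OF w_add(4)]
lemmas d_lin [simp] = d_add additive_lemmas[of d11, OF d_add(1)] additive_lemmas[of d12, OF d_add(2)]
  additive_lemmas[of d21, OF d_add(3)] additive_lemmas[of d22, OF d_add(4)]

lemma d_zero: "d11 0 = 0" "d12 0 = 0" "d21 0 = 0" "d22 0 = 0" by simp_all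

text \<open>In the enveloping algebra this is 2 Theta, and \<open>w_hyp\<close> says that
  \<open>w11\<close> and \<open>w22\<close> have anticommutator - T.\<close>

definition T :: "'u \<Rightarrow> 'u" where "T x = w12 (w21 x) + w21 (w12 x)"

lemma T_lin [simp]: "T 0 = 0" "T (x + y) = T x + T y" "T (- x) = - T x" "T (x - y) = T x - T y"
  by (simp_all add: T_def)

lemma w_T: "w21 (w12 x) = T x - w12 (w21 x)" "w22 (w11 x) = - T x - w11 (w22 x)"
proof -
  show "w21 (w12 x) = T x - w12 (w21 x)" by (simp add: T_def)
  have "w22 (w11 x) + w11 (w22 x) + T x = 0" using w_hyp[of x] by (simp add: T_def add_ac)
  then show "w22 (w11 x) = - T x - w11 (w22 x)" by (simp only: eq_diff_eq eq_neg_iff_add_eq_0)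
qed

text \<open>T is an anticommutator in two ways. Written in \<open>w12\<close>, \<open>w21\<close> it
  visibly commutes with \<open>w11\<close> and \<open>w22\<close>, which anticommute with both;
  written in \<open>w11\<close>, \<open>w22\<close> it commutes with \<open>w12\<close> and
  \<open>w21\<close>.\<close>

lemma w_T_comm: "w11 (T x) = T (w11 x)" "w22 (T x) = T (w22 x)" "w12 (T x) = T (w12 x)" "w21 (T x) = T (w21 x)"
proof -
  show "w11 (T x) = T (w11 x)" "w22 (T x) = T (w22 x)"
    by (simp_all add: T_def w_anti)
  have *: "T y = - w11 (w22 y) - w22 (w11 y)" for y by (simp add: w_T(2))
  have "w12 (w22 y) = - w22 (w12 y)" "w21 (w22 y) = - w22 (w21 y)" for y by (simp_all add: w_anti)
  note ** = * this w_anti(1,2)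
  show "w12 (T x) = T (w12 x)" "w21 (T x) = T (w21 x)"
    by (simp_all add: **)
qed

text \<open>Used from left to right, these rules move T outermost and order the factors as
  \<open>w11\<close>, \<open>w12\<close>, \<open>w21\<close>, \<open>w22\<close> from the outside
  in, so identities between composites become comparisons of normal forms.\<close>

lemmas w_normal = w_sq w_anti w_T w_T_comm

text \<open>Filtration by the number of factors \<open>w\<^sub>2\<^sub>1, w\<^sub>2\<^sub>2\<close> in a normally ordered product.\<close>
definition filt :: "nat \<Rightarrow> 'u set" where
  "filt j = (if j = 0 then {0} else if j = 1 then {u. d21 u = 0 \<and> d22 u = 0}
          else if j = 2 then {u. d21 (d22 u) = 0} else UNIV)"

lemma filt_0: "filt 0 = {0}" and filt_3: "filt 3 = UNIV" by (simp_all add: filt_def)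
lemma subgrp_filt: "subgrp (filt j)" by (auto simp: filt_def subgrp_def)

lemma filt_w1: "u \<in> filt j \<Longrightarrow> w11 u \<in> filt j" "u \<in> filt j \<Longrightarrow> w12 u \<in> filt j"
  by (auto simp: filt_def dw0 split: if_splits)

lemma filt_w2:
  assumes "u \<in> filt j" shows "w21 u \<in> filt (Suc j)" "w22 u \<in> filt (Suc j)"
proof -
  consider "j = 0" | "j = 1" | "j \<ge> 2" by linarith
  then have "w21 u \<in> filt (Suc j) \<and> w22 u \<in> filt (Suc j)"
    by cases (use assms in \<open>simp_all add: filt_def dw0 dw1\<close>)
  then show "w21 u \<in> filt (Suc j)" "w22 u \<in> filt (Suc j)" by simp_all
qed

lemma filt_d2:
  assumes "u \<in> filt (Suc j)" shows "d21 u \<in> filt j" "d22 u \<in> filt j"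
proof -
  consider "j = 0" | "j = 1" | "j = 2" | "j > 2" by linarith
  then have "d21 u \<in> filt j \<and> d22 u \<in> filt j"
    by cases (use assms in \<open>simp_all add: filt_def dd\<close>)
  then show "d21 u \<in> filt j" "d22 u \<in> filt j" by simp_all
qed

lemma pair_w1: "anticomm_pair w11 w12" and pair_w2: "anticomm_pair w21 w22"
  by (unfold_locales; simp add: w_sq w_anti)+

text \<open>Each contraction is a contracting homotopy, d w + w d = 1, for its own w.\<close>

lemma w_exact: "w11 u = 0 \<Longrightarrow> u = w11 (d11 u)" "w12 u = 0 \<Longrightarrow> u = w12 (d12 u)"
  "w21 u = 0 \<Longrightarrow> u = w21 (d21 u)" "w22 u = 0 \<Longrightarrow> u = w22 (d22 u)"
proof -
  have "d11 (w11 u) + w11 (d11 u) = u" "d12 (w12 u) + w12 (d12 u) = u"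
    "d21 (w21 u) + w21 (d21 u) = u" "d22 (w22 u) + w22 (d22 u) = u"
    by (simp_all add: dw1)
  then show "w11 u = 0 \<Longrightarrow> u = w11 (d11 u)" "w12 u = 0 \<Longrightarrow> u = w12 (d12 u)"
    "w21 u = 0 \<Longrightarrow> u = w21 (d21 u)" "w22 u = 0 \<Longrightarrow> u = w22 (d22 u)"
    by (metis d_zero add_0)+
qed

text \<open>Exactness of \<open>w11\<close> applied to w12 u, followed by anticommuting, shows that
  \<open>w12\<close> kills u - w11 (d11 u); then exactness of \<open>w12\<close> applies.\<close>

lemma w1_exact2:
  assumes "w11 (w12 u) = 0" shows "\<exists>a b. u = w11 a + w12 b"
proof -
  have "w12 u = w11 (d11 (w12 u))" by (rule w_exact(1)[OF assms])
  then have "w12 (u - w11 (d11 u)) = 0" by (simp add: dw0 w_anti)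
  then have "u - w11 (d11 u) = w12 (d12 (u - w11 (d11 u)))" by (rule w_exact(2))
  then show ?thesis by (metis diff_eq_eq add.commute)
qed

text \<open>The argument of \<open>w1_exact2\<close>; both witnesses arise by contracting with
  \<open>d21\<close> or \<open>d22\<close>, which lowers the filtration by one.\<close>

lemma w2_exact2:
  assumes "w21 (w22 u) = 0" "u \<in> filt (Suc j)"
  shows "\<exists>a\<in>filt j. \<exists>b\<in>filt j. u = w21 a + w22 b"
proof -
  have "w22 u = w21 (d21 (w22 u))" by (rule w_exact(3)[OF assms(1)])
  then have "w22 (u - w21 (d21 u)) = 0" by (simp add: dw0 w_anti)
  then have "u - w21 (d21 u) = w22 (d22 (u - w21 (d21 u)))" by (rule w_exact(4))
  moreover have "d21 u \<in> filt j" using filt_d2 assms(2) by blast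
  moreover have "d22 (u - w21 (d21 u)) \<in> filt j"
    using filt_d2(1)[OF assms(2)] by (intro filt_d2 subgrp_diff[OF subgrp_filt] assms(2) filt_w2)
  ultimately show ?thesis by (metis diff_eq_eq add.commute)
qed

lemma filt_UNIV: "u \<in> filt (Suc (Suc (Suc j)))" by (simp add: filt_def)

text \<open>Writing u = w21 h turns w22 u = 0 into the hypothesis of \<open>w2_exact2\<close> for h,
  and only the \<open>w22\<close> part of h survives under \<open>w21\<close>.\<close>

lemma w2_exact3:
  assumes "w21 u = 0" "w22 u = 0" shows "\<exists>r. u = w22 (w21 r)"
proof -
  define h where "h = d21 u"
  have u: "u = w21 h" unfolding h_def by (rule w_exact(3)[OF assms(1)])
  then have "w21 (w22 h) = 0" using assms(2) by (simp add: w_anti)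
  then obtain a b where "h = w21 a + w22 b" using w2_exact2[OF _ filt_UNIV] by blast
  then have "u = w22 (w21 (- b))" using u by (simp add: w_sq w_anti)
  then show ?thesis ..
qed

section \<open>Exactness for families in the y-variables\<close>

lemma exA1:
  assumes "f \<in> Fam1 (Suc n)" "lower w11 w12 f = 0"
  shows "\<exists>g\<in>Fam1 (Suc (Suc n)). f = lower w11 w12 g"
proof -
  interpret anticomm_pair w11 w12 by (rule pair_w1)
  show ?thesis
    by (rule tateA[where S = UNIV and T = UNIV]) (use assms w_exact(1) w1_exact2 in \<open>auto\<close>)
qed

text \<open>The preimage lies one step lower because \<open>w21\<close> and \<open>w22\<close> raise
  the filtration by one. This gain drives the induction of \<open>ex2_filtered\<close>.\<close>

lemma exA2:
  assumes "f \<in> homog (Suc n) (filt (Suc j))" "lower w21 w22 f = 0"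
  shows "\<exists>g\<in>homog (Suc (Suc n)) (filt j). f = lower w21 w22 g"
proof -
  interpret anticomm_pair w21 w22 by (rule pair_w2)
  show ?thesis
  proof (rule tateA[OF subgrp_filt subgrp_filt filt_w2 _ _ assms(1)])
    show "\<exists>h\<in>filt j. u = w21 h" if "u \<in> filt (Suc j)" "w21 u = 0" for u
      using w_exact(3)[OF that(2)] filt_d2(1)[OF that(1)] by blast
    show "\<exists>a\<in>filt j. \<exists>b\<in>filt j. u = w21 a + w22 b" if "u \<in> filt (Suc j)" "w21 (w22 u) = 0" for u
      using w2_exact2 that by blast
  qed (use assms(2) in simp_all)
qed

lemma exC1:
  assumes "f \<in> Fam1 (Suc n)" "raise w11 w12 f = 0"
  shows "\<exists>g\<in>Fam1 n. f = raise w11 w12 g"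
proof -
  interpret anticomm_pair w11 w12 by (rule pair_w1)
  have *: "w11 u = 0 \<Longrightarrow> w12 u = 0 \<Longrightarrow> u = w11 (d11 u) \<and> w12 (d11 u) = 0" for u
    using w_exact(1)[of u] dw0(1)[of u] by (metis d_zero neg_equal_0_iff_equal)
  show ?thesis
    by (rule tateC[where S = UNIV and T = UNIV]) (use assms w_exact(2) * in \<open>auto\<close>)
qed

lemma exC2:
  assumes "f \<in> homog (Suc n) (filt (Suc j))" "raise w21 w22 f = 0"
  shows "\<exists>g\<in>homog n (filt j). f = raise w21 w22 g"
proof -
  interpret anticomm_pair w21 w22 by (rule pair_w2)
  have *: "w21 u = 0 \<Longrightarrow> w22 u = 0 \<Longrightarrow> u = w21 (d21 u) \<and> w22 (d21 u) = 0" for u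
    using w_exact(3)[of u] dw0(9)[of u] by (metis d_zero neg_equal_0_iff_equal)
  show ?thesis
  proof (rule tateC[OF subgrp_filt subgrp_filt filt_w2 _ _ assms])
    show "\<exists>h\<in>filt j. u = w22 h" if "u \<in> filt (Suc j)" "w22 u = 0" for u
      using w_exact(4)[OF that(2)] filt_d2(2)[OF that(1)] by blast
    show "\<exists>h\<in>filt j. u = w21 h \<and> w22 h = 0" if "u \<in> filt (Suc j)" "w21 u = 0" "w22 u = 0" for u
      using *[OF that(2,3)] filt_d2(1)[OF that(1)] by blast
  qed
qed

abbreviation P1 where "P1 \<equiv> lower w11 w12"
abbreviation P2 where "P2 \<equiv> lower w21 w22"
abbreviation R1 where "R1 \<equiv> raise w11 w12"
abbreviation R2 where "R2 \<equiv> raise w21 w22"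

text \<open>In P1 P2 + P2 P1 the coefficients of the pure second derivatives vanish by
  \<open>w_anti\<close>; the coefficient of the mixed one is the left side of
  \<open>w_hyp\<close>.\<close>

lemma pair_P: "anticomm_pair P1 P2"
proof
  fix x y :: "nat \<Rightarrow> nat \<Rightarrow> 'u"
  show "P1 (x + y) = P1 x + P1 y" "P2 (x + y) = P2 x + P2 y" 
    by (intro ext; simp add: lower_def)+
  show "P1 (P1 x) = 0" "P2 (P2 x) = 0"
    using anticomm_pair.lower_lower pair_w1 pair_w2 by blast+
  show "P1 (P2 x) = - P2 (P1 x)"
    by (intro ext) (simp add: lower_def w_normal algebra_simps)
qed

lemma pair_R: "anticomm_pair R1 R2"
proof
  fix x y :: "nat \<Rightarrow> nat \<Rightarrow> 'u"
  show "R1 (x + y) = R1 x + R1 y" "R2 (x + y) = R2 x + R2 y" 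
    by (intro ext; simp add: raise_def)+
  show "R1 (R1 x) = 0" "R2 (R2 x) = 0"
    using anticomm_pair.raise_raise pair_w1 pair_w2 by blast+
  show "R1 (R2 x) = - R2 (R1 x)"
    by (intro ext) (auto simp add: raise_def w_normal algebra_simps)
qed

lemma P1_fam: "f \<in> homog (Suc n) (filt j) \<Longrightarrow> P1 f \<in> homog n (filt j)"
  by (rule anticomm_pair.lower_homog[OF pair_w1]) (auto intro: subgrp_filt filt_w1)
lemma P_fam: "f \<in> Fam1 (Suc n) \<Longrightarrow> P1 f \<in> Fam1 n" "f \<in> Fam1 (Suc n) \<Longrightarrow> P2 f \<in> Fam1 n"
  by (rule anticomm_pair.lower_homog[OF pair_w1] anticomm_pair.lower_homog[OF pair_w2]; auto)+
lemma R1_fam: "f \<in> homog n (filt j) \<Longrightarrow> R1 f \<in> homog (Suc n) (filt j)"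
  by (rule anticomm_pair.raise_homog[OF pair_w1]) (auto intro: subgrp_filt filt_w1)
lemma R_fam: "f \<in> Fam1 n \<Longrightarrow> R1 f \<in> Fam1 (Suc n)" "f \<in> Fam1 n \<Longrightarrow> R2 f \<in> Fam1 (Suc n)"
  by (rule anticomm_pair.raise_homog[OF pair_w1] anticomm_pair.raise_homog[OF pair_w2]; auto)+

lemma homog_mono: "S \<subseteq> S' \<Longrightarrow> homog n S \<subseteq> homog n S'"
  by (auto simp: homog_def)

lemma homog_filt_0: "homog n (filt 0) \<subseteq> {0}"
  by (auto simp: homog_def filt_0 fun_eq_iff)

text \<open>Degree at least two is required because \<open>exA2\<close> is applied to P1 f, which
  must still have positive degree.\<close>

lemma P_exact2:
  assumes "f \<in> Fam1 (Suc (Suc n))" "P1 (P2 f) = 0"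
  shows "\<exists>a\<in>homog (Suc (Suc (Suc n))) UNIV. \<exists>b\<in>homog (Suc (Suc (Suc n))) UNIV. f = P1 a + P2 b"
proof -
  interpret anticomm_pair P1 P2 by (rule pair_P)
  show ?thesis
  \<comment> \<open>Since \<open>w21\<close> and \<open>w22\<close> square to zero, at most two such
    factors occur: \<open>filt 3\<close> is everything, and the induction starts there.\<close>
  proof (rule ex2_filtered[where X = "\<lambda>j. homog (Suc (Suc n)) (filt j)" and Y = "\<lambda>j. homog (Suc n) (filt j)"
        and N = "Fam1 (Suc (Suc n))" and j = 3])
    show "homog (Suc (Suc n)) (filt 0) \<subseteq> {0}" by (rule homog_filt_0)
    show "P1 f \<in> homog (Suc n) (filt j)" if "f \<in> homog (Suc (Suc n)) (filt j)" for f j using P1_fam that .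
    show "\<exists>h\<in>homog (Suc (Suc n)) (filt j). y = P2 h" if "y \<in> homog (Suc n) (filt (Suc j))" "P2 y = 0" for y j
      using exA2 that .
    show "\<exists>c\<in>homog (Suc (Suc (Suc n))) UNIV. u = P1 c" if "u \<in> Fam1 (Suc (Suc n))" "P1 u = 0" for u
      using exA1 that .
    show "P2 x \<in> Fam1 (Suc (Suc n))" if "x \<in> homog (Suc (Suc (Suc n))) UNIV" for x
      using P_fam(2) that .
  qed (use assms in \<open>auto simp: filt_3 subgrp_homog intro: homog_mono[THEN subsetD]\<close>)
qed

text \<open>Here degree one is enough, since R1 raises the degree.\<close>

lemma R_exact2:
  assumes "f \<in> Fam1 (Suc n)" "R1 (R2 f) = 0"
  shows "\<exists>a\<in>Fam1 n. \<exists>b\<in>Fam1 n. f = R1 a + R2 b"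
proof -
  interpret anticomm_pair R1 R2 by (rule pair_R)
  show ?thesis
  proof (rule ex2_filtered[where X = "\<lambda>j. homog (Suc n) (filt j)" and Y = "\<lambda>j. homog (Suc (Suc n)) (filt j)"
        and N = "Fam1 (Suc n)" and j = 3])
    show "homog (Suc n) (filt 0) \<subseteq> {0}" by (rule homog_filt_0)
    show "R1 f \<in> homog (Suc (Suc n)) (filt j)" if "f \<in> homog (Suc n) (filt j)" for f j using R1_fam that .
    show "\<exists>h\<in>homog (Suc n) (filt j). y = R2 h" if "y \<in> homog (Suc (Suc n)) (filt (Suc j))" "R2 y = 0" for y j
      using exC2 that .
    show "\<exists>c\<in>Fam1 n. u = R1 c" if "u \<in> Fam1 (Suc n)" "R1 u = 0" for u
      using exC1 that .
    show "R2 x \<in> Fam1 (Suc n)" if "x \<in> Fam1 n" for x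
      using R_fam(2) that .
  qed (use assms in \<open>auto simp: filt_3 subgrp_homog intro: homog_mono[THEN subsetD]\<close>)
qed

lemma P2_exact1:
  assumes "f \<in> Fam1 (Suc n)" "P2 f = 0"
  shows "\<exists>g\<in>Fam1 (Suc (Suc n)). f = P2 g"
  using exA2[of f n 3] assms by (auto simp: filt_def)

lemma R2_exact1:
  assumes "f \<in> Fam1 (Suc n)" "R2 f = 0"
  shows "\<exists>g\<in>Fam1 n. f = R2 g"
  using exC2[of f n 3] assms by (auto simp: filt_def)

text \<open>With f = P1 g, the condition P2 f = 0 becomes P1 (P2 g) = 0, so g = P1 a + P2 b and only
  b survives under P1.\<close>

lemma P_exact3:
  assumes "f \<in> Fam1 (Suc n)" "P1 f = 0" "P2 f = 0"
  shows "\<exists>h\<in>homog (Suc (Suc (Suc n))) UNIV. f = P1 (P2 h)"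
proof -
  interpret anticomm_pair P1 P2 by (rule pair_P)
  obtain g where g: "g \<in> Fam1 (Suc (Suc n))" "f = P1 g" using exA1 assms by blast
  have "P1 (P2 g) = 0" using assms(3) g(2) by (simp add: pq)
  then obtain a b where "a \<in> homog (Suc (Suc (Suc n))) UNIV" "b \<in> homog (Suc (Suc (Suc n))) UNIV" "g = P1 a + P2 b"
    using P_exact2 g(1) by blast
  then show ?thesis using g(2) by (intro bexI[of _ b]) (simp_all add: p_add pp)
qed

lemma R_exact3:
  assumes "f \<in> Fam1 (Suc (Suc n))" "R1 f = 0" "R2 f = 0"
  shows "\<exists>h\<in>Fam1 n. f = R1 (R2 h)"
proof -
  interpret anticomm_pair R1 R2 by (rule pair_R)
  obtain g where g: "g \<in> Fam1 (Suc n)" "f = R1 g" using exC1 assms by blast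
  have "R1 (R2 g) = 0" using assms(3) g(2) by (simp add: pq)
  then obtain a b where "a \<in> Fam1 n" "b \<in> Fam1 n" "g = R1 a + R2 b"
    using R_exact2 g(1) by blast
  then show ?thesis using g(2) by (intro bexI[of _ b]) (simp_all add: p_add pp)
qed

text \<open>The outer indices belong to the x-variables, with P1 and P2 as coefficients. For m = 0
  the cycle condition is that of the splice map.\<close>

lemma A_exact:
  assumes "f \<in> Fam m (Suc (Suc n))"
    and "m = 0 \<Longrightarrow> P1 (P2 (f 0 0)) = 0" "m > 0 \<Longrightarrow> lower P1 P2 f = 0"
  shows "\<exists>g\<in>homog (Suc m) (homog (Suc (Suc (Suc n))) UNIV). f = lower P1 P2 g"
proof -
  interpret anticomm_pair P1 P2 by (rule pair_P)
  show ?thesis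
    by (rule tateA[OF subgrp_homog[OF subgrp_UNIV] subgrp_homog[OF subgrp_UNIV] P_fam exA1 P_exact2 assms])
qed

lemma D_exact0:
  assumes "f \<in> Fam 0 (Suc n)" "R1 (R2 (f 0 0)) = 0"
  shows "\<exists>g\<in>Fam (Suc 0) n. f = lower R1 R2 g"
proof -
  interpret anticomm_pair R1 R2 by (rule pair_R)
  show ?thesis
    by (rule tateA[OF subgrp_homog[OF subgrp_UNIV] subgrp_homog[OF subgrp_UNIV] R_fam exC1 R_exact2 assms(1)]) (use assms(2) in simp_all)
qed

lemma B_exact:
  assumes "f \<in> Fam (Suc m) (Suc n)" "raise P1 P2 f = 0"
  shows "\<exists>g\<in>Fam m (Suc (Suc n)). f = raise P1 P2 g"
proof -
  interpret anticomm_pair P1 P2 by (rule pair_P)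
  \<comment> \<open>\<open>tateC\<close> wants a preimage under P1 that is a P2-cycle; P2 h is one,
    as P2 squares to zero.\<close>
  have *: "\<exists>h\<in>Fam1 (Suc (Suc n)). u = P1 h \<and> P2 h = 0"
    if u: "u \<in> Fam1 (Suc n)" "P1 u = 0" "P2 u = 0" for u
  proof -
    obtain h where "h \<in> homog (Suc (Suc (Suc n))) UNIV" "u = P1 (P2 h)" using P_exact3[OF u] by blast
    then show ?thesis by (intro bexI[of _ "P2 h"]) (simp_all add: qq P_fam)
  qed
  show ?thesis
    by (rule tateC[OF subgrp_homog[OF subgrp_UNIV] subgrp_homog[OF subgrp_UNIV] P_fam P2_exact1 * assms])
qed

lemma C_exact:
  assumes "f \<in> Fam (Suc m) (Suc (Suc n))" "raise R1 R2 f = 0"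
  shows "\<exists>g\<in>Fam m (Suc n). f = raise R1 R2 g"
proof -
  interpret anticomm_pair R1 R2 by (rule pair_R)
  have *: "\<exists>h\<in>Fam1 (Suc n). u = R1 h \<and> R2 h = 0"
    if u: "u \<in> Fam1 (Suc (Suc n))" "R1 u = 0" "R2 u = 0" for u
  proof -
    obtain h where "h \<in> Fam1 n" "u = R1 (R2 h)" using R_exact3[OF u] by blast
    then show ?thesis by (intro bexI[of _ "R2 h"]) (simp_all add: qq R_fam)
  qed
  show ?thesis
    by (rule tateC[OF subgrp_homog[OF subgrp_UNIV] subgrp_homog[OF subgrp_UNIV] R_fam R2_exact1 * assms])
qed

end

subsection \<open>Vertices near the corners\<close>

definition transp :: "(nat \<Rightarrow> nat \<Rightarrow> nat \<Rightarrow> nat \<Rightarrow> 'a) \<Rightarrow> nat \<Rightarrow> nat \<Rightarrow> nat \<Rightarrow> nat \<Rightarrow> 'a" where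
  "transp f = (\<lambda>i j k l. f k l i j)"

lemma transp_transp [simp]: "transp (transp f) = f" by (simp add: transp_def)

lemma transp_homog: "transp f \<in> Fam m n \<longleftrightarrow> f \<in> Fam n m"
  unfolding homog_def transp_def fun_eq_iff
  by (auto simp: zero_fun_def) (metis (no_types))+

text \<open>Differentiation in the first variable on divided powers. It commutes with
  \<open>lower\<close>, so if F prolongs f = drop1 F to a cycle and F = lower p q g, then drop1 g
  solves the problem for f.\<close>

definition drop1 :: "(nat \<Rightarrow> nat \<Rightarrow> 'a) \<Rightarrow> nat \<Rightarrow> nat \<Rightarrow> 'a" where
  "drop1 f = (\<lambda>i j. f (Suc i) j)"

lemma drop1_homog: "f \<in> homog (Suc m) S \<Longrightarrow> drop1 f \<in> homog m S"
  by (auto simp: homog_def drop1_def)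

lemma drop1_lower: "lower p q (drop1 f) = drop1 (lower p q f)"
  by (simp add: drop1_def lower_def)

text \<open>Multiplication by the first variable. It commutes with \<open>raise\<close> and so
  carries a cycle to one of higher degree, where exactness is already known.\<close>

definition shift1 :: "(nat \<Rightarrow> nat \<Rightarrow> 'a::zero) \<Rightarrow> nat \<Rightarrow> nat \<Rightarrow> 'a" where
  "shift1 f = (\<lambda>i j. if i = 0 then 0 else f (i - 1) j)"

lemma shift1_homog: "f \<in> homog m S \<Longrightarrow> 0 \<in> S \<Longrightarrow> shift1 f \<in> homog (Suc m) S"
  by (auto simp: homog_def shift1_def)

lemma shift1_raise:
  assumes "anticomm_pair p q" "raise p q f = 0" shows "raise p q (shift1 f) = 0"
proof -
  interpret anticomm_pair p q by fact
  have "raise p q (shift1 f) i j = shift1 (raise p q f) i j" for i j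
    by (cases i) (auto simp: raise_def shift1_def)
  then show ?thesis using assms(2) by (intro ext) (simp add: shift1_def)
qed

definition single :: "nat \<Rightarrow> nat \<Rightarrow> 'a \<Rightarrow> nat \<Rightarrow> nat \<Rightarrow> 'a::zero" where
  "single i j x = (\<lambda>k l. if k = i \<and> l = j then x else 0)"

lemma single_homog: "0 \<in> S \<Longrightarrow> x \<in> S \<Longrightarrow> i + j = m \<Longrightarrow> single i j x \<in> homog m S"
  by (auto simp: homog_def single_def)

lemma homog_0_eq: "f \<in> homog 0 S \<Longrightarrow> f = single 0 0 (f 0 0)"
  by (intro ext) (auto simp: homog_def single_def)

lemma homog_1_eq: "f \<in> homog (Suc 0) S \<Longrightarrow> f = single 1 0 (f 1 0) + single 0 1 (f 0 1)"
proof (rule homog_ext)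
  assume f: "f \<in> homog (Suc 0) S"
  show "f \<in> homog (Suc 0) S" by fact
  show "single 1 0 (f 1 0) + single 0 1 (f 0 1) \<in> Fam1 (Suc 0)"
    by (intro subgrp_add[OF subgrp_homog] single_homog) auto
  fix i :: nat assume "i \<le> Suc 0"
  then show "f i (Suc 0 - i) = (single 1 0 (f 1 0) + single 0 1 (f 0 1)) i (Suc 0 - i)"
    by (cases i) (auto simp: single_def)
qed

context cliff
begin

lemma transp_nabA: "transp (lower P1 P2 f) = lower (lower w11 w21) (lower w12 w22) (transp f)"
  by (intro ext) (simp add: transp_def lower_def add_ac)

lemma transp_nabC: "transp (raise R1 R2 f) = raise (raise w11 w21) (raise w12 w22) (transp f)"
  by (intro ext) (auto simp: transp_def raise_def add_ac)

lemma transp_nabB: "transp (raise P1 P2 f) = lower (raise w11 w21) (raise w12 w22) (transp f)"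
  by (intro ext) (auto simp: transp_def raise_def lower_def add_ac)

lemma transp_nabD: "transp (lower R1 R2 f) = raise (lower w11 w21) (lower w12 w22) (transp f)"
  by (intro ext) (auto simp: transp_def raise_def lower_def add_ac)

text \<open>The counterpart of \<open>A_exact\<close> under the exchange of x and y: now the
  x-degree has to be at least two, and n = 0 is the splice vertex.\<close>

lemma A_exact':
  assumes "f \<in> Fam (Suc (Suc m)) n"
    and "n = 0 \<Longrightarrow> lower w11 w21 (lower w12 w22 (transp f 0 0)) = 0" "n > 0 \<Longrightarrow> lower P1 P2 f = 0"
  shows "\<exists>g\<in>homog (Suc (Suc (Suc m))) (Fam1 (Suc n)). f = lower P1 P2 g"
proof -
  interpret sw: cliff w11 w21 w12 w22 d11 d21 d12 d22 by (rule cliff_swap)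
  have "\<exists>g\<in>homog (Suc n) (homog (Suc (Suc (Suc m))) UNIV). transp f = lower sw.P1 sw.P2 g"
  proof (rule sw.A_exact)
    show "transp f \<in> Fam n (Suc (Suc m))" using assms(1) by (simp add: transp_homog)
    show "sw.P1 (sw.P2 (transp f 0 0)) = 0" if "n = 0" using assms(2) that .
    show "lower sw.P1 sw.P2 (transp f) = 0" if "0 < n"
      using assms(3)[OF that] transp_nabA[of f] by (simp add: transp_def fun_eq_iff)
  qed
  then obtain g where "g \<in> homog (Suc n) (homog (Suc (Suc (Suc m))) UNIV)" "transp f = lower sw.P1 sw.P2 g" by blast
  then have "transp g \<in> homog (Suc (Suc (Suc m))) (Fam1 (Suc n))" "f = lower P1 P2 (transp g)"
    using transp_nabA[of "transp g"] by (simp_all add: transp_homog) (metis transp_transp)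
  then show ?thesis by blast
qed

lemma C_exact':
  assumes "f \<in> Fam (Suc (Suc m)) (Suc n)" "raise R1 R2 f = 0"
  shows "\<exists>g\<in>Fam (Suc m) n. f = raise R1 R2 g"
proof -
  interpret sw: cliff w11 w21 w12 w22 d11 d21 d12 d22 by (rule cliff_swap)
  have "\<exists>g\<in>Fam n (Suc m). transp f = raise sw.R1 sw.R2 g"
  proof (rule sw.C_exact)
    show "transp f \<in> Fam (Suc n) (Suc (Suc m))" using assms(1) by (simp add: transp_homog)
    show "raise sw.R1 sw.R2 (transp f) = 0"
      using assms(2) transp_nabC[of f] by (simp add: transp_def fun_eq_iff)
  qed
  then obtain g where "g \<in> Fam n (Suc m)" "transp f = raise sw.R1 sw.R2 g" by blast
  then have "transp g \<in> Fam (Suc m) n" "f = raise R1 R2 (transp g)"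
    using transp_nabC[of "transp g"] by (simp_all add: transp_homog) (metis transp_transp)
  then show ?thesis by blast
qed

text \<open>Without y-variables a cycle is a single family killed by both raising maps of the
  exchanged structure, so it lies in the image of their composite.\<close>

lemma C20_exact:
  assumes "f \<in> Fam (Suc (Suc m)) 0" "raise R1 R2 f = 0"
  shows "\<exists>h\<in>Fam1 m. transp f 0 0 = raise w12 w22 (raise w11 w21 h)"
proof -
  interpret sw: cliff w11 w21 w12 w22 d11 d21 d12 d22 by (rule cliff_swap)
  have tf: "transp f \<in> Fam 0 (Suc (Suc m))" using assms(1) by (simp add: transp_homog)
  have z: "raise sw.R1 sw.R2 (transp f) = 0"
    using assms(2) transp_nabC[of f] by (simp add: transp_def fun_eq_iff)
  have "sw.R1 (transp f 0 0) = 0" "sw.R2 (transp f 0 0) = 0"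
    using fun_cong[OF fun_cong[OF z, of 1], of 0] fun_cong[OF fun_cong[OF z, of 0], of 1]
    by (simp_all add: raise_def[of sw.R1])
  then obtain h where h: "h \<in> Fam1 m" "transp f 0 0 = sw.R1 (sw.R2 h)"
    using sw.R_exact3 homog_in[OF tf, of 0 0] by auto
  interpret anticomm_pair sw.R1 sw.R2 by (rule sw.pair_R)
  have "transp f 0 0 = sw.R2 (sw.R1 (- h))" using h(2) by (simp add: pq p_minus q_minus)
  then show ?thesis using h(1) subgrp_uminus[OF subgrp_homog[OF subgrp_UNIV]] by blast
qed

text \<open>Both summands of the anticommutator of \<open>w11\<close> and \<open>w22\<close> vanish
  at c, and this anticommutator is injective.\<close>

lemma all_w_zero:
  assumes "w11 c = 0" "w22 c = 0" shows "c = 0"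
  using w_tors[of c] assms by simp

text \<open>A prolongation to x-degree two needs one new entry \<open>f2\<close> with P1 (f 0 1) +
  P2 f2 = 0. It suffices that v' lies in im w21 + im w22, that is, w21 (w22 v') = 0. The cycle
  equation identifies w12 (w11 v) with - w22 (w21 v'); this common element is killed by
  \<open>w11\<close> and by \<open>w22\<close>, hence zero.\<close>

lemma A11_exact:
  assumes f: "f \<in> Fam (Suc 0) (Suc 0)" and cyc: "lower P1 P2 f = 0"
  shows "\<exists>g\<in>Fam (Suc (Suc 0)) (Suc (Suc 0)). f = lower P1 P2 g"
proof -
  define x11 x12 x21 x22 where "x11 = f 1 0 1 0" "x12 = f 1 0 0 1" "x21 = f 0 1 1 0" "x22 = f 0 1 0 1"
  note x_defs = this
  define v where "v = w21 x11 + w22 x12"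
  define v' where "v' = w11 x21 + w12 x22"
  have "lower P1 P2 f 0 0 0 0 = 0" by (simp add: cyc)
  then have e: "w11 x11 + w12 x12 + (w21 x21 + w22 x22) = 0"
    by (simp add: lower_def x_defs)
  \<comment> \<open>The two obstructions to prolonging the cycle agree, and everything of this form is zero.\<close>
  define c where "c = w12 (w11 v)"
  have c1: "w11 c = 0" "w12 c = 0" unfolding c_def by (simp_all add: w_normal)
  define u where "u = w11 x11 + w12 x12"
  have u2: "u = - (w21 x21 + w22 x22)" using e unfolding u_def by (simp only: eq_neg_iff_add_eq_0)
  \<comment> \<open>The cycle equation gives two expressions for u. Applying w21 w12 - w22 w11 - T
    to each of them produces one obstruction from each.\<close>
  have "w21 (w12 u) - w22 (w11 u) - T u = - w22 (w21 v')"
    unfolding u2 v'_def by (simp add: w_normal algebra_simps)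
  moreover have "w12 (w11 v) = w21 (w12 u) - w22 (w11 u) - T u"
    unfolding u_def v_def by (simp add: w_normal algebra_simps)
  ultimately have "c = - w22 (w21 v')" by (simp add: c_def)
  then have c2: "w22 c = 0" by (simp add: w_normal)
  have "c = 0" using all_w_zero c1(1) c2 .
  then have "w21 (w22 v') = 0" using \<open>c = - w22 (w21 v')\<close> by (simp add: w_anti)
  then obtain a b where ab: "v' = w21 a + w22 b" using w2_exact2[OF _ filt_UNIV] by blast
  define f2 where "f2 = - (single 1 0 a + single 0 1 b)"
  have f2: "f2 \<in> Fam1 (Suc 0)" unfolding f2_def
    by (intro subgrp_uminus[OF subgrp_homog] subgrp_add[OF subgrp_homog] single_homog) auto
  define F where "F = (\<lambda>i j. if j = 2 \<and> i = 0 then f2 else if i = 0 then 0 else f (i - 1) j)"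
  have F: "F \<in> Fam (Suc (Suc 0)) (Suc 0)"
    using f f2 by (auto simp: homog_def F_def)
  have df: "drop1 F = f" by (simp add: drop1_def F_def)
  have f01: "f 0 1 \<in> Fam1 (Suc 0)" using homog_in[OF f] by simp
  have Pf: "P1 (f 0 1) + P2 f2 = 0"
  proof (rule homog_ext[of _ 0 UNIV _ UNIV])
    show "P1 (f 0 1) + P2 f2 \<in> Fam1 0"
      using P_fam f2 f01 by (intro subgrp_add[OF subgrp_homog]) auto
    show "0 \<in> Fam1 0" by (simp add: homog_def)
    fix i :: nat assume "i \<le> 0"
    then show "(P1 (f 0 1) + P2 f2) i (0 - i) = 0 i (0 - i)"
      using ab by (simp add: lower_def f2_def single_def v'_def x_defs)
  qed
  have "lower P1 P2 F = 0"
  proof (rule homog_ext[of _ 1 "Fam1 0" _ UNIV])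
    show "lower P1 P2 F \<in> Fam 1 0"
      using F anticomm_pair.lower_homog[OF pair_P _ subgrp_homog[OF subgrp_UNIV] P_fam] by simp
    show "0 \<in> Fam1 1" by (simp add: homog_def)
    fix i :: nat assume "i \<le> 1"
    then consider "i = 0" | "i = 1" by linarith
    then show "lower P1 P2 F i (1 - i) = 0 i (1 - i)"
    proof cases
      case 2
      have "lower P1 P2 F 1 0 = lower P1 P2 f 0 0" using fun_cong[OF fun_cong[OF drop1_lower[of P1 P2 F], of 0], of 0] unfolding df by (simp add: drop1_def)
      then show ?thesis using 2 cyc by simp
    next
      case 1
      then show ?thesis using Pf by (simp add: lower_def[of P1] F_def numeral_2_eq_2)
    qed
  qed
  then obtain g where g: "g \<in> homog (Suc (Suc (Suc 0))) (Fam1 (Suc (Suc 0)))" "F = lower P1 P2 g"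
    using A_exact'[of F 0 "Suc 0"] F by auto
  have "f = lower P1 P2 (drop1 g)" using df g(2) by (simp add: drop1_lower)
  then show ?thesis using drop1_homog[OF g(1)] by blast
qed

text \<open>A prolongation to x-degree two has one new entry, here - y, and is a cycle for the
  second-order map if z = w22 (w21 y). By \<open>w2_exact3\<close> such a y exists as soon as
  \<open>w21\<close> and \<open>w22\<close> kill z, which is the cycle condition of the third-order
  map.\<close>

lemma A10_exact:
  assumes f: "f \<in> Fam (Suc 0) 0"
    and cyc: "\<And>z. z = w12 (w11 (f 1 0 0 0)) + (w12 (w21 (f 0 1 0 0)) + w22 (w11 (f 0 1 0 0))) \<Longrightarrow> w21 z = 0 \<and> w22 z = 0"
  shows "\<exists>g\<in>Fam (Suc (Suc 0)) (Suc 0). f = lower P1 P2 g"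
proof -
  obtain y where y: "w12 (w11 (f 1 0 0 0)) + (w12 (w21 (f 0 1 0 0)) + w22 (w11 (f 0 1 0 0))) = w22 (w21 y)"
    using w2_exact3 cyc by blast
  define F where "F = (\<lambda>i j. if j = 2 \<and> i = 0 then single 0 0 (- y) else if i = 0 then 0 else f (i - 1) j)"
  have F: "F \<in> Fam (Suc (Suc 0)) 0"
    using f by (auto simp: homog_def F_def single_def)
  have df: "drop1 F = f" by (simp add: drop1_def F_def)
  have q: "lower w12 w22 (lower w11 w21 (transp F 0 0)) = 0"
  proof (rule homog_ext[of _ 0 UNIV _ UNIV])
    have "transp F \<in> Fam 0 (Suc (Suc 0))" using F by (simp add: transp_homog)
    then have t: "transp F 0 0 \<in> Fam1 (Suc (Suc 0))" by (simp add: homog_in)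
    interpret sw: cliff w11 w21 w12 w22 d11 d21 d12 d22 by (rule cliff_swap)
    show "sw.P2 (sw.P1 (transp F 0 0)) \<in> Fam1 0" using sw.P_fam t by blast
    show "0 \<in> Fam1 0" by (simp add: homog_def)
    fix i :: nat assume "i \<le> 0"
    then show "sw.P2 (sw.P1 (transp F 0 0)) i (0 - i) = 0 i (0 - i)"
      using y by (simp add: lower_def transp_def F_def single_def numeral_2_eq_2 add.assoc add_diff_eq)
  qed
  interpret sw: cliff w11 w21 w12 w22 d11 d21 d12 d22 by (rule cliff_swap)
  interpret pw: anticomm_pair sw.P1 sw.P2 by (rule sw.pair_P)
  have "sw.P1 (sw.P2 (transp F 0 0)) = 0" using q by (simp add: pw.pq)
  then obtain g where g: "g \<in> homog (Suc (Suc (Suc 0))) (Fam1 (Suc 0))" "F = lower P1 P2 g"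
    using A_exact'[of F 0 0] F by auto
  have "f = lower P1 P2 (drop1 g)" using df g(2) by (simp add: drop1_lower)
  then show ?thesis using drop1_homog[OF g(1)] by blast
qed

text \<open>The hypotheses give u = w11 a + w12 b = w21 c + w22 d. The difference of the two
  expressions is a cycle f at M_A^{1,1}, and a primitive of f shows that u lies in the image of the
  splice map.\<close>

lemma B00_exact:
  assumes "w12 (w11 u) = 0" "w22 (w21 u) = 0"
  shows "\<exists>h\<in>Fam1 (Suc (Suc 0)). u = P2 (P1 h) 0 0"
proof -
  obtain a b where ab: "u = w11 a + w12 b" using assms(1) w1_exact2[of u] by (auto simp: w_anti)
  have "w21 (w22 u) = 0" using assms(2) by (simp add: w_anti)
  then obtain c d where cd: "u = w21 c + w22 d" using w2_exact2[OF _ filt_UNIV] by blast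
  define f where "f = single 1 0 (single 1 0 a + single 0 1 b) - single 0 1 (single 1 0 c + single 0 1 d)"
  have f: "f \<in> Fam (Suc 0) (Suc 0)" unfolding f_def
    by (intro subgrp_diff[OF subgrp_homog] subgrp_add[OF subgrp_homog] single_homog subgrp_zero subgrp_homog) auto
  have 0: "w11 a + w12 b - (w21 c + w22 d) = 0" using ab cd by simp
  have "lower P1 P2 f = 0"
  proof (rule homog_ext[of _ 0 "Fam1 0" _ "Fam1 0"])
    show df: "lower P1 P2 f \<in> Fam 0 0"
      using f anticomm_pair.lower_homog[OF pair_P _ subgrp_homog[OF subgrp_UNIV] P_fam] by simp
    show "0 \<in> Fam 0 0" by (simp add: homog_def)
    fix i :: nat assume "i \<le> 0"
    have "lower P1 P2 f 0 0 = 0"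
    proof (rule homog_ext[of _ 0 UNIV _ UNIV])
      show "lower P1 P2 f 0 0 \<in> Fam1 0" using homog_in[OF df] by simp
      show "0 \<in> Fam1 0" by (simp add: homog_def)
      fix i :: nat assume "i \<le> 0"
      then show "lower P1 P2 f 0 0 i (0 - i) = 0 i (0 - i)"
        using 0 by (simp add: lower_def f_def single_def algebra_simps)
    qed
    then show "lower P1 P2 f i (0 - i) = 0 i (0 - i)" using \<open>i \<le> 0\<close> by simp
  qed
  then obtain g where g: "g \<in> Fam (Suc (Suc 0)) (Suc (Suc 0))" "f = lower P1 P2 g"
    using A11_exact f by blast
  interpret anticomm_pair P1 P2 by (rule pair_P)
  have "u = P1 (f 1 0) 0 0" using ab by (simp add: lower_def f_def single_def)
  \<comment> \<open>Here f 1 0 = P1 (g 2 0) + P2 (g 1 1); the first summand dies under P1, and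
    anticommuting accounts for the sign.\<close>
  also have "P1 (f 1 0) = P2 (P1 (- g 1 1))"
    using g(2) by (simp add: lower_def[of P1] p_add pp pq p_minus q_minus)
  finally have "u = P2 (P1 (- g 1 1)) 0 0" .
  moreover have "- g 1 1 \<in> Fam1 (Suc (Suc 0))"
    using homog_in[OF g(1), of 1 1] by (intro subgrp_uminus[OF subgrp_homog]) auto
  ultimately show ?thesis by blast
qed

text \<open>After a shift, \<open>C20_exact\<close> expresses both entries through one t. The
  vanishing entry of the shifted family says w22 (w21 t) = 0, so t = w21 a + w22 b, and substitution
  gives the third-order map up to sign.\<close>

lemma C10_exact:
  assumes f: "f \<in> Fam (Suc 0) 0" and cyc: "raise R1 R2 f = 0"
  shows "\<exists>a b. f 1 0 0 0 = w12 (w21 (w11 a) + (w21 (w12 b) + w22 (w11 b))) \<and>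
               f 0 1 0 0 = w22 (w21 (w11 a) + (w21 (w12 b) + w22 (w11 b)))"
proof -
  have s: "shift1 f \<in> Fam (Suc (Suc 0)) 0"
    using f by (rule shift1_homog) (simp add: homog_def)
  have "raise R1 R2 (shift1 f) = 0" by (rule shift1_raise[OF pair_R cyc])
  then obtain h where h: "transp (shift1 f) 0 0 = raise w12 w22 (raise w11 w21 h)"
    using C20_exact[OF s] by blast
  define t where "t = h 0 0"
  have h': "transp (shift1 f) 0 0 i j = raise w12 w22 (raise w11 w21 h) i j" for i j by (simp add: h)
  have 1: "f 1 0 0 0 = w12 (w11 t)" "f 0 1 0 0 = w12 (w21 t) + w22 (w11 t)" "w22 (w21 t) = 0"
    using h'[of 2 0] h'[of 1 1] h'[of 0 2] by (simp_all add: raise_def transp_def shift1_def t_def)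
  have "w21 (w22 t) = 0" using 1(3) by (simp add: w_anti)
  then obtain a b where t: "t = w21 a + w22 b" using w2_exact2[OF _ filt_UNIV] by blast
  have "f 1 0 0 0 = w12 (w21 (w11 (- a)) + (w21 (w12 (- b)) + w22 (w11 (- b))))"
    "f 0 1 0 0 = w22 (w21 (w11 (- a)) + (w21 (w12 (- b)) + w22 (w11 (- b))))"
    unfolding 1 t by (simp_all add: w_normal algebra_simps)
  then show ?thesis by blast
qed

text \<open>The shifted cycle is the image of a family with two entries s and t. The zero entry of
  the shift forces w21 t = w22 t = 0, so t = w22 (w21 r): s gives a boundary, and r what is
  left.\<close>

lemma C11_cycle:
  assumes f: "f \<in> Fam (Suc 0) (Suc 0)" and cyc: "raise R1 R2 f = 0"
  shows "\<exists>s r. f = raise R1 R2 (single 0 0 (single 0 0 s)) +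
           single 0 1 (single 1 0 (w11 (w22 (w21 r))) + single 0 1 (w12 (w22 (w21 r))))"
proof -
  have s: "shift1 f \<in> Fam (Suc (Suc 0)) (Suc 0)"
    using f by (rule shift1_homog) (simp add: homog_def)
  have "raise R1 R2 (shift1 f) = 0" by (rule shift1_raise[OF pair_R cyc])
  then obtain g where g: "g \<in> Fam (Suc 0) 0" "shift1 f = raise R1 R2 g"
    using C_exact'[OF s] by blast
  have h': "shift1 f i j = raise R1 R2 g i j" for i j by (simp add: g)
  interpret anticomm_pair R1 R2 by (rule pair_R)
  have 1: "f 1 0 = R1 (g 1 0)" "f 0 1 = R1 (g 0 1) + R2 (g 1 0)" "R2 (g 0 1) = 0"
    using h'[of 2 0] h'[of 1 1] h'[of 0 2] by (simp_all add: raise_def[of R1] shift1_def)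
  define s t where "s = g 1 0 0 0" and "t = g 0 1 0 0"
  have gs: "g 1 0 = single 0 0 s" "g 0 1 = single 0 0 t"
    unfolding s_def t_def using homog_in[OF g(1), of 1 0] homog_in[OF g(1), of 0 1] by (auto intro: homog_0_eq)
  have z: "R2 (g 0 1) i j = 0" for i j using 1(3) by (simp add: fun_eq_iff)
  have "w21 t = 0" "w22 t = 0"
    using z[of 1 0] z[of 0 1] by (simp_all add: raise_def t_def)
  then obtain r where r: "t = w22 (w21 r)" using w2_exact3 by blast
  have R1t: "R1 (single 0 0 t) = single 1 0 (w11 t) + single 0 1 (w12 t)"
    by (intro ext) (auto simp: raise_def single_def)
  have R0: "R1 0 = 0" "R2 0 = 0" by simp_all
  have "f = raise R1 R2 (single 0 0 (single 0 0 s)) + single 0 1 (R1 (single 0 0 t))"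
  proof (rule homog_ext[OF f, of _ UNIV])
    show "raise R1 R2 (single 0 0 (single 0 0 s)) + single 0 1 (R1 (single 0 0 t)) \<in> Fam1 (Suc 0)"
      by (intro subgrp_add[OF subgrp_homog] single_homog raise_homog[where T = UNIV]) auto
    fix i :: nat assume "i \<le> Suc 0"
    then consider "i = 0" | "i = 1" by linarith
    then show "f i (Suc 0 - i) = (raise R1 R2 (single 0 0 (single 0 0 s)) + single 0 1 (R1 (single 0 0 t))) i (Suc 0 - i)"
    proof cases
      case 1
      have "f 0 1 = R2 (single 0 0 s) + R1 (single 0 0 t)" using \<open>f 0 1 = R1 (g 0 1) + R2 (g 1 0)\<close> by (simp only: gs add.commute)
      then show ?thesis using 1 by (simp add: raise_def[of R1] single_def[of _ _ "single 0 0 s"] single_def[of _ _ "R1 (single 0 0 t)"])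
    next
      case 2
      have "f 1 0 = R1 (single 0 0 s)" using \<open>f 1 0 = R1 (g 1 0)\<close> by (simp only: gs)
      then show ?thesis using 2 by (simp add: raise_def[of R1] single_def[of _ _ "single 0 0 s"] single_def[of _ _ "R1 (single 0 0 t)"])
    qed
  qed
  then show ?thesis using R1t r by auto
qed

lemma C11_boundary:
  fixes r :: 'u
  assumes "r = w11 a + w12 b + w21 c + w22 d"
  shows "\<exists>s. single 0 1 (single 1 0 (w11 (w22 (w21 r))) + single 0 1 (w12 (w22 (w21 r)))) = raise R1 R2 (single 0 0 (single 0 0 s))"
proof -
  \<comment> \<open>The boundary must have no R1-part, so \<open>w11\<close> and \<open>w12\<close>
    have to kill s; the outer factors w12 w11 ensure this. The c and d parts of r vanish under w22
    w21, so only a and b enter.\<close>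
  define s where "s = w12 (w11 (w21 a)) + w12 (w11 (w22 b))"
  have 1: "w11 s = 0" "w12 s = 0" unfolding s_def by (simp_all add: w_normal)
  have 2: "w21 s = w11 (w22 (w21 r))" "w22 s = w12 (w22 (w21 r))"
    unfolding s_def assms by (simp_all add: w_normal algebra_simps)
  interpret anticomm_pair R1 R2 by (rule pair_R)
  have R: "R1 (single 0 0 s) = single 1 0 (w11 s) + single 0 1 (w12 s)" "R2 (single 0 0 s) = single 1 0 (w21 s) + single 0 1 (w22 s)"
    by (intro ext; auto simp: raise_def single_def)+
  have "raise R1 R2 (single 0 0 (single 0 0 s)) = single 1 0 (R1 (single 0 0 s)) + single 0 1 (R2 (single 0 0 s))"
    by (intro ext) (auto simp: raise_def[of R1] single_def[of _ _ "single 0 0 s"] single_def[of _ _ "R1 (single 0 0 s)"] single_def[of _ _ "R2 (single 0 0 s)"])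
  also have "single 1 0 (R1 (single 0 0 s)) = 0" unfolding R 1 by (intro ext) (simp add: single_def)
  finally show ?thesis unfolding R 2 add_0_left by (intro exI[of _ s]) (rule sym)
qed

end

subsection \<open>The enveloping algebra of the negative part\<close>

text \<open>The sign of moving eta_j from the right end of eta_J to its place in increasing
  order.\<close>

definition usgn :: "nat set \<Rightarrow> nat \<Rightarrow> complex" where
  "usgn J j = (-1) ^ ngt J j"

lemma usgn_sq [simp]: "usgn J j * usgn J j = 1" "usgn J j * (usgn J j * x) = x"
  by (simp_all add: usgn_def flip: mult.assoc power_mult_distrib)

lemma usgn_insert:
  assumes "finite J" "i \<notin> J"
  shows "usgn (insert i J) j = (if j < i then - usgn J j else usgn J j)"
proof -
  have "{x \<in> insert i J. j < x} = (if j < i then insert i {x \<in> J. j < x} else {x \<in> J. j < x})" by auto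
  then show ?thesis using assms by (simp add: usgn_def ngt_def)
qed

lemma usgn_remove:
  assumes "finite J" "i \<in> J"
  shows "usgn (J - {i}) j = (if j < i then - usgn J j else usgn J j)"
  using usgn_insert[of "J - {i}" i j] assms by (simp add: insert_absorb split: if_splits)

definition uc :: "ue \<Rightarrow> bool" where
  "uc u \<longleftrightarrow> finite {z. u z \<noteq> 0} \<and> (\<forall>k J. u (k, J) \<noteq> 0 \<longrightarrow> J \<subseteq> {1..4})"

text \<open>Each coefficient of the product is read off from the single basis element that eta_j
  sends to a multiple of Theta^k eta_J. In this form the Clifford relations are pointwise
  identities. The factor - 1/2 comes from eta_j^2 = - Theta/2.\<close>

definition rop :: "nat \<Rightarrow> ue \<Rightarrow> ue" where
  "rop j u = (\<lambda>(k, J). usgn J j * (if j \<in> J then u (k, J - {j})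
                 else if k = 0 then 0 else - u (k - 1, insert j J) / 2))"

definition iop :: "nat \<Rightarrow> ue \<Rightarrow> ue" where
  "iop j u = (\<lambda>(k, J). if j \<in> J then 0 else usgn J j * u (k, insert j J))"

lemma uc_lincomb: "uc u \<Longrightarrow> uc v \<Longrightarrow> uc (\<lambda>z. a * u z + b * v z)"
proof -
  assume u: "uc u" and v: "uc v"
  have "finite {z. a * u z + b * v z \<noteq> 0}"
    using u v by (auto simp: uc_def intro: finite_subset[of _ "{z. u z \<noteq> 0} \<union> {z. v z \<noteq> 0}"])
  moreover have "J \<subseteq> {1..4}" if "a * u (k, J) + b * v (k, J) \<noteq> 0" for k J
  proof -
    have "u (k, J) \<noteq> 0 \<or> v (k, J) \<noteq> 0" using that by auto
    then show ?thesis using u v unfolding uc_def by blast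
  qed
  ultimately show ?thesis unfolding uc_def by blast
qed

lemma uc_zero: "uc (\<lambda>z. 0)" by (simp add: uc_def)

lemma uc_shape:
  assumes "uc u" "\<And>k J. v (k, J) \<noteq> 0 \<Longrightarrow> J \<subseteq> {1..4} \<and> (\<exists>z\<in>h ` {z. u z \<noteq> 0}. (k, J) \<in> z)"
    and "\<And>z. finite (h z)"
  shows "uc v"
proof -
  have "{z. v z \<noteq> 0} \<subseteq> \<Union>(h ` {z. u z \<noteq> 0})" using assms(2) by force
  moreover have "finite (\<Union>(h ` {z. u z \<noteq> 0}))" using assms(1,3) by (auto simp: uc_def)
  ultimately show ?thesis using assms(2) finite_subset unfolding uc_def by blast
qed

lemma uc_rop:
  assumes u: "uc u" and j: "j \<in> {1..4}" shows "uc (rop j u)"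
proof (rule uc_shape[OF u, where h = "\<lambda>(k, J). {(k, insert j J), (k + 1, J - {j})}"])
  fix k J assume nz: "rop j u (k, J) \<noteq> 0"
  show "J \<subseteq> {1..4} \<and> (\<exists>z\<in>(\<lambda>(k, J). {(k, insert j J), (k + 1, J - {j})}) ` {z. u z \<noteq> 0}. (k, J) \<in> z)"
  proof (cases "j \<in> J")
    case True
    then have "u (k, J - {j}) \<noteq> 0" using nz by (auto simp: rop_def)
    moreover from this u j have "J \<subseteq> {1..4}" unfolding uc_def by blast
    ultimately show ?thesis using True by (auto intro!: bexI[of _ "(k, J - {j})"] simp: image_iff)
  next
    case False
    then have "k > 0" "u (k - 1, insert j J) \<noteq> 0" using nz by (auto simp: rop_def split: if_splits)
    moreover from this u j have "J \<subseteq> {1..4}" unfolding uc_def by blast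
    ultimately have m: "(k - 1, insert j J) \<in> {z. u z \<noteq> 0}" and J: "J \<subseteq> {1..4}"
      and i: "(k, J) \<in> (case (k - 1, insert j J) of (k, J) \<Rightarrow> {(k, insert j J), (k + 1, J - {j})})"
      using False by auto
    show ?thesis by (rule conjI[OF J], rule rev_bexI, rule imageI[OF m], rule i)
  qed
qed auto

lemma uc_iop:
  assumes u: "uc u" shows "uc (iop j u)"
proof (rule uc_shape[OF u, where h = "\<lambda>(k, J). {(k, J - {j})}"])
  fix k J assume nz: "iop j u (k, J) \<noteq> 0"
  then have "j \<notin> J" "u (k, insert j J) \<noteq> 0" by (auto simp: iop_def split: if_splits)
  moreover from this u have "J \<subseteq> {1..4}" unfolding uc_def by blast
  ultimately show "J \<subseteq> {1..4} \<and> (\<exists>z\<in>(\<lambda>(k, J). {(k, J - {j})}) ` {z. u z \<noteq> 0}. (k, J) \<in> z)"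
    by (auto intro!: bexI[of _ "(k, insert j J)"] simp: image_iff)
qed auto

lemma uc_theta:
  assumes u: "uc u" shows "uc (\<lambda>(k, J). if k = 0 then 0 else u (k - 1, J))"
proof (rule uc_shape[OF u, where h = "\<lambda>(k, J). {(k + 1, J)}"])
  fix k J assume nz: "(\<lambda>(k, J). if k = 0 then 0 else u (k - 1, J)) (k, J) \<noteq> 0"
  then have "k > 0" "u (k - 1, J) \<noteq> 0" by (auto split: if_splits)
  moreover from this u have "J \<subseteq> {1..4}" unfolding uc_def by blast
  ultimately show "J \<subseteq> {1..4} \<and> (\<exists>z\<in>(\<lambda>(k, J). {(k + 1, J)}) ` {z. u z \<noteq> 0}. (k, J) \<in> z)"
    by (auto intro!: bexI[of _ "(k - 1, J)"] simp: image_iff)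
qed auto

text \<open>\<open>ucl\<close> is the enveloping algebra in its PBW basis; \<open>rmul j\<close> and \<open>contr j\<close> below are the right
  multiplication by \<open>\<eta>\<^sub>j\<close> and the right contraction with it.\<close>
typedef ucl = "{u. uc u}" morphisms Rep Abs
  using uc_zero by blast

setup_lifting type_definition_ucl

instantiation ucl :: ab_group_add
begin
lift_definition zero_ucl :: ucl is "\<lambda>z. 0" by (rule uc_zero)
lift_definition plus_ucl :: "ucl \<Rightarrow> ucl \<Rightarrow> ucl" is "\<lambda>u v z. u z + v z"
  using uc_lincomb[of _ _ 1 1] by simp
lift_definition minus_ucl :: "ucl \<Rightarrow> ucl \<Rightarrow> ucl" is "\<lambda>u v z. u z - v z"
  using uc_lincomb[of _ _ 1 "-1"] by simp
lift_definition uminus_ucl :: "ucl \<Rightarrow> ucl" is "\<lambda>u z. - u z"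
  using uc_lincomb[of _ "\<lambda>z. 0" "-1" 0] uc_zero by simp
instance by standard (transfer; simp add: fun_eq_iff)+
end

lift_definition scl :: "complex \<Rightarrow> ucl \<Rightarrow> ucl" is "\<lambda>c u z. c * u z"
  subgoal for c u using uc_lincomb[of u "\<lambda>z. 0" c 0] uc_zero by simp done
lift_definition rmul :: "nat \<Rightarrow> ucl \<Rightarrow> ucl" is "\<lambda>j u. if j \<in> {1..4} then rop j u else (\<lambda>z. 0)"
  by (auto intro: uc_rop uc_zero)
lift_definition contr :: "nat \<Rightarrow> ucl \<Rightarrow> ucl" is "iop"
  by (rule uc_iop)
lift_definition theta :: "ucl \<Rightarrow> ucl" is "\<lambda>u (k, J). if k = 0 then 0 else u (k - 1, J)"
  by (rule uc_theta)

lemmas rep_simps = zero_ucl.rep_eq plus_ucl.rep_eq minus_ucl.rep_eq uminus_ucl.rep_eq scl.rep_eq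

lemma uc_Rep: "uc (Rep x)" using Rep[of x] by simp

lemma Rep_out: "\<not> J \<subseteq> {1..4} \<Longrightarrow> Rep x (k, J) = 0"
  using uc_Rep[of x] by (auto simp: uc_def)

lemma ucl_eqI: "(\<And>k J. J \<subseteq> {1..4} \<Longrightarrow> Rep x (k, J) = Rep y (k, J)) \<Longrightarrow> x = y"
  by (metis Rep_inject Rep_out ext prod.collapse)

lemma rmul_simps:
  "rmul j (x + y) = rmul j x + rmul j y" "rmul j (x - y) = rmul j x - rmul j y" "rmul j (- x) = - rmul j x"
  "rmul j 0 = 0" "rmul j (scl c x) = scl c (rmul j x)"
  by (rule ucl_eqI; simp add: rep_simps rmul.rep_eq rop_def algebra_simps add_divide_distrib diff_divide_distrib)+

lemma contr_simps:
  "contr j (x + y) = contr j x + contr j y" "contr j (x - y) = contr j x - contr j y" "contr j (- x) = - contr j x"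
  "contr j 0 = 0" "contr j (scl c x) = scl c (contr j x)"
  by (rule ucl_eqI; simp add: rep_simps contr.rep_eq iop_def algebra_simps)+

lemma scl_simps:
  "scl c (x + y) = scl c x + scl c y" "scl c (x - y) = scl c x - scl c y" "scl c (- x) = - scl c x"
  "scl c 0 = 0" "scl c (scl d x) = scl (c * d) x" "scl 1 x = x" "scl 0 x = 0"
  by (rule ucl_eqI; simp add: rep_simps algebra_simps)+

lemma fin14: "J \<subseteq> {1..4::nat} \<Longrightarrow> finite J" by (rule finite_subset) auto

lemma rmul_anti:
  assumes "i \<noteq> j" shows "rmul i (rmul j x) = - rmul j (rmul i x)"
proof (cases "i \<in> {1..4} \<and> j \<in> {1..4}")
  case True
  show ?thesis
  proof (rule ucl_eqI)
    fix k and J :: "nat set" assume "J \<subseteq> {1..4}"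
    then have f: "finite J" by (rule fin14)
    have s: "insert i (J - {j}) = insert i J - {j}" "insert j (J - {i}) = insert j J - {i}"
      "J - {i} - {j} = J - {j} - {i}" "insert i (insert j J) = insert j (insert i J)"
      using assms by auto
    show "Rep (rmul i (rmul j x)) (k, J) = Rep (- rmul j (rmul i x)) (k, J)"
      using True assms f
      by (cases "i \<in> J"; cases "j \<in> J"; cases "i < j")
         (auto simp: rep_simps rmul.rep_eq rop_def usgn_insert usgn_remove s)
  qed
next
  case False then show ?thesis by (intro ucl_eqI) (auto simp: rep_simps rmul.rep_eq rop_def)
qed

lemma rmul_sq:
  assumes "j \<in> {1..4}" shows "rmul j (rmul j x) = scl (- 1 / 2) (theta x)"
proof (rule ucl_eqI)
  fix k and J :: "nat set" assume "J \<subseteq> {1..4}"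
  then have f: "finite J" by (rule fin14)
  show "Rep (rmul j (rmul j x)) (k, J) = Rep (scl (- 1 / 2) (theta x)) (k, J)"
    using assms f by (cases "j \<in> J") (auto simp: rep_simps rmul.rep_eq rop_def theta.rep_eq usgn_insert usgn_remove insert_absorb)
qed

lemma contr_rmul_same:
  assumes "j \<in> {1..4}" shows "contr j (rmul j x) = x - rmul j (contr j x)"
proof (rule ucl_eqI)
  fix k and J :: "nat set" assume "J \<subseteq> {1..4}"
  then have f: "finite J" by (rule fin14)
  show "Rep (contr j (rmul j x)) (k, J) = Rep (x - rmul j (contr j x)) (k, J)"
    using assms f by (cases "j \<in> J") (auto simp: rep_simps rmul.rep_eq rop_def contr.rep_eq iop_def usgn_insert usgn_remove insert_absorb)
qed

lemma contr_rmul: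
  assumes "i \<noteq> j" shows "contr i (rmul j x) = - rmul j (contr i x)"
proof (cases "j \<in> {1..4}")
  case True
  show ?thesis
  proof (rule ucl_eqI)
    fix k and J :: "nat set" assume "J \<subseteq> {1..4}"
    then have f: "finite J" by (rule fin14)
    have s: "insert i (J - {j}) = insert i J - {j}" "insert j (J - {i}) = insert j J - {i}"
      "J - {i} - {j} = J - {j} - {i}" "insert i (insert j J) = insert j (insert i J)"
      using assms by auto
    show "Rep (contr i (rmul j x)) (k, J) = Rep (- rmul j (contr i x)) (k, J)"
      using True assms f
      by (cases "i \<in> J"; cases "j \<in> J"; cases "i < j")
         (auto simp: rep_simps rmul.rep_eq rop_def contr.rep_eq iop_def usgn_insert usgn_remove s)
  qed
next
  case False then show ?thesis by (intro ucl_eqI) (auto simp: rep_simps rmul.rep_eq rop_def contr.rep_eq iop_def)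
qed

lemma contr_contr': "contr i (contr j x) = (if i = j then 0 else - contr j (contr i x))"
proof (rule ucl_eqI)
  fix k and J :: "nat set" assume "J \<subseteq> {1..4}"
  then have f: "finite J" by (rule fin14)
  show "Rep (contr i (contr j x)) (k, J) = Rep (if i = j then 0 else - contr j (contr i x)) (k, J)"
    using f
    by (cases "i \<in> J"; cases "j \<in> J"; cases "i < j")
       (auto simp: rep_simps contr.rep_eq iop_def usgn_insert insert_commute)
qed

lemma contr_contr: "contr i (contr i x) = 0" "i \<noteq> j \<Longrightarrow> contr i (contr j x) = - contr j (contr i x)"
  by (subst contr_contr', simp)+

definition w11 :: "ucl \<Rightarrow> ucl" where "w11 x = rmul 2 x + scl \<i> (rmul 1 x)"
definition w22 :: "ucl \<Rightarrow> ucl" where "w22 x = rmul 2 x - scl \<i> (rmul 1 x)"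
definition w12 :: "ucl \<Rightarrow> ucl" where "w12 x = - rmul 4 x + scl \<i> (rmul 3 x)"
definition w21 :: "ucl \<Rightarrow> ucl" where "w21 x = rmul 4 x + scl \<i> (rmul 3 x)"
text \<open>The conjugate coefficients and the factor 1/2 make \<open>d11\<close>,
  \<open>d22\<close>, \<open>d12\<close>, \<open>d21\<close> the basis dual to the corresponding w's
  under contraction.\<close>

definition d11 :: "ucl \<Rightarrow> ucl" where "d11 x = scl (1/2) (contr 2 x - scl \<i> (contr 1 x))"
definition d22 :: "ucl \<Rightarrow> ucl" where "d22 x = scl (1/2) (contr 2 x + scl \<i> (contr 1 x))"
definition d12 :: "ucl \<Rightarrow> ucl" where "d12 x = scl (1/2) (- contr 4 x - scl \<i> (contr 3 x))"
definition d21 :: "ucl \<Rightarrow> ucl" where "d21 x = scl (1/2) (contr 4 x - scl \<i> (contr 3 x))"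

lemmas rmul_ord = rmul_anti[of 2 1] rmul_anti[of 3 1] rmul_anti[of 3 2] rmul_anti[of 4 1] rmul_anti[of 4 2] rmul_anti[of 4 3]
lemmas contr_ord = contr_contr(2)[of 2 1] contr_contr(2)[of 4 3] contr_contr(2)[of 3 1] contr_contr(2)[of 3 2] contr_contr(2)[of 4 1] contr_contr(2)[of 4 2]
lemmas op_simps = w11_def w12_def w21_def w22_def d11_def d12_def d21_def d22_def rmul_simps contr_simps scl_simps rmul_ord rmul_sq
  contr_rmul_same contr_rmul contr_contr(1) contr_ord
text \<open>The simplifier turns the index 1 into \<open>Suc 0\<close>, so the rules are needed in
  this form.\<close>

lemmas op_simps' = op_simps[unfolded One_nat_def]

interpretation std: cliff w11 w12 w21 w22 d11 d12 d21 d22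
proof
  fix x y
  show "x = 0" if "w11 (w22 x) + w22 (w11 x) = 0"
  proof (rule ucl_eqI)
    fix k J
    \<comment> \<open>Both mixed terms cancel and eta_1^2, eta_2^2 each occur twice, which gives 4
      times - Theta/2.\<close>
    have "w11 (w22 x) + w22 (w11 x) = scl (- 2) (theta x)"
      by (rule ucl_eqI) (simp add: op_simps' rep_simps field_simps)
    with that have "Rep (scl (- 2) (theta x)) (Suc k, J) = 0" by (simp add: rep_simps)
    then show "Rep x (k, J) = Rep 0 (k, J)" by (simp add: rep_simps theta.rep_eq)
  qed
qed (rule ucl_eqI; simp add: op_simps' rep_simps field_simps)+

section \<open>Linear extension and products in the enveloping algebra\<close>

lemma lin_sum:
  assumes "finite A" "{b. f b \<noteq> 0} \<subseteq> A"
  shows "lin \<phi> f z = (\<Sum>b\<in>A. f b * \<phi> b z)"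
  unfolding lin_def using assms by (intro sum.mono_neutral_left) auto

lemma lin_single:
  assumes "finite {b. f b \<noteq> 0}" "\<And>b. b \<noteq> b0 \<Longrightarrow> f b \<noteq> 0 \<Longrightarrow> \<phi> b z = 0"
  shows "lin \<phi> f z = f b0 * \<phi> b0 z"
proof -
  have "lin \<phi> f z = (\<Sum>b\<in>insert b0 {b. f b \<noteq> 0}. f b * \<phi> b z)"
    using assms(1) by (intro lin_sum) auto
  also have "\<dots> = (\<Sum>b\<in>{b0}. f b * \<phi> b z)"
    using assms by (intro sum.mono_neutral_right) auto
  finally show ?thesis by simp
qed

lemma lin_none:
  assumes "\<And>b. f b \<noteq> 0 \<Longrightarrow> \<phi> b z = 0"
  shows "lin \<phi> f z = 0"
  unfolding lin_def using assms by (intro sum.neutral) auto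

lemma ngt_diff: "ngt (J - {j}) j = ngt J j" and ngt_insert: "ngt (insert j J) j = ngt J j"
  unfolding ngt_def by (rule arg_cong[where f = card]; auto)+

lemma rmul_eta_rop:
  assumes "finite {z. u z \<noteq> 0}" shows "rmul_eta j u = rop j u"
proof (intro ext)
  fix z :: "nat \<times> nat set" obtain k J where z: "z = (k, J)" by (cases z)
  consider "j \<in> J" | "j \<notin> J" "k = 0" | "j \<notin> J" "k > 0" by blast
  then show "rmul_eta j u z = rop j u z"
  proof cases
    case 1
    have "lin (\<lambda>kJ. rmul_eta_mono kJ j) u z = u (k, J - {j}) * rmul_eta_mono (k, J - {j}) j z"
      by (rule lin_single[OF assms]) (use 1 z in \<open>auto simp: rmul_eta_mono_def dlt_def split: prod.splits if_splits\<close>)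
    then show ?thesis using 1 z
      by (simp add: rmul_eta_def rop_def rmul_eta_mono_def dlt_def insert_absorb usgn_def ngt_diff)
  next
    case 2
    have "lin (\<lambda>kJ. rmul_eta_mono kJ j) u z = 0"
      by (rule lin_none) (use 2 z in \<open>auto simp: rmul_eta_mono_def dlt_def split: prod.splits if_splits\<close>)
    then show ?thesis using 2 z by (simp add: rmul_eta_def rop_def)
  next
    case 3
    have "lin (\<lambda>kJ. rmul_eta_mono kJ j) u z = u (k - 1, insert j J) * rmul_eta_mono (k - 1, insert j J) j z"
      by (rule lin_single[OF assms]) (use 3 z in \<open>auto simp: rmul_eta_mono_def dlt_def split: prod.splits if_splits\<close>)
    then show ?thesis using 3 z
      by (simp add: rmul_eta_def rop_def rmul_eta_mono_def dlt_def usgn_def ngt_insert)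
  qed
qed

lemma rmul_eta_rmul: "j \<in> {1..4} \<Longrightarrow> rmul_eta j (Rep x) = Rep (rmul j x)"
  using uc_Rep[of x] by (simp add: rmul_eta_rop uc_def rmul.rep_eq)

lift_definition mon :: "nat \<times> nat set \<Rightarrow> ucl" is "\<lambda>(k, J). if J \<subseteq> {1..4} then dlt (k, J) else (\<lambda>z. 0)"
  subgoal for p
  proof -
    obtain k J where p: "p = (k, J)" by (cases p)
    have "{z. dlt (k, J) z \<noteq> 0} = {(k, J)}" by (auto simp: dlt_def)
    then show ?thesis using p uc_zero by (auto simp: uc_def dlt_def)
  qed
  done

abbreviation one :: ucl where "one \<equiv> mon (0, {})"

lemma Rep_mon: "snd p \<subseteq> {1..4} \<Longrightarrow> Rep (mon p) = dlt p"
  by (cases p) (simp add: mon.rep_eq)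

lemma Rep_sum: "Rep (sum f A) z = (\<Sum>a\<in>A. Rep (f a) z)"
  by (induction A rule: infinite_finite_induct) (simp_all add: rep_simps)

lemma finite_Rep: "finite {z. Rep x z \<noteq> 0}" using uc_Rep[of x] by (simp add: uc_def)

lemma Rep_supp: "Rep x p \<noteq> 0 \<Longrightarrow> snd p \<subseteq> {1..4}"
  using uc_Rep[of x] by (cases p) (auto simp: uc_def)

lemma ucl_decomp: "x = (\<Sum>p\<in>{p. Rep x p \<noteq> 0}. scl (Rep x p) (mon p))"
proof (rule ucl_eqI)
  fix k J
  have "Rep (\<Sum>p\<in>{p. Rep x p \<noteq> 0}. scl (Rep x p) (mon p)) (k, J)
      = (\<Sum>p\<in>{p. Rep x p \<noteq> 0}. Rep x p * dlt p (k, J))"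
    unfolding Rep_sum by (intro sum.cong) (simp_all add: rep_simps Rep_mon[OF Rep_supp[of x]])
  also have "\<dots> = (\<Sum>p\<in>{p. Rep x p \<noteq> 0}. if p = (k, J) then Rep x (k, J) else 0)"
    by (intro sum.cong) (auto simp: dlt_def)
  also have "\<dots> = Rep x (k, J)" using finite_Rep[of x] by auto
  finally show "Rep x (k, J) = Rep (\<Sum>p\<in>{p. Rep x p \<noteq> 0}. scl (Rep x p) (mon p)) (k, J)" by simp
qed

definition ulin :: "(ucl \<Rightarrow> ucl) \<Rightarrow> bool" where
  "ulin L \<longleftrightarrow> (\<forall>x y. L (x + y) = L x + L y) \<and> (\<forall>c x. L (scl c x) = scl c (L x))"

lemma ulin_zero: "ulin L \<Longrightarrow> L 0 = 0"
  by (metis ulin_def scl_simps(7))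

lemma ulin_sum: "ulin L \<Longrightarrow> L (sum f A) = (\<Sum>a\<in>A. L (f a))"
  by (induction A rule: infinite_finite_induct) (simp_all add: ulin_zero, simp add: ulin_def)

lemma ulin_decomp: "ulin L \<Longrightarrow> L x = (\<Sum>p\<in>{p. Rep x p \<noteq> 0}. scl (Rep x p) (L (mon p)))"
  by (subst ucl_decomp[of x]) (simp add: ulin_sum, simp add: ulin_def)

lemma ulin_eqI:
  assumes "ulin L" "ulin M" "\<And>p. snd p \<subseteq> {1..4} \<Longrightarrow> L (mon p) = M (mon p)"
  shows "L x = M x"
  unfolding ulin_decomp[OF assms(1), of x] ulin_decomp[OF assms(2), of x]
  using assms(3)[OF Rep_supp[of x]] by (intro sum.cong) simp_all

lemma ulin_comp: "ulin L \<Longrightarrow> ulin M \<Longrightarrow> ulin (\<lambda>x. L (M x))"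
  and ulin_id: "ulin (\<lambda>x. x)"
  by (simp_all add: ulin_def)

lemma ulin_rmul: "ulin (rmul j)" by (simp add: ulin_def rmul_simps)

lemma ulin_theta: "ulin theta"
  by (auto simp: ulin_def rep_simps theta.rep_eq intro!: ucl_eqI)

lemma theta_rmul: "theta (rmul j x) = rmul j (theta x)"
  by (rule ucl_eqI) (auto simp: rmul.rep_eq theta.rep_eq rop_def)

lemma theta_fold: "theta (fold rmul xs x) = fold rmul xs (theta x)"
  by (induction xs arbitrary: x) (simp_all add: theta_rmul)

definition umulm :: "ucl \<Rightarrow> nat \<times> nat set \<Rightarrow> ucl" where
  "umulm x q = fold rmul (sorted_list_of_set (snd q)) ((theta ^^ fst q) x)"

lemma ulin_um: "ulin (\<lambda>x. umulm x q)"
proof -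
  have f: "ulin (fold rmul xs)" for xs
    by (induction xs) (simp_all add: ulin_id[unfolded id_def] id_def ulin_comp ulin_rmul comp_def)
  have "ulin (theta ^^ k)" for k
    by (induction k) (simp_all add: ulin_id id_def ulin_comp ulin_theta comp_def)
  then show ?thesis unfolding umulm_def using f ulin_comp by blast
qed

lemma theta_pow_mon: "J \<subseteq> {1..4} \<Longrightarrow> (theta ^^ m) (mon (k, J)) = mon (k + m, J)"
proof (induction m)
  case (Suc m)
  have "theta (mon (k + m, J)) = mon (k + Suc m, J)" if "J \<subseteq> {1..4}"
    by (rule ucl_eqI) (use that in \<open>auto simp: theta.rep_eq Rep_mon dlt_def\<close>)
  then show ?case using Suc by simp
qed simp

lemma umul_mono_um:
  assumes "snd p \<subseteq> {1..4}" "snd q \<subseteq> {1..4}"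
  shows "umul_mono p q = Rep (umulm (mon p) q)"
proof -
  have *: "fold rmul_eta xs (Rep x) = Rep (fold rmul xs x)" if "set xs \<subseteq> {1..4}" for xs x
    using that by (induction xs arbitrary: x) (simp_all add: rmul_eta_rmul)
  have "set (sorted_list_of_set (snd q)) \<subseteq> {1..4}" using assms(2) fin14 by simp
  from *[OF this, of "mon (fst p + fst q, snd p)"] show ?thesis
    using assms theta_pow_mon[of "snd p" "fst q" "fst p"] by (simp add: umul_mono_def umulm_def Rep_mon)
qed

definition mulc :: "ucl \<Rightarrow> ucl \<Rightarrow> ucl" where
  "mulc x y = (\<Sum>q\<in>{q. Rep y q \<noteq> 0}. scl (Rep y q) (umulm x q))"

lemma umul_Rep: "umul (Rep x) (Rep y) = Rep (mulc x y)"
proof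
  fix z
  have "Rep (mulc x y) z = (\<Sum>q\<in>{q. Rep y q \<noteq> 0}. Rep y q * Rep (umulm x q) z)"
    by (simp add: mulc_def Rep_sum rep_simps)
  also have "\<dots> = (\<Sum>q\<in>{q. Rep y q \<noteq> 0}. \<Sum>p\<in>{p. Rep x p \<noteq> 0}. Rep x p * Rep y q * umul_mono p q z)"
  proof (rule sum.cong)
    fix q assume q: "q \<in> {q. Rep y q \<noteq> 0}"
    show "Rep y q * Rep (umulm x q) z = (\<Sum>p\<in>{p. Rep x p \<noteq> 0}. Rep x p * Rep y q * umul_mono p q z)"
      unfolding ulin_decomp[OF ulin_um, of x q] Rep_sum sum_distrib_left
      using q by (intro sum.cong) (simp_all add: rep_simps umul_mono_um[OF Rep_supp[of x] Rep_supp[of y]])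
  qed simp
  also have "\<dots> = umul (Rep x) (Rep y) z"
    unfolding umul_def by (rule sum.swap)
  finally show "umul (Rep x) (Rep y) z = Rep (mulc x y) z" by simp
qed

lemma mulc_sum:
  assumes "finite A" "{q. Rep y q \<noteq> 0} \<subseteq> A"
  shows "mulc x y = (\<Sum>q\<in>A. scl (Rep y q) (umulm x q))"
  unfolding mulc_def using assms by (intro sum.mono_neutral_left) (auto simp: scl_simps)

lemma scl_add: "scl (c + d) x = scl c x + scl d x"
  by (rule ucl_eqI) (simp add: rep_simps algebra_simps)

lemma ulin_mulc: "ulin (mulc x)"
proof -
  have "mulc x (y + y') = mulc x y + mulc x y'" for y y'
  proof -
    let ?A = "{q. Rep y q \<noteq> 0} \<union> {q. Rep y' q \<noteq> 0}"
    have A: "finite ?A" using finite_Rep by simp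
    have "mulc x (y + y') = (\<Sum>q\<in>?A. scl (Rep (y + y') q) (umulm x q))"
      by (rule mulc_sum[OF A]) (auto simp: rep_simps)
    also have "\<dots> = (\<Sum>q\<in>?A. scl (Rep y q) (umulm x q)) + (\<Sum>q\<in>?A. scl (Rep y' q) (umulm x q))"
      by (simp add: rep_simps scl_add sum.distrib)
    also have "\<dots> = mulc x y + mulc x y'"
      by (subst (1 2) mulc_sum[OF A]) auto
    finally show ?thesis .
  qed
  moreover have "mulc x (scl c y) = scl c (mulc x y)" for c y
  proof -
    have s: "ulin (scl c)" by (simp add: ulin_def scl_simps mult.commute)
    have "mulc x (scl c y) = (\<Sum>q\<in>{q. Rep y q \<noteq> 0}. scl (Rep (scl c y) q) (umulm x q))"
      by (rule mulc_sum[OF finite_Rep]) (auto simp: rep_simps)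
    then show ?thesis by (simp add: mulc_def ulin_sum[OF s] scl_simps rep_simps)
  qed
  ultimately show ?thesis by (simp add: ulin_def)
qed

lemma mulc_mon: "snd p \<subseteq> {1..4} \<Longrightarrow> mulc x (mon p) = umulm x p"
  using mulc_sum[of "{p}" "mon p" x] by (auto simp: Rep_mon dlt_def scl_simps split: if_splits)

lemma mulc_one: "mulc x one = x"
  by (simp add: mulc_mon umulm_def)

lemma rmul_mon:
  assumes "J \<subseteq> {1..4}" "j \<in> {1..4}"
  shows "rmul j (mon (k, J)) = (if j \<in> J then scl (- usgn J j / 2) (mon (k + 1, J - {j})) else scl (usgn J j) (mon (k, insert j J)))"
proof (rule ucl_eqI)
  fix k' and J' :: "nat set"
  have sub: "J - {j} \<subseteq> {1..4}" "insert j J \<subseteq> {1..4}" using assms by auto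
  have u: "usgn (J - {j}) j = usgn J j" "usgn (insert j J) j = usgn J j"
    by (simp_all add: usgn_def ngt_diff ngt_insert)
  have L: "Rep (rmul j (mon (k, J))) (k', J') = rop j (dlt (k, J)) (k', J')"
    using assms by (simp add: rmul.rep_eq Rep_mon)
  show "Rep (rmul j (mon (k, J))) (k', J') = Rep (if j \<in> J then scl (- usgn J j / 2) (mon (k + 1, J - {j})) else scl (usgn J j) (mon (k, insert j J))) (k', J')"
  proof (cases "j \<in> J")
    case True
    have "rop j (dlt (k, J)) (k', J') = - usgn J j / 2 * dlt (k + 1, J - {j}) (k', J')"
    proof (cases "j \<in> J'")
      case True
      with \<open>j \<in> J\<close> have "J' - {j} \<noteq> J" "J' \<noteq> J - {j}" by auto
      then show ?thesis using True by (simp add: rop_def dlt_def)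
    next
      case False
      then have e: "insert j J' = J \<longleftrightarrow> J' = J - {j}" using \<open>j \<in> J\<close> by auto
      show ?thesis
      proof (cases "J' = J - {j}")
        case True
        then show ?thesis using e u \<open>j \<in> J\<close> by (auto simp: rop_def dlt_def insert_absorb)
      qed (use e False in \<open>simp add: rop_def dlt_def\<close>)
    qed
    then show ?thesis using True sub by (simp only: L if_True scl.rep_eq Rep_mon snd_conv)
  next
    case False
    have "rop j (dlt (k, J)) (k', J') = usgn J j * dlt (k, insert j J) (k', J')"
    proof (cases "j \<in> J'")
      case True
      then have e: "J' - {j} = J \<longleftrightarrow> J' = insert j J" using \<open>j \<notin> J\<close> by auto
      show ?thesis
      proof (cases "J' = insert j J")
        case True
        then show ?thesis using e u \<open>j \<notin> J\<close> by (auto simp: rop_def dlt_def)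
      qed (use e True in \<open>simp add: rop_def dlt_def\<close>)
    next
      case False
      with \<open>j \<notin> J\<close> have "insert j J' \<noteq> J" "J' \<noteq> insert j J" by auto
      then show ?thesis using False by (simp add: rop_def dlt_def)
    qed
    then show ?thesis using False sub by (simp only: L if_False scl.rep_eq Rep_mon snd_conv)
  qed
qed

lemma insort_snoc: "(j::nat) < a \<Longrightarrow> insort j (xs @ [a]) = insort j xs @ [a]"
  by (induction xs) auto

lemma insort_end: "\<forall>a\<in>set xs. a < (j::nat) \<Longrightarrow> insort j xs = xs @ [j]"
  by (induction xs) auto

text \<open>Multiplying by eta_j in its sorted place differs from multiplying by it last by one sign
  for each larger index.\<close>

lemma fold_insort:
  assumes "sorted xs" "distinct xs" "j \<notin> set xs"
  shows "fold rmul (insort j xs) x = scl (usgn (set xs) j) (rmul j (fold rmul xs x))"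
  using assms
proof (induction xs rule: rev_induct)
  case Nil then show ?case by (simp add: usgn_def ngt_def scl_simps)
next
  case (snoc a xs)
  show ?case
  proof (cases "j < a")
    case True
    have "usgn (insert a (set xs)) j = - usgn (set xs) j"
      using usgn_insert[of "set xs" a j] True snoc.prems by simp
    moreover have "rmul a (rmul j (fold rmul xs x)) = - rmul j (rmul a (fold rmul xs x))" using True by (intro rmul_anti) simp
    moreover have "scl (- c) y = - scl c y" for c y by (rule ucl_eqI) (simp add: rep_simps)
    ultimately show ?thesis using snoc True by (simp add: insort_snoc sorted_append rmul_simps scl_simps)
  next
    case False
    then have "\<forall>b\<in>set (xs @ [a]). b < j" using snoc.prems by (auto simp: sorted_append) 
    moreover from this have "{b \<in> set (xs @ [a]). j < b} = {}" by fastforce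
    then have "usgn (set (xs @ [a])) j = 1" unfolding usgn_def ngt_def by (simp only: card.empty power_0)
    ultimately show ?thesis by (simp only: insort_end scl_simps) simp
  qed
qed

lemma um_insert:
  assumes "J \<subseteq> {1..4}" "j \<notin> J"
  shows "umulm x (k, insert j J) = scl (usgn J j) (rmul j (umulm x (k, J)))"
  using fold_insort[of "sorted_list_of_set J" j "(theta ^^ k) x"] fin14[OF assms(1)] assms(2)
  by (simp add: umulm_def sorted_list_of_set_insert)

text \<open>Associativity for a generator on the right, which by linearity is checked on monomials
  y. If eta_j already occurs in y, it is first moved to the end and then squared.\<close>

lemma mulc_rmul:
  assumes j: "j \<in> {1..4}" shows "mulc x (rmul j y) = rmul j (mulc x y)"
proof (rule ulin_eqI[where L = "\<lambda>y. mulc x (rmul j y)" and M = "\<lambda>y. rmul j (mulc x y)"])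
  show "ulin (\<lambda>y. mulc x (rmul j y))" "ulin (\<lambda>y. rmul j (mulc x y))"
    by (rule ulin_comp[OF ulin_mulc ulin_rmul] ulin_comp[OF ulin_rmul ulin_mulc])+
  fix p :: "nat \<times> nat set" assume p: "snd p \<subseteq> {1..4}"
  obtain k J where pk: "p = (k, J)" by (cases p)
  have J: "J \<subseteq> {1..4}" "J - {j} \<subseteq> {1..4}" "insert j J \<subseteq> {1..4}" using p pk j by auto
  have ms: "mulc x (scl c z) = scl c (mulc x z)" for c z using ulin_mulc by (simp add: ulin_def)
  show "mulc x (rmul j (mon p)) = rmul j (mulc x (mon p))"
  proof (cases "j \<in> J")
    case False
    then show ?thesis using J j pk by (simp add: rmul_mon ms mulc_mon um_insert scl_simps)
  next
    case True
    have t: "umulm x (k + 1, J - {j}) = theta (umulm x (k, J - {j}))" by (simp add: umulm_def theta_fold)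
    have u: "usgn (J - {j}) j = usgn J j" by (simp add: usgn_def ngt_diff)
    have "umulm x (k, J) = scl (usgn J j) (rmul j (umulm x (k, J - {j})))"
      using um_insert[OF J(2), of j x k] True by (simp add: insert_absorb u)
    then have "rmul j (umulm x (k, J)) = scl (- usgn J j / 2) (umulm x (k + 1, J - {j}))"
      using rmul_sq[OF j] by (simp add: rmul_simps scl_simps t[unfolded Suc_eq_plus1[symmetric]])
    then show ?thesis using J j pk True by (simp add: rmul_mon ms mulc_mon)
  qed
qed

definition W :: "nat \<Rightarrow> nat \<Rightarrow> ucl \<Rightarrow> ucl" where
  "W a b = (if a = 1 \<and> b = 1 then w11 else if a = 2 \<and> b = 2 then w22
            else if a = 1 \<and> b = 2 then w12 else w21)"

lemma W_eqs: "W (Suc 0) (Suc 0) = w11" "W (Suc 0) 2 = w12" "W 2 (Suc 0) = w21" "W 2 2 = w22"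
  by (simp_all add: W_def)

lemma mulc_lin: "mulc x (y + z) = mulc x y + mulc x z" "mulc x (y - z) = mulc x y - mulc x z"
  "mulc x (- y) = - mulc x y" "mulc x (scl c y) = scl c (mulc x y)"
proof -
  have l: "mulc x (y + z) = mulc x y + mulc x z" for y z using ulin_mulc by (simp add: ulin_def)
  show "mulc x (y + z) = mulc x y + mulc x z" by (rule l)
  show s: "mulc x (scl c y) = scl c (mulc x y)" for c y using ulin_mulc by (simp add: ulin_def)
  have m: "scl (- 1) y = - y" for y by (rule ucl_eqI) (simp add: rep_simps)
  show n: "mulc x (- y) = - mulc x y" for y using s[of "-1" y] by (simp add: m)
  show "mulc x (y - z) = mulc x y - mulc x z" using l[of y "- z"] by (simp add: n)
qed

lemma mulc_W: "mulc x (W a b y) = W a b (mulc x y)"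
  by (simp add: W_def w11_def w12_def w21_def w22_def mulc_lin mulc_rmul)

lemma eta_Rep: "j \<in> {1..4} \<Longrightarrow> eta j = Rep (rmul j one)"
  by (simp add: rmul_mon eta_def usgn_def ngt_def scl_simps Rep_mon)

lemma wgen_Rep: "wgen a b = Rep (W a b one)"
  by (intro ext) (simp add: wgen_def W_def w11_def w12_def w21_def w22_def eta_Rep rep_simps)

lemma umul_wgen: "umul (Rep x) (wgen a b) = Rep (W a b x)"
  by (simp add: wgen_Rep umul_Rep mulc_W mulc_one)

lemma uadd_Rep: "uadd (Rep x) (Rep y) = Rep (x + y)"
  by (simp add: uadd_def plus_ucl.rep_eq)

text \<open>Operators of right multiplication compose in reverse order: the factor written first
  acts first.\<close>

lemma umul_umul: "umul (Rep x) (umul (wgen a b) (wgen c d)) = Rep (W c d (W a b x))"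
  unfolding wgen_Rep[of a b] umul_wgen by (simp add: umul_Rep mulc_W mulc_one)

subsection \<open>Translation of the arrows\<close>

definition slice :: "me \<Rightarrow> mono \<Rightarrow> ucl" where
  "slice f \<alpha> = Abs (\<lambda>(k, J). f (k, J, \<alpha>))"

lemma Mspace_finite: "f \<in> Mspace v \<Longrightarrow> finite {z. f z \<noteq> 0}"
  by (auto simp: Mspace_def split: prod.splits)

lemma Mspace_sub: "f \<in> Mspace v \<Longrightarrow> f (k, J, \<alpha>) \<noteq> 0 \<Longrightarrow> J \<subseteq> {1..4}"
  by (cases \<alpha>) (auto simp: Mspace_def split: prod.splits)

lemma Rep_slice:
  assumes f: "f \<in> Mspace v" shows "Rep (slice f \<alpha>) (k, J) = f (k, J, \<alpha>)"
proof -
  have "finite {z. (\<lambda>(k, J). f (k, J, \<alpha>)) z \<noteq> 0}"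
    by (rule finite_subset[OF _ finite_imageI[OF Mspace_finite[OF f], of "\<lambda>(k, J, \<alpha>). (k, J)"]])
       (auto intro!: image_eqI[where x = "(_, _, \<alpha>)"])
  then have "uc (\<lambda>(k, J). f (k, J, \<alpha>))"
    using Mspace_sub[OF f] unfolding uc_def by simp
  then show ?thesis by (simp add: slice_def Abs_inverse)
qed

lemma slice_support:
  assumes f: "f \<in> Mspace v" shows "finite {\<alpha>. slice f \<alpha> \<noteq> 0}"
proof (rule finite_subset[OF _ finite_imageI[OF Mspace_finite[OF f], of "\<lambda>(k, J, \<alpha>). \<alpha>"]])
  show "{\<alpha>. slice f \<alpha> \<noteq> 0} \<subseteq> (\<lambda>(k, J, \<alpha>). \<alpha>) ` {z. f z \<noteq> 0}"
  proof
    fix \<alpha> assume "\<alpha> \<in> {\<alpha>. slice f \<alpha> \<noteq> 0}"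
    then have "slice f \<alpha> \<noteq> 0" by simp
    then obtain k J where "Rep (slice f \<alpha>) (k, J) \<noteq> Rep 0 (k, J)" using ucl_eqI by metis
    then have "f (k, J, \<alpha>) \<noteq> 0" by (simp add: Rep_slice[OF f] rep_simps)
    then show "\<alpha> \<in> (\<lambda>(k, J, \<alpha>). \<alpha>) ` {z. f z \<noteq> 0}" by (intro image_eqI[where x = "(k, J, \<alpha>)"]) simp_all
  qed
qed

lemma umul_dlt:
  "umul u r z = (\<Sum>p\<in>{p. u p \<noteq> 0}. u p * umul (dlt p) r z)"
proof -
  have "{q. dlt p q \<noteq> 0} = {p}" for p :: "nat \<times> nat set" by (auto simp: dlt_def)
  then show ?thesis unfolding umul_def by (simp add: dlt_def sum_distrib_left mult.assoc)
qed

text \<open>Reindexing the basis triples as a product lets the sum over (k, J) assemble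
  \<open>slice f\<close> at each monomial and disappear into \<open>umul\<close>, by linearity in
  its first argument. Only the sum over monomials remains, and on it the second tensor factor
  acts.\<close>

lemma genmap_eval:
  assumes f: "f \<in> Mspace v"
  shows "genmap ts f (k, J, \<beta>) =
    (\<Sum>t\<leftarrow>ts. lin (snd t) (\<lambda>\<alpha>. umul (Rep (slice f \<alpha>)) (fst t) (k, J)) \<beta>)"
proof -
  let ?S = "{z. f z \<noteq> 0}"
  define A where "A = (\<lambda>(k, J, \<alpha>). \<alpha>) ` ?S"
  define P where "P = (\<lambda>(k, J, \<alpha>). (k, J)) ` ?S"
  have fin: "finite ?S" "finite A" "finite P" using Mspace_finite[OF f] by (simp_all add: A_def P_def)
  define sh where "sh = (\<lambda>(p :: nat \<times> nat set, \<alpha> :: mono). (fst p, snd p, \<alpha>))"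
  have inj: "inj_on sh (P \<times> A)" by (auto simp: inj_on_def sh_def)
  have sub: "?S \<subseteq> sh ` (P \<times> A)"
  proof
    fix z assume "z \<in> ?S"
    moreover obtain k J \<alpha> where "z = (k, J, \<alpha>)" by (cases z)
    ultimately have "z = sh ((k, J), \<alpha>)" "(k, J) \<in> P" "\<alpha> \<in> A" unfolding P_def A_def
      by (auto simp: sh_def intro!: image_eqI[where x = "(k, J, \<alpha>)"])
    then show "z \<in> sh ` (P \<times> A)" by blast
  qed
  define E where "E = (\<lambda>\<alpha> p. \<Sum>t\<leftarrow>ts. umul (dlt p) (fst t) (k, J) * snd t \<alpha> \<beta>)"
  have "genmap ts f (k, J, \<beta>) = (\<Sum>b\<in>sh ` (P \<times> A). f b * (case b of (k', J', \<alpha>) \<Rightarrow> E \<alpha> (k', J')))"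
    unfolding genmap_def using sub fin
    by (subst lin_sum[of "sh ` (P \<times> A)"]) (auto intro!: sum.cong simp: E_def ten_def)
  also have "\<dots> = (\<Sum>(p, \<alpha>)\<in>P \<times> A. f (fst p, snd p, \<alpha>) * E \<alpha> p)"
    by (subst sum.reindex[OF inj]) (auto intro!: sum.cong simp: sh_def)
  also have "\<dots> = (\<Sum>\<alpha>\<in>A. \<Sum>p\<in>P. f (fst p, snd p, \<alpha>) * E \<alpha> p)"
    by (subst sum.cartesian_product[symmetric]) (rule sum.swap)
  also have "\<dots> = (\<Sum>\<alpha>\<in>A. \<Sum>t\<leftarrow>ts. (\<Sum>p\<in>P. f (fst p, snd p, \<alpha>) * umul (dlt p) (fst t) (k, J)) * snd t \<alpha> \<beta>)"
  proof (intro sum.cong refl)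
    fix \<alpha>
    show "(\<Sum>p\<in>P. f (fst p, snd p, \<alpha>) * E \<alpha> p) =
        (\<Sum>t\<leftarrow>ts. (\<Sum>p\<in>P. f (fst p, snd p, \<alpha>) * umul (dlt p) (fst t) (k, J)) * snd t \<alpha> \<beta>)"
      unfolding E_def by (induction ts) (simp_all add: sum.distrib distrib_left sum_distrib_right mult.assoc)
  qed
  also have "\<dots> = (\<Sum>\<alpha>\<in>A. \<Sum>t\<leftarrow>ts. umul (Rep (slice f \<alpha>)) (fst t) (k, J) * snd t \<alpha> \<beta>)"
  proof (intro sum.cong refl arg_cong[where f = sum_list] map_cong)
    fix \<alpha> and t :: "ue \<times> (mono \<Rightarrow> mono \<Rightarrow> complex)"
    have "umul (Rep (slice f \<alpha>)) (fst t) (k, J)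
        = (\<Sum>p\<in>P. Rep (slice f \<alpha>) p * umul (dlt p) (fst t) (k, J))"
      unfolding umul_dlt[of "Rep (slice f \<alpha>)"]
    proof (rule sum.mono_neutral_left[OF fin(3)])
      show "{p. Rep (slice f \<alpha>) p \<noteq> 0} \<subseteq> P"
        by (auto simp: P_def Rep_slice[OF f] intro!: image_eqI[where x = "(_, _, \<alpha>)"])
    qed auto
    also have "\<dots> = (\<Sum>p\<in>P. f (fst p, snd p, \<alpha>) * umul (dlt p) (fst t) (k, J))"
      by (intro sum.cong) (auto simp: Rep_slice[OF f])
    finally show "(\<Sum>p\<in>P. f (fst p, snd p, \<alpha>) * umul (dlt p) (fst t) (k, J)) * snd t \<alpha> \<beta>
       = umul (Rep (slice f \<alpha>)) (fst t) (k, J) * snd t \<alpha> \<beta>" by simp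
  qed
  also have "\<dots> = (\<Sum>t\<leftarrow>ts. \<Sum>\<alpha>\<in>A. umul (Rep (slice f \<alpha>)) (fst t) (k, J) * snd t \<alpha> \<beta>)"
    by (induction ts) (simp_all add: sum.distrib)
  also have "\<dots> = (\<Sum>t\<leftarrow>ts. lin (snd t) (\<lambda>\<alpha>. umul (Rep (slice f \<alpha>)) (fst t) (k, J)) \<beta>)"
  proof (intro arg_cong[where f = sum_list] map_cong refl)
    fix t :: "ue \<times> (mono \<Rightarrow> mono \<Rightarrow> complex)"
    have "{\<alpha>. umul (Rep (slice f \<alpha>)) (fst t) (k, J) \<noteq> 0} \<subseteq> A"
    proof
      fix \<alpha> assume "\<alpha> \<in> {\<alpha>. umul (Rep (slice f \<alpha>)) (fst t) (k, J) \<noteq> 0}"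
      then obtain p where "Rep (slice f \<alpha>) p \<noteq> 0"
        unfolding umul_dlt[of "Rep _"] by (auto elim!: sum.not_neutral_contains_not_neutral)
      then have "f (fst p, snd p, \<alpha>) \<noteq> 0" using Rep_slice[OF f, of \<alpha> "fst p" "snd p"] by simp
      then show "\<alpha> \<in> A" unfolding A_def by (intro image_eqI[where x = "(fst p, snd p, \<alpha>)"]) simp_all
    qed
    then show "(\<Sum>\<alpha>\<in>A. umul (Rep (slice f \<alpha>)) (fst t) (k, J) * snd t \<alpha> \<beta>)
      = lin (snd t) (\<lambda>\<alpha>. umul (Rep (slice f \<alpha>)) (fst t) (k, J)) \<beta>"
      by (rule lin_sum[OF fin(2), symmetric])
  qed
  finally show ?thesis .
qed

section \<open>Coefficient form of the operators on V_X\<close>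

definition px :: "vlab \<Rightarrow> nat \<Rightarrow> (mono \<Rightarrow> complex) \<Rightarrow> mono \<Rightarrow> complex" where
  "px X a c = (\<lambda>(a1, a2, b1, b2).
     if xpoly X then (if a = 1 then of_nat (Suc a1) * c (Suc a1, a2, b1, b2) else of_nat (Suc a2) * c (a1, Suc a2, b1, b2))
     else if a = 1 then (if a1 = 0 then 0 else c (a1 - 1, a2, b1, b2)) else (if a2 = 0 then 0 else c (a1, a2 - 1, b1, b2)))"

definition py :: "vlab \<Rightarrow> nat \<Rightarrow> (mono \<Rightarrow> complex) \<Rightarrow> mono \<Rightarrow> complex" where
  "py X a c = (\<lambda>(a1, a2, b1, b2).
     if ypoly X then (if a = 1 then of_nat (Suc b1) * c (a1, a2, Suc b1, b2) else of_nat (Suc b2) * c (a1, a2, b1, Suc b2))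
     else if a = 1 then (if b1 = 0 then 0 else c (a1, a2, b1 - 1, b2)) else (if b2 = 0 then 0 else c (a1, a2, b1, b2 - 1)))"

lemma lin_pullback:
  assumes "finite {\<alpha>. c \<alpha> \<noteq> 0}" "\<And>\<alpha>. \<phi> \<alpha> \<beta> = (if ok \<and> \<alpha> = \<gamma> then x else 0)"
  shows "lin \<phi> c \<beta> = (if ok then x * c \<gamma> else 0)"
  using lin_single[OF assms(1), of \<gamma> \<phi> \<beta>] assms(2) by simp

lemma lin_dx:
  assumes "finite {\<alpha>. c \<alpha> \<noteq> 0}" shows "lin (dx X a) c = px X a c"
proof
  fix \<beta> :: mono obtain a1 a2 b1 b2 where \<beta>: "\<beta> = (a1, a2, b1, b2)" by (cases \<beta>)
  consider "xpoly X" "a = 1" | "xpoly X" "a \<noteq> 1" | "\<not> xpoly X" "a = 1" | "\<not> xpoly X" "a \<noteq> 1" by blast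
  then show "lin (dx X a) c \<beta> = px X a c \<beta>" unfolding \<beta>
  proof cases
    case 1
    then show "lin (dx X a) c (a1, a2, b1, b2) = px X a c (a1, a2, b1, b2)"
      by (subst lin_pullback[OF assms, where ok = "True" and \<gamma> = "(Suc a1, a2, b1, b2)" and x = "of_nat (Suc a1)"]) (auto simp: dx_def px_def dlt_def split: if_splits)
  next
    case 2
    then show "lin (dx X a) c (a1, a2, b1, b2) = px X a c (a1, a2, b1, b2)"
      by (subst lin_pullback[OF assms, where ok = "True" and \<gamma> = "(a1, Suc a2, b1, b2)" and x = "of_nat (Suc a2)"]) (auto simp: dx_def px_def dlt_def split: if_splits)
  next
    case 3
    then show "lin (dx X a) c (a1, a2, b1, b2) = px X a c (a1, a2, b1, b2)"
      by (subst lin_pullback[OF assms, where ok = "a1 > 0" and \<gamma> = "(a1 - 1, a2, b1, b2)" and x = "1"]) (auto simp: dx_def px_def dlt_def split: if_splits)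
  next
    case 4
    then show "lin (dx X a) c (a1, a2, b1, b2) = px X a c (a1, a2, b1, b2)"
      by (subst lin_pullback[OF assms, where ok = "a2 > 0" and \<gamma> = "(a1, a2 - 1, b1, b2)" and x = "1"]) (auto simp: dx_def px_def dlt_def split: if_splits)
  qed
qed

lemma lin_dy:
  assumes "finite {\<alpha>. c \<alpha> \<noteq> 0}" shows "lin (dy X a) c = py X a c"
proof
  fix \<beta> :: mono obtain a1 a2 b1 b2 where \<beta>: "\<beta> = (a1, a2, b1, b2)" by (cases \<beta>)
  consider "ypoly X" "a = 1" | "ypoly X" "a \<noteq> 1" | "\<not> ypoly X" "a = 1" | "\<not> ypoly X" "a \<noteq> 1" by blast
  then show "lin (dy X a) c \<beta> = py X a c \<beta>" unfolding \<beta>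
  proof cases
    case 1
    then show "lin (dy X a) c (a1, a2, b1, b2) = py X a c (a1, a2, b1, b2)"
      by (subst lin_pullback[OF assms, where ok = "True" and \<gamma> = "(a1, a2, Suc b1, b2)" and x = "of_nat (Suc b1)"]) (auto simp: dy_def py_def dlt_def split: if_splits)
  next
    case 2
    then show "lin (dy X a) c (a1, a2, b1, b2) = py X a c (a1, a2, b1, b2)"
      by (subst lin_pullback[OF assms, where ok = "True" and \<gamma> = "(a1, a2, b1, Suc b2)" and x = "of_nat (Suc b2)"]) (auto simp: dy_def py_def dlt_def split: if_splits)
  next
    case 3
    then show "lin (dy X a) c (a1, a2, b1, b2) = py X a c (a1, a2, b1, b2)"
      by (subst lin_pullback[OF assms, where ok = "b1 > 0" and \<gamma> = "(a1, a2, b1 - 1, b2)" and x = "1"]) (auto simp: dy_def py_def dlt_def split: if_splits)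
  next
    case 4
    then show "lin (dy X a) c (a1, a2, b1, b2) = py X a c (a1, a2, b1, b2)"
      by (subst lin_pullback[OF assms, where ok = "b2 > 0" and \<gamma> = "(a1, a2, b1, b2 - 1)" and x = "1"]) (auto simp: dy_def py_def dlt_def split: if_splits)
  qed
qed

lemma lin_sel: "finite {\<alpha>. c \<alpha> \<noteq> 0} \<Longrightarrow> lin (sel \<beta> \<gamma>) c = (\<lambda>\<delta>. if \<delta> = \<gamma> then c \<beta> else 0)"
  by (rule ext, subst lin_single[of c \<beta>]) (auto simp: sel_def dlt_def)

lemma dx_finite: "finite {\<beta>. dx X a \<alpha> \<beta> \<noteq> 0}" and dy_finite: "finite {\<beta>. dy X a \<alpha> \<beta> \<noteq> 0}"
proof -
  have d: "finite {\<beta>. x * dlt \<gamma> \<beta> \<noteq> 0}" "finite {\<beta>. dlt \<gamma> \<beta> \<noteq> 0}" for x and \<gamma> :: mono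
    by (auto intro: finite_subset[of _ "{\<gamma>}"] simp: dlt_def)
  show "finite {\<beta>. dx X a \<alpha> \<beta> \<noteq> 0}" "finite {\<beta>. dy X a \<alpha> \<beta> \<noteq> 0}"
    using d by (cases \<alpha>; simp add: dx_def dy_def)+
qed

lemma lin_lcomp:
  assumes c: "finite {\<alpha>. c \<alpha> \<noteq> 0}" and \<phi>: "\<And>\<alpha>. finite {\<beta>. \<phi> \<alpha> \<beta> \<noteq> 0}"
  shows "lin (lcomp \<phi> \<psi>) c = lin \<psi> (lin \<phi> c)"
proof
  fix z
  let ?A = "{\<alpha>. c \<alpha> \<noteq> 0}"
  let ?B = "\<Union>\<alpha>\<in>?A. {\<beta>. \<phi> \<alpha> \<beta> \<noteq> 0}"
  have B: "finite ?B" using c \<phi> by blast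
  have "lin (lcomp \<phi> \<psi>) c z = (\<Sum>\<alpha>\<in>?A. c \<alpha> * (\<Sum>\<beta>\<in>?B. \<phi> \<alpha> \<beta> * \<psi> \<beta> z))"
    unfolding lin_sum[OF c subset_refl] lcomp_def using B
    by (intro sum.cong refl arg_cong[where f = "(*) _"] lin_sum) auto
  also have "\<dots> = (\<Sum>\<beta>\<in>?B. (\<Sum>\<alpha>\<in>?A. c \<alpha> * \<phi> \<alpha> \<beta>) * \<psi> \<beta> z)"
    by (simp add: sum_distrib_left sum_distrib_right mult.assoc) (rule sum.swap)
  also have "\<dots> = lin \<psi> (lin \<phi> c) z"
  proof (subst lin_sum[OF B])
    show "{b. lin \<phi> c b \<noteq> 0} \<subseteq> ?B"
      unfolding lin_def by (auto elim!: sum.not_neutral_contains_not_neutral)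
  qed (simp add: lin_def)
  finally show "lin (lcomp \<phi> \<psi>) c z = lin \<psi> (lin \<phi> c) z" .
qed

lemma lin_finite:
  assumes c: "finite {\<alpha>. c \<alpha> \<noteq> 0}" and \<phi>: "\<And>\<alpha>. finite {\<beta>. \<phi> \<alpha> \<beta> \<noteq> 0}"
  shows "finite {\<beta>. lin \<phi> c \<beta> \<noteq> 0}"
proof (rule finite_subset)
  show "{\<beta>. lin \<phi> c \<beta> \<noteq> 0} \<subseteq> (\<Union>\<alpha>\<in>{\<alpha>. c \<alpha> \<noteq> 0}. {\<beta>. \<phi> \<alpha> \<beta> \<noteq> 0})"
    unfolding lin_def by (auto elim!: sum.not_neutral_contains_not_neutral)
qed (use c \<phi> in blast)

lemma lin_dx_dx: "finite {\<alpha>. c \<alpha> \<noteq> 0} \<Longrightarrow> lin (lcomp (dx X a) (dx X b)) c = px X b (px X a c)"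
  and lin_dy_dy: "finite {\<alpha>. c \<alpha> \<noteq> 0} \<Longrightarrow> lin (lcomp (dy X a) (dy X b)) c = py X b (py X a c)"
  and lin_dx_dy: "finite {\<alpha>. c \<alpha> \<noteq> 0} \<Longrightarrow> lin (lcomp (dx X a) (dy X b)) c = py X b (px X a c)"
proof -
  assume c: "finite {\<alpha>. c \<alpha> \<noteq> 0}"
  have x: "finite {\<alpha>. px X a c \<alpha> \<noteq> 0}" using lin_finite[of c "dx X a", OF c dx_finite] lin_dx[OF c, of X a] by simp
  have y: "finite {\<alpha>. py X a c \<alpha> \<noteq> 0}" using lin_finite[of c "dy X a", OF c dy_finite] lin_dy[OF c, of X a] by simp
  show "lin (lcomp (dx X a) (dx X b)) c = px X b (px X a c)"
    by (simp add: lin_lcomp[OF c dx_finite] lin_dx[OF c] lin_dx[OF x])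
  show "lin (lcomp (dy X a) (dy X b)) c = py X b (py X a c)"
    by (simp add: lin_lcomp[OF c dy_finite] lin_dy[OF c] lin_dy[OF y])
  show "lin (lcomp (dx X a) (dy X b)) c = py X b (px X a c)"
    by (simp add: lin_lcomp[OF c dx_finite] lin_dx[OF c] lin_dy[OF x])
qed

section \<open>Coefficient families in divided powers\<close>

definition dp :: "vlab \<Rightarrow> nat \<Rightarrow> nat \<Rightarrow> nat \<Rightarrow> nat \<Rightarrow> complex" where
  "dp X a1 a2 b1 b2 = (if xpoly X then fact a1 * fact a2 else 1) * (if ypoly X then fact b1 * fact b2 else 1)"

lemma dp_nonzero [simp]: "dp X a1 a2 b1 b2 \<noteq> 0" by (simp add: dp_def)

text \<open>The divided-power rescaling turns differentiation in a polynomial variable into an index shift.\<close>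
definition coeffs :: "vlab \<Rightarrow> me \<Rightarrow> nat \<Rightarrow> nat \<Rightarrow> nat \<Rightarrow> nat \<Rightarrow> ucl" where
  "coeffs X f = (\<lambda>a1 a2 b1 b2. scl (dp X a1 a2 b1 b2) (slice f (a1, a2, b1, b2)))"

definition of_coeffs :: "vlab \<Rightarrow> (nat \<Rightarrow> nat \<Rightarrow> nat \<Rightarrow> nat \<Rightarrow> ucl) \<Rightarrow> me" where
  "of_coeffs X F = (\<lambda>(k, J, a1, a2, b1, b2). Rep (F a1 a2 b1 b2) (k, J) / dp X a1 a2 b1 b2)"

lemma Fam_iff: "F \<in> Fam m n \<longleftrightarrow> (\<forall>a1 a2 b1 b2. F a1 a2 b1 b2 \<noteq> 0 \<longrightarrow> a1 + a2 = m \<and> b1 + b2 = n)"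
proof
  assume "F \<in> Fam m n"
  note F = this
  show "\<forall>a1 a2 b1 b2. F a1 a2 b1 b2 \<noteq> 0 \<longrightarrow> a1 + a2 = m \<and> b1 + b2 = n"
  proof (intro allI impI)
    fix a1 a2 b1 b2 assume nz: "F a1 a2 b1 b2 \<noteq> 0"
    have a: "a1 + a2 = m" using homog_out[OF F, of a1 a2] nz by fastforce
    moreover have "b1 + b2 = n" using homog_out[OF homog_in[OF F a], of b1 b2] nz by fastforce
    ultimately show "a1 + a2 = m \<and> b1 + b2 = n" ..
  qed
qed (auto simp: homog_def fun_eq_iff)

lemma coeffs_Fam: assumes f: "f \<in> Mspace (X, m, n)" shows "coeffs X f \<in> Fam m n"
  unfolding Fam_iff
proof (intro allI impI)
  fix a1 a2 b1 b2 assume "coeffs X f a1 a2 b1 b2 \<noteq> 0"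
  then have "slice f (a1, a2, b1, b2) \<noteq> 0" by (auto simp: coeffs_def scl_simps)
  then obtain k J where "Rep (slice f (a1, a2, b1, b2)) (k, J) \<noteq> Rep 0 (k, J)" using ucl_eqI by metis
  then have "f (k, J, a1, a2, b1, b2) \<noteq> 0" by (simp add: Rep_slice[OF f] rep_simps)
  then show "a1 + a2 = m \<and> b1 + b2 = n" using f by (auto simp: Mspace_def)
qed

lemma Rep_coeffs: "f \<in> Mspace (X, m, n) \<Longrightarrow>
    Rep (coeffs X f a1 a2 b1 b2) (k, J) = dp X a1 a2 b1 b2 * f (k, J, a1, a2, b1, b2)"
  by (simp add: coeffs_def rep_simps Rep_slice)

lemma of_coeffs_Mspace: assumes F: "F \<in> Fam m n" shows "of_coeffs X F \<in> Mspace (X, m, n)"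
proof -
  have nz: "a1 + a2 = m \<and> b1 + b2 = n \<and> J \<subseteq> {1..4}" if "of_coeffs X F (k, J, a1, a2, b1, b2) \<noteq> 0" for k J a1 a2 b1 b2
  proof -
    have "Rep (F a1 a2 b1 b2) (k, J) \<noteq> 0" using that by (auto simp: of_coeffs_def)
    moreover from this have "F a1 a2 b1 b2 \<noteq> 0" by (auto simp: rep_simps)
    ultimately show ?thesis using F Rep_supp[of "F a1 a2 b1 b2" "(k, J)"] by (auto simp: Fam_iff)
  qed
  let ?I = "{..m} \<times> {..m} \<times> {..n} \<times> {..n}"
  let ?S = "\<Union>\<alpha>\<in>?I. (\<lambda>(k, J). (k, J, \<alpha>)) ` {z. Rep (case \<alpha> of (a1, a2, b1, b2) \<Rightarrow> F a1 a2 b1 b2) z \<noteq> 0}"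
  have "{z. of_coeffs X F z \<noteq> 0} \<subseteq> ?S"
  proof
    fix z assume z: "z \<in> {z. of_coeffs X F z \<noteq> 0}"
    obtain k J a1 a2 b1 b2 where zz: "z = (k, J, a1, a2, b1, b2)" by (cases z)
    then have "a1 + a2 = m" "b1 + b2 = n" using nz z by auto
    then have "(a1, a2, b1, b2) \<in> ?I" by auto
    moreover have "z \<in> (\<lambda>(k, J). (k, J, (a1, a2, b1, b2))) ` {z. Rep (F a1 a2 b1 b2) z \<noteq> 0}"
      by (rule image_eqI[where x = "(k, J)"]) (use z zz in \<open>auto simp: of_coeffs_def\<close>)
    ultimately show "z \<in> ?S" by (intro UN_I[of "(a1, a2, b1, b2)"]) auto
  qed
  moreover have "finite ?S" using finite_Rep by (intro finite_UN_I finite_imageI) auto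
  ultimately have "finite {z. of_coeffs X F z \<noteq> 0}" using finite_subset by blast
  then show ?thesis using nz by (auto simp: Mspace_def simp del: One_nat_def)
qed

lemma coeffs_of_coeffs: assumes F: "F \<in> Fam m n" shows "coeffs X (of_coeffs X F) = F"
  by (intro ext ucl_eqI) (simp add: Rep_coeffs[OF of_coeffs_Mspace[OF F]], simp add: of_coeffs_def)

text \<open>After rescaling at both ends the arrow is the operator D. The scaling factor on the left
  belongs to the target, whose label differs from that of the source when the arrow leaves a
  quadrant.\<close>

definition arrow_rep :: "vertex \<Rightarrow> terms \<Rightarrow> vlab \<Rightarrow>
    ((nat \<Rightarrow> nat \<Rightarrow> nat \<Rightarrow> nat \<Rightarrow> ucl) \<Rightarrow> nat \<Rightarrow> nat \<Rightarrow> nat \<Rightarrow> nat \<Rightarrow> ucl) \<Rightarrow> bool" where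
  "arrow_rep v ts Y D \<longleftrightarrow> (\<forall>f\<in>Mspace v. \<forall>k J a1 a2 b1 b2.
     dp Y a1 a2 b1 b2 * genmap ts f (k, J, a1, a2, b1, b2) = Rep (D (coeffs (fst v) f) a1 a2 b1 b2) (k, J))"

lemma arrow_repD: "arrow_rep (X, m, n) ts Y D \<Longrightarrow> f \<in> Mspace (X, m, n) \<Longrightarrow>
    dp Y a1 a2 b1 b2 * genmap ts f (k, J, a1, a2, b1, b2) = Rep (D (coeffs X f) a1 a2 b1 b2) (k, J)"
  by (simp add: arrow_rep_def)

lemma Ker_coeffs:
  assumes "arrow_rep (X, m, n) ts Y D" "f \<in> Mspace (X, m, n)" "genmap ts f = (\<lambda>z. 0)"
  shows "D (coeffs X f) = 0"
  by (intro ext ucl_eqI) (simp add: arrow_repD[OF assms(1,2), symmetric] assms(3) rep_simps)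

lemma Img_of_coeffs:
  assumes out: "outarrow (X0, m0, n0) = Some ((X, m, n), ts)" and rep: "arrow_rep (X0, m0, n0) ts X D"
    and f: "f \<in> Mspace (X, m, n)" and G: "G \<in> Fam m0 n0" "coeffs X f = D G"
  shows "f \<in> Img (X, m, n)"
proof -
  have g: "of_coeffs X0 G \<in> Mspace (X0, m0, n0)" by (rule of_coeffs_Mspace[OF G(1)])
  have "f = genmap ts (of_coeffs X0 G)"
  proof
    fix z :: "nat \<times> nat set \<times> mono" obtain k J a1 a2 b1 b2 where z: "z = (k, J, a1, a2, b1, b2)" by (cases z)
    have "dp X a1 a2 b1 b2 * genmap ts (of_coeffs X0 G) (k, J, a1, a2, b1, b2) = dp X a1 a2 b1 b2 * f (k, J, a1, a2, b1, b2)"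
      unfolding arrow_repD[OF rep g] coeffs_of_coeffs[OF G(1)] G(2)[symmetric] Rep_coeffs[OF f] ..
    then show "f z = genmap ts (of_coeffs X0 G) z" by (simp add: z)
  qed
  then show ?thesis using out g unfolding Img_def by blast
qed

lemma homology_zeroI:
  assumes out: "outarrow (X, m, n) = Some ((Y, m', n'), ts)" and rep: "arrow_rep (X, m, n) ts Y D"
    and inn: "outarrow (X0, m0, n0) = Some ((X, m, n), ts0)" and rep0: "arrow_rep (X0, m0, n0) ts0 X D0"
    and ex: "\<And>F. F \<in> Fam m n \<Longrightarrow> D F = 0 \<Longrightarrow> \<exists>G\<in>Fam m0 n0. F = D0 G"
  shows "homology_zero (X, m, n)"
  unfolding homology_zero_def
proof
  fix f assume "f \<in> Ker (X, m, n)"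
  then have f: "f \<in> Mspace (X, m, n)" "genmap ts f = (\<lambda>z. 0)" using out by (auto simp: Ker_def)
  then obtain G where "G \<in> Fam m0 n0" "coeffs X f = D0 G"
    using ex[OF coeffs_Fam[OF f(1)] Ker_coeffs[OF rep f]] by blast
  then show "f \<in> Img (X, m, n)" by (rule Img_of_coeffs[OF inn rep0 f(1)])
qed

lemma w_scl: "w11 (scl c x) = scl c (w11 x)" "w12 (scl c x) = scl c (w12 x)"
  "w21 (scl c x) = scl c (w21 x)" "w22 (scl c x) = scl c (w22 x)"
  by (simp_all add: w11_def w12_def w21_def w22_def rmul_simps scl_simps mult.commute)

lemma op_finite:
  assumes "f \<in> Mspace v" "V 0 = 0" shows "finite {\<alpha>. Rep (V (slice f \<alpha>)) z \<noteq> 0}"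
  by (rule finite_subset[OF _ slice_support[OF assms(1)]]) (use assms(2) in \<open>auto simp: rep_simps\<close>)

lemma W_zero [simp]: "W a b 0 = 0"
  by (simp add: W_def)

lemma genmap_nabla:
  assumes f: "f \<in> Mspace v"
  shows "genmap (nabla X) f (k, J, \<beta>) = (\<Sum>a\<leftarrow>[1,2]. \<Sum>b\<leftarrow>[1,2].
      py X b (px X a (\<lambda>\<alpha>. Rep (W a b (slice f \<alpha>)) (k, J))) \<beta>)"
proof -
  have fin: "finite {\<alpha>. Rep (W a b (slice f \<alpha>)) z \<noteq> 0}" for a b z
    using op_finite[OF f, of "W a b" z] by simp
  show ?thesis
    unfolding genmap_eval[OF f] by (simp add: nabla_def umul_wgen lin_dx_dy fin)
qed

lemmas coeffs_eval = px_def py_def xpoly_def ypoly_def lower_def raise_def coeffs_def rep_simps W_eqs w_scl dp_def transp_def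

abbreviation "nabA \<equiv> lower (lower w11 w12) (lower w21 w22)"
abbreviation "nabB \<equiv> raise (lower w11 w12) (lower w21 w22)"
abbreviation "nabC \<equiv> raise (raise w11 w12) (raise w21 w22)"
abbreviation "nabD \<equiv> lower (raise w11 w12) (raise w21 w22)"
abbreviation "yyA \<equiv> \<lambda>h. lower w21 w22 (lower w11 w12 h)"
abbreviation "yyD \<equiv> \<lambda>h. raise w21 w22 (raise w11 w12 h)"
abbreviation "xxA \<equiv> \<lambda>h. lower w12 w22 (lower w11 w21 h)"
abbreviation "xxB \<equiv> \<lambda>h. raise w12 w22 (raise w11 w21 h)"

lemma arrow_nabla:
  "arrow_rep (VA, m, n) (nabla VA) VA nabA"
  "arrow_rep (VB, m, n) (nabla VB) VB nabB"
  "arrow_rep (VC, m, n) (nabla VC) VC nabC"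
  "arrow_rep (VD, m, n) (nabla VD) VD nabD"
  unfolding arrow_rep_def
  \<comment> \<open>For A exponents are only shifted upward and simplification closes the goal;
    \<open>fail\<close> rejects any other outcome of the first alternative. Raising has the default
    value 0 at a zero exponent, which calls for the case split.\<close>
  by (intro ballI allI; simp add: genmap_nabla coeffs_eval algebra_simps; fail |
      intro ballI allI; rename_tac a1 a2 b1 b2; case_tac a1; case_tac a2; case_tac b1; case_tac b2;
      simp add: genmap_nabla coeffs_eval algebra_simps)+

interpretation sw: cliff w11 w21 w12 w22 d11 d21 d12 d22
  by (rule std.cliff_swap)

lemma umul_umul_umul:
  "umul (Rep x) (umul (umul (wgen a b) (wgen c d)) (wgen e g)) = Rep (W e g (W c d (W a b x)))"
  "umul (Rep x) (umul (uadd (umul (wgen a b) (wgen c d)) (umul (wgen a' b') (wgen c' d'))) (wgen e g))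
     = Rep (W e g (W c d (W a b x) + W c' d' (W a' b' x)))"
  "umul (Rep x) (uadd (umul (wgen a b) (wgen c d)) (umul (wgen a' b') (wgen c' d')))
     = Rep (W c d (W a b x) + W c' d' (W a' b' x))"
  unfolding wgen_Rep[of a b] wgen_Rep[of a' b'] umul_wgen uadd_Rep
  by (simp_all add: umul_Rep mulc_W mulc_one mulc_lin)

definition nab2 :: "((nat \<Rightarrow> nat \<Rightarrow> ucl) \<Rightarrow> nat \<Rightarrow> nat \<Rightarrow> ucl) \<Rightarrow> (nat \<Rightarrow> nat \<Rightarrow> nat \<Rightarrow> nat \<Rightarrow> ucl) \<Rightarrow> nat \<Rightarrow> nat \<Rightarrow> nat \<Rightarrow> nat \<Rightarrow> ucl" where
  "nab2 P F = transp (\<lambda>b1 b2. P (transp F b1 b2))"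

definition nab2t :: "((nat \<Rightarrow> nat \<Rightarrow> ucl) \<Rightarrow> nat \<Rightarrow> nat \<Rightarrow> ucl) \<Rightarrow> (nat \<Rightarrow> nat \<Rightarrow> nat \<Rightarrow> nat \<Rightarrow> ucl) \<Rightarrow> nat \<Rightarrow> nat \<Rightarrow> nat \<Rightarrow> nat \<Rightarrow> ucl" where
  "nab2t P F = (\<lambda>a1 a2. P (F a1 a2))"

text \<open>The element \<open>z\<close> is the second-order map xxA applied to the two given
  coefficients; the pair \<open>w21\<close>, \<open>w22\<close> then tests whether z lies in the
  image of w22 w21.\<close>

definition nab3t :: "(nat \<Rightarrow> nat \<Rightarrow> nat \<Rightarrow> nat \<Rightarrow> ucl) \<Rightarrow> nat \<Rightarrow> nat \<Rightarrow> nat \<Rightarrow> nat \<Rightarrow> ucl" where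
  "nab3t F = (let z = w12 (w11 (F 1 0 0 0)) + (w12 (w21 (F 0 1 0 0)) + w22 (w11 (F 0 1 0 0)))
     in single 0 0 (single 1 0 (w21 z) + single 0 1 (w22 z)))"

definition nab3 :: "(nat \<Rightarrow> nat \<Rightarrow> nat \<Rightarrow> nat \<Rightarrow> ucl) \<Rightarrow> nat \<Rightarrow> nat \<Rightarrow> nat \<Rightarrow> nat \<Rightarrow> ucl" where
  "nab3 F = (let z = w21 (w11 (F 0 0 1 0)) + (w21 (w12 (F 0 0 0 1)) + w22 (w11 (F 0 0 0 1)))
     in single 1 0 (single 0 0 (w12 z)) + single 0 1 (single 0 0 (w22 z)))"

lemma genmap_nabla2:
  assumes f: "f \<in> Mspace v"
  shows "genmap (nabla2 X) f (k, J, \<beta>) =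
      px X 1 (px X 1 (\<lambda>\<alpha>. Rep (w12 (w11 (slice f \<alpha>))) (k, J))) \<beta>
      + px X 2 (px X 1 (\<lambda>\<alpha>. Rep (w22 (w11 (slice f \<alpha>)) + w12 (w21 (slice f \<alpha>))) (k, J))) \<beta>
      + px X 2 (px X 2 (\<lambda>\<alpha>. Rep (w22 (w21 (slice f \<alpha>))) (k, J))) \<beta>"
proof -
  have fin: "finite {\<alpha>. Rep (w12 (w11 (slice f \<alpha>))) z \<noteq> 0}" "finite {\<alpha>. Rep (w22 (w21 (slice f \<alpha>))) z \<noteq> 0}"
    "finite {\<alpha>. Rep (w22 (w11 (slice f \<alpha>)) + w12 (w21 (slice f \<alpha>))) z \<noteq> 0}" for z
    using op_finite[OF f, of "\<lambda>x. w12 (w11 x)" z] op_finite[OF f, of "\<lambda>x. w22 (w21 x)" z]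
      op_finite[OF f, of "\<lambda>x. w22 (w11 x) + w12 (w21 x)" z] by simp_all
  show ?thesis
    unfolding genmap_eval[OF f] by (simp add: nabla2_def umul_umul umul_umul_umul W_eqs lin_dx_dx fin)
qed

lemma genmap_nabla2t:
  assumes f: "f \<in> Mspace v"
  shows "genmap (nabla2t X) f (k, J, \<beta>) =
      py X 1 (py X 1 (\<lambda>\<alpha>. Rep (w21 (w11 (slice f \<alpha>))) (k, J))) \<beta>
      + py X 2 (py X 1 (\<lambda>\<alpha>. Rep (w21 (w12 (slice f \<alpha>)) + w22 (w11 (slice f \<alpha>))) (k, J))) \<beta>
      + py X 2 (py X 2 (\<lambda>\<alpha>. Rep (w22 (w12 (slice f \<alpha>))) (k, J))) \<beta>"
proof -
  have fin: "finite {\<alpha>. Rep (w21 (w11 (slice f \<alpha>))) z \<noteq> 0}" "finite {\<alpha>. Rep (w22 (w12 (slice f \<alpha>))) z \<noteq> 0}"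
    "finite {\<alpha>. Rep (w21 (w12 (slice f \<alpha>)) + w22 (w11 (slice f \<alpha>))) z \<noteq> 0}" for z
    using op_finite[OF f, of "\<lambda>x. w21 (w11 x)" z] op_finite[OF f, of "\<lambda>x. w22 (w12 x)" z]
      op_finite[OF f, of "\<lambda>x. w21 (w12 x) + w22 (w11 x)" z] by simp_all
  show ?thesis
    unfolding genmap_eval[OF f] by (simp add: nabla2t_def umul_umul umul_umul_umul W_eqs lin_dy_dy fin)
qed

lemma slice_zero:
  assumes "f \<in> Mspace (X, m, n)" "\<not> (a1 + a2 = m \<and> b1 + b2 = n)" shows "slice f (a1, a2, b1, b2) = 0"
proof (rule ucl_eqI)
  fix k J
  have "f (k, J, a1, a2, b1, b2) = 0" using assms unfolding Mspace_def by (simp, metis)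
  then show "Rep (slice f (a1, a2, b1, b2)) (k, J) = Rep 0 (k, J)" by (simp add: Rep_slice[OF assms(1)] rep_simps)
qed

lemma slice_zero':
  assumes "f \<in> Mspace (X, m, n)"
  shows "n = 0 \<Longrightarrow> slice f (a1, a2, Suc b1, b2) = 0" "n = 0 \<Longrightarrow> slice f (a1, a2, b1, Suc b2) = 0"
    "m = 0 \<Longrightarrow> slice f (Suc a1, a2, b1, b2) = 0" "m = 0 \<Longrightarrow> slice f (a1, Suc a2, b1, b2) = 0"
  using slice_zero[OF assms] by auto

text \<open>Source and target have different divided-power factors in the y-variables. They agree at
  exponent zero, and all slices with a positive y-exponent vanish because the y-degree is
  zero.\<close>

lemma arrow_nabla2A: "arrow_rep (VA, m, 0) (nabla2 VA) VD (nab2 xxA)"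
  unfolding arrow_rep_def
proof (intro ballI allI)
  fix f k J and a1 a2 b1 b2 :: nat assume f: "f \<in> Mspace (VA, m, 0)"
  note z = slice_zero'[OF f]
  show "dp VD a1 a2 b1 b2 * genmap (nabla2 VA) f (k, J, a1, a2, b1, b2) =
    Rep (nab2 xxA (coeffs (fst (VA, m, 0)) f) a1 a2 b1 b2) (k, J)"
    by (cases b1; cases b2; simp add: genmap_nabla2[OF f] nab2_def coeffs_eval z scl_simps algebra_simps)
qed

lemma arrow_nabla2B: "arrow_rep (VB, m, 0) (nabla2 VB) VC (nab2 xxB)"
  unfolding arrow_rep_def
proof (intro ballI allI)
  fix f k J and a1 a2 b1 b2 :: nat assume f: "f \<in> Mspace (VB, m, 0)"
  note z = slice_zero'[OF f]
  show "dp VC a1 a2 b1 b2 * genmap (nabla2 VB) f (k, J, a1, a2, b1, b2) =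
    Rep (nab2 xxB (coeffs (fst (VB, m, 0)) f) a1 a2 b1 b2) (k, J)"
    by (cases b1; cases b2; cases a1; cases a2; simp add: genmap_nabla2[OF f] nab2_def coeffs_eval z scl_simps algebra_simps)
qed

lemma arrow_nabla2tA: "arrow_rep (VA, 0, n) (nabla2t VA) VB (nab2t yyA)"
  unfolding arrow_rep_def
proof (intro ballI allI)
  fix f k J and a1 a2 b1 b2 :: nat assume f: "f \<in> Mspace (VA, 0, n)"
  note z = slice_zero'[OF f]
  show "dp VB a1 a2 b1 b2 * genmap (nabla2t VA) f (k, J, a1, a2, b1, b2) =
    Rep (nab2t yyA (coeffs (fst (VA, 0, n)) f) a1 a2 b1 b2) (k, J)"
    by (cases a1; cases a2; simp add: genmap_nabla2t[OF f] nab2t_def coeffs_eval z scl_simps algebra_simps)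
qed

lemma arrow_nabla2tD: "arrow_rep (VD, 0, n) (nabla2t VD) VC (nab2t yyD)"
  unfolding arrow_rep_def
proof (intro ballI allI)
  fix f k J and a1 a2 b1 b2 :: nat assume f: "f \<in> Mspace (VD, 0, n)"
  note z = slice_zero'[OF f]
  show "dp VC a1 a2 b1 b2 * genmap (nabla2t VD) f (k, J, a1, a2, b1, b2) =
    Rep (nab2t yyD (coeffs (fst (VD, 0, n)) f) a1 a2 b1 b2) (k, J)"
    by (cases a1; cases a2; cases b1; cases b2; simp add: genmap_nabla2t[OF f] nab2t_def coeffs_eval z scl_simps algebra_simps)
qed

lemma W3_finite:
  assumes f: "f \<in> Mspace v"
  shows "finite {\<alpha>. Rep (W a b (W c d (W e g (slice f \<alpha>)))) z \<noteq> 0}"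
     "finite {\<alpha>. Rep (W a b (W c d (W e g (slice f \<alpha>)) + W c' d' (W e' g' (slice f \<alpha>)))) z \<noteq> 0}"
    using op_finite[OF f, of "\<lambda>x. W a b (W c d (W e g x))" z]
      op_finite[OF f, of "\<lambda>x. W a b (W c d (W e g x) + W c' d' (W e' g' x))" z] by simp_all

lemma arrow_nabla3: "arrow_rep (VA, 0, 1) nabla3 VC nab3"
  unfolding arrow_rep_def
proof (intro ballI allI)
  fix f k J and a1 a2 b1 b2 :: nat assume f: "f \<in> Mspace (VA, 0, 1)"
  show "dp VC a1 a2 b1 b2 * genmap nabla3 f (k, J, a1, a2, b1, b2) = Rep (nab3 (coeffs (fst (VA, 0, 1)) f) a1 a2 b1 b2) (k, J)"
    unfolding genmap_eval[OF f]
    apply (simp add: nabla3_def umul_umul_umul lin_sel W3_finite[OF f])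
    apply (auto simp: W_eqs nab3_def Let_def coeffs_eval single_def scl_simps algebra_simps)
    done
qed

lemma arrow_nabla3t: "arrow_rep (VA, 1, 0) nabla3t VC nab3t"
  unfolding arrow_rep_def
proof (intro ballI allI)
  fix f k J and a1 a2 b1 b2 :: nat assume f: "f \<in> Mspace (VA, 1, 0)"
  show "dp VC a1 a2 b1 b2 * genmap nabla3t f (k, J, a1, a2, b1, b2) = Rep (nab3t (coeffs (fst (VA, 1, 0)) f) a1 a2 b1 b2) (k, J)"
    unfolding genmap_eval[OF f]
    apply (simp add: nabla3t_def umul_umul_umul lin_sel W3_finite[OF f])
    apply (auto simp: W_eqs nab3t_def Let_def coeffs_eval single_def scl_simps algebra_simps)
    done
qed

subsection \<open>Vertices with zero homology\<close>

lemma single_Fam: "h \<in> Fam1 n \<Longrightarrow> single 0 0 h \<in> Fam 0 n"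
  by (intro single_homog subgrp_zero subgrp_homog) auto

lemma Fam0_eq: "F \<in> Fam 0 n \<Longrightarrow> F = single 0 0 (F 0 0)"
  by (rule homog_0_eq)

lemma nab2t_single: "P 0 = 0 \<Longrightarrow> nab2t P (single 0 0 h) = single 0 0 (P h)"
  by (intro ext) (auto simp: nab2t_def single_def)

lemma nab2_transp: "nab2 P (transp F) = transp (nab2t P F)"
  by (simp add: nab2_def nab2t_def)

lemma transp_Fam: "F \<in> Fam m n \<Longrightarrow> transp F \<in> Fam n m"
  by (simp add: transp_homog)

lemma nab2_eq_zero: "nab2 P F = 0 \<Longrightarrow> P (transp F 0 0) = 0"
  by (auto simp: nab2_def transp_def fun_eq_iff)

lemma nab2t_eq_zero: "nab2t P F = 0 \<Longrightarrow> P (F 0 0) = 0"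
  by (simp add: nab2t_def fun_eq_iff)

lemma uminus_homog: "h \<in> Fam1 n \<Longrightarrow> - h \<in> Fam1 n"
  by (rule subgrp_uminus[OF subgrp_homog]) simp_all

lemma transp_0: "transp (0 :: nat \<Rightarrow> nat \<Rightarrow> nat \<Rightarrow> nat \<Rightarrow> ucl) = 0"
  by (simp add: transp_def fun_eq_iff)

lemma pairs: "anticomm_pair (lower w11 w12) (lower w21 w22)" "anticomm_pair (raise w11 w12) (raise w21 w22)"
  "anticomm_pair (lower w11 w21) (lower w12 w22)" "anticomm_pair (raise w11 w21) (raise w12 w22)"
  by (rule std.pair_P std.pair_R sw.pair_P sw.pair_R)+

text \<open>The splice maps of the diagram are q p, while the exactness lemmas speak of p q; the two
  differ by a sign.\<close>

lemma sgn_swap: assumes "anticomm_pair p q" shows "p (q x) = 0 \<longleftrightarrow> q (p x) = 0" "p (q x) = q (p (- x))" "q (p 0) = 0" "p 0 = 0"  "q 0 = 0"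
proof -
  interpret anticomm_pair p q by fact
  show "p (q x) = 0 \<longleftrightarrow> q (p x) = 0" "p (q x) = q (p (- x))" "q (p 0) = 0"
    "p 0 = 0"  "q 0 = 0" by (simp_all add: pq p_minus q_minus)
qed

lemma zero_A:
  assumes "m \<ge> 1" "n \<ge> 1" shows "homology_zero (VA, m, n)"
proof -
  obtain m' n' where mn: "m = Suc m'" "n = Suc n'" using assms by (cases m; cases n) auto
  show ?thesis
  proof (rule homology_zeroI[OF _ arrow_nabla(1) _ arrow_nabla(1)])
    show "outarrow (VA, m, n) = Some ((VA, m - 1, n - 1), nabla VA)" using assms by simp
    show "outarrow (VA, Suc m, Suc n) = Some ((VA, m, n), nabla VA)" by simp
    fix F assume F: "F \<in> Fam m n" "nabA F = 0"
    consider "m' = 0" "n' = 0" | k where "n' = Suc k" | k where "m' = Suc k" by (cases m'; cases n') auto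
    then show "\<exists>G\<in>Fam (Suc m) (Suc n). F = nabA G"
    proof cases
      case 1 then show ?thesis using std.A11_exact F mn by simp
    next
      case 2 then show ?thesis using std.A_exact[of F m k] F mn by simp
    next
      case 3 then show ?thesis using std.A_exact'[of F k n] F mn by simp
    qed
  qed
qed

lemma zero_Am0:
  assumes "m \<ge> 2" shows "homology_zero (VA, m, 0)"
proof -
  obtain k where m: "m = Suc (Suc k)" using assms by (metis Suc_le_D numeral_2_eq_2 Suc_le_mono)
  show ?thesis
  proof (rule homology_zeroI[OF _ arrow_nabla2A _ arrow_nabla(1)])
    show "outarrow (VA, m, 0) = Some ((VD, m - 2, 0), nabla2 VA)" using assms by simp
    show "outarrow (VA, Suc m, Suc 0) = Some ((VA, m, 0), nabla VA)" by simp
    fix F assume F: "F \<in> Fam m 0" "nab2 xxA F = 0"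
    have "lower w11 w21 (lower w12 w22 (transp F 0 0)) = 0"
      using nab2_eq_zero[OF F(2)] sgn_swap(1)[OF pairs(3)] by simp
    then show "\<exists>G\<in>Fam (Suc m) (Suc 0). F = nabA G"
      using std.A_exact'[of F k 0] F(1) m by simp
  qed
qed

lemma zero_A0n:
  assumes "n \<ge> 2" shows "homology_zero (VA, 0, n)"
proof -
  obtain k where n: "n = Suc (Suc k)" using assms by (metis Suc_le_D numeral_2_eq_2 Suc_le_mono)
  show ?thesis
  proof (rule homology_zeroI[OF _ arrow_nabla2tA _ arrow_nabla(1)])
    show "outarrow (VA, 0, n) = Some ((VB, 0, n - 2), nabla2t VA)" using assms by simp
    show "outarrow (VA, Suc 0, Suc n) = Some ((VA, 0, n), nabla VA)" by simp
    fix F assume F: "F \<in> Fam 0 n" "nab2t yyA F = 0"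
    have "lower w11 w12 (lower w21 w22 (F 0 0)) = 0"
      using nab2t_eq_zero[OF F(2)] sgn_swap(1)[OF pairs(1)] by simp
    then show "\<exists>G\<in>Fam (Suc 0) (Suc n). F = nabA G"
      using std.A_exact[of F 0 k] F(1) n by simp
  qed
qed

lemma zero_A10: "homology_zero (VA, 1, 0)"
proof (rule homology_zeroI[OF _ arrow_nabla3t _ arrow_nabla(1)])
  show "outarrow (VA, 1, 0) = Some ((VC, 0, 1), nabla3t)" by simp
  show "outarrow (VA, 2, 1) = Some ((VA, 1, 0), nabla VA)" by simp
  fix F assume F: "F \<in> Fam 1 0" "nab3t F = 0"
  have "nab3t F 0 0 1 0 = 0" "nab3t F 0 0 0 1 = 0" using F(2) by simp_all
  then have "\<exists>G\<in>Fam (Suc (Suc 0)) (Suc 0). F = nabA G"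
    using F(1) by (intro std.A10_exact) (auto simp: nab3t_def Let_def single_def)
  then show "\<exists>G\<in>Fam 2 1. F = nabA G" by (simp add: numeral_2_eq_2)
qed

lemma zero_A01: "homology_zero (VA, 0, 1)"
proof (rule homology_zeroI[OF _ arrow_nabla3 _ arrow_nabla(1)])
  show "outarrow (VA, 0, 1) = Some ((VC, 1, 0), nabla3)" by simp
  show "outarrow (VA, 1, 2) = Some ((VA, 0, 1), nabla VA)" by simp
  fix F assume F: "F \<in> Fam 0 1" "nab3 F = 0"
  have "nab3 F 1 0 0 0 = 0" "nab3 F 0 1 0 0 = 0" using F(2) by simp_all
  then have "\<exists>G\<in>Fam (Suc (Suc 0)) (Suc 0). transp F = lower (lower w11 w21) (lower w12 w22) G"
    using transp_Fam[OF F(1)] by (intro sw.A10_exact) (auto simp: nab3_def Let_def single_def transp_def)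
  then obtain G where G: "G \<in> Fam 2 1" "transp F = lower (lower w11 w21) (lower w12 w22) G" by (auto simp: numeral_2_eq_2)
  have "F = nabA (transp G)"
    using std.transp_nabA[of "transp G"] G(2) by simp (metis transp_transp)
  then show "\<exists>G\<in>Fam 1 2. F = nabA G" using transp_Fam[OF G(1)] by blast
qed

text \<open>For m > 0 this is \<open>B_exact\<close>. For m = 0 the incoming arrow is the splice
  from A, and a cycle is one family killed by P1 and P2, so \<open>P_exact3\<close> applies.\<close>

lemma zero_B:
  assumes "n \<ge> 1" shows "homology_zero (VB, m, n)"
proof -
  obtain k where n: "n = Suc k" using assms by (cases n) auto
  have out: "outarrow (VB, m, n) = Some ((VB, m + 1, n - 1), nabla VB)" using assms by simp
  show ?thesis
  proof (cases m)
    case (Suc m')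
    show ?thesis
    proof (rule homology_zeroI[OF out arrow_nabla(2) _ arrow_nabla(2)])
      show "outarrow (VB, m', Suc n) = Some ((VB, m, n), nabla VB)" using Suc by simp
      show "\<exists>G\<in>Fam m' (Suc n). F = nabB G"
        if "F \<in> Fam m n" "nabB F = 0" for F
        using std.B_exact[of F m' k] that Suc n by simp
    qed
  next
    case 0
    show ?thesis
    proof (rule homology_zeroI[OF out arrow_nabla(2) _ arrow_nabla2tA])
      show "outarrow (VA, 0, n + 2) = Some ((VB, m, n), nabla2t VA)" using 0 by simp
      fix F assume F: "F \<in> Fam m n" "nabB F = 0"
      have F0: "F = single 0 0 (F 0 0)" using Fam0_eq F(1) 0 by simp
      have "lower w11 w12 (F 0 0) = 0" "lower w21 w22 (F 0 0) = 0"
        using fun_cong[OF fun_cong[OF F(2), of 1], of 0] fun_cong[OF fun_cong[OF F(2), of 0], of 1]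
        by (simp_all add: raise_def)
      then obtain h where h: "h \<in> homog (Suc (Suc (Suc k))) UNIV" "F 0 0 = lower w11 w12 (lower w21 w22 h)"
        using std.P_exact3[of "F 0 0" k] homog_in[OF F(1), of 0 0] 0 n by auto
      have "F = nab2t yyA (single 0 0 (- h))"
        using F0 h(2) by (simp add: nab2t_single sgn_swap(3)[OF pairs(1)] sgn_swap(2)[OF pairs(1)])
      moreover have "single 0 0 (- h) \<in> Fam 0 (n + 2)" using uminus_homog[OF h(1)] n by (intro single_Fam) simp
      ultimately show "\<exists>G\<in>Fam 0 (n + 2). F = nab2t yyA G" by blast
    qed
  qed
qed

text \<open>For m > 0 the exchange of x and y turns the statement into \<open>D_exact0\<close>. At
  (0,0) both neighbouring arrows are of second order, and the two extreme coefficients of the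
  outgoing one are the hypotheses of \<open>B00_exact\<close>.\<close>

lemma zero_Bm0: "homology_zero (VB, m, 0)"
proof -
  have out: "outarrow (VB, m, 0) = Some ((VC, m + 2, 0), nabla2 VB)" by simp
  show ?thesis
  proof (cases m)
    case (Suc m')
    show ?thesis
    proof (rule homology_zeroI[OF out arrow_nabla2B _ arrow_nabla(2)])
      show "outarrow (VB, m', 1) = Some ((VB, m, 0), nabla VB)" using Suc by simp
      fix F assume F: "F \<in> Fam m 0" "nab2 xxB F = 0"
      have "raise w11 w21 (raise w12 w22 (transp F 0 0)) = 0"
        using nab2_eq_zero[OF F(2)] sgn_swap(1)[OF pairs(4)] by simp
      then obtain G where G: "G \<in> Fam (Suc 0) m'" "transp F = lower (raise w11 w21) (raise w12 w22) G"
        using sw.D_exact0[of "transp F" m'] transp_Fam[OF F(1)] Suc by auto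
      have "F = nabB (transp G)"
        using std.transp_nabB[of "transp G"] G(2) by simp (metis transp_transp)
      then show "\<exists>G\<in>Fam m' 1. F = nabB G" using transp_Fam[OF G(1)] by auto
    qed
  next
    case 0
    show ?thesis
    proof (rule homology_zeroI[OF out arrow_nabla2B _ arrow_nabla2tA])
      show "outarrow (VA, 0, 2) = Some ((VB, m, 0), nabla2t VA)" using 0 by simp
      fix F assume F: "F \<in> Fam m 0" "nab2 xxB F = 0"
      have F0: "F = single 0 0 (F 0 0)" "F 0 0 = single 0 0 (F 0 0 0 0)"
        using Fam0_eq F(1) 0 homog_0_eq[OF homog_in[OF F(1), of 0 0]] by simp_all
      have e: "raise w12 w22 (raise w11 w21 (transp F 0 0)) i j = 0" for i j using nab2_eq_zero[OF F(2)] by simp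
      have "w12 (w11 (F 0 0 0 0)) = 0" "w22 (w21 (F 0 0 0 0)) = 0"
        using e[of 2 0] e[of 0 2] by (simp_all add: raise_def transp_def)
      then obtain h where h: "h \<in> Fam1 (Suc (Suc 0))" "F 0 0 0 0 = lower w21 w22 (lower w11 w12 h) 0 0"
        using std.B00_exact by blast
      have "lower w21 w22 (lower w11 w12 h) \<in> Fam1 0" using h(1) std.P_fam by simp
      then have "F 0 0 = lower w21 w22 (lower w11 w12 h)" using F0(2) h(2) homog_0_eq by metis
      then have "F = nab2t yyA (single 0 0 h)"
        using F0(1) by (simp add: nab2t_single sgn_swap(3)[OF pairs(1)])
      moreover have "single 0 0 h \<in> Fam 0 2" using h(1) by (intro single_Fam) (simp add: numeral_2_eq_2)
      ultimately show "\<exists>G\<in>Fam 0 2. F = nab2t yyA G" by blast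
    qed
  qed
qed

text \<open>Transposition turns a nabla that lowers in x and raises in y into one of type B for the
  exchanged structure.\<close>

lemma zero_D:
  assumes "m \<ge> 1" shows "homology_zero (VD, m, n)"
proof -
  obtain k where m: "m = Suc k" using assms by (cases m) auto
  have out: "outarrow (VD, m, n) = Some ((VD, m - 1, n + 1), nabla VD)" using assms by simp
  have trF: "raise (lower w11 w21) (lower w12 w22) (transp F) = 0" if "nabD F = 0" for F
    using std.transp_nabD[of F] that by (simp add: transp_0)
  show ?thesis
  proof (cases n)
    case (Suc n')
    show ?thesis
    proof (rule homology_zeroI[OF out arrow_nabla(4) _ arrow_nabla(4)])
      show "outarrow (VD, Suc m, n') = Some ((VD, m, n), nabla VD)" using Suc by simp
      fix F assume F: "F \<in> Fam m n" "nabD F = 0"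
      obtain G where G: "G \<in> Fam n' (Suc m)" "transp F = raise (lower w11 w21) (lower w12 w22) G"
        using sw.B_exact[of "transp F" n' k] transp_Fam[OF F(1)] trF[OF F(2)] Suc m by auto
      have "F = nabD (transp G)"
        using std.transp_nabD[of "transp G"] G(2) by simp (metis transp_transp)
      then show "\<exists>G\<in>Fam (Suc m) n'. F = nabD G" using transp_Fam[OF G(1)] by blast
    qed
  next
    case 0
    show ?thesis
    proof (rule homology_zeroI[OF out arrow_nabla(4) _ arrow_nabla2A])
      show "outarrow (VA, m + 2, 0) = Some ((VD, m, n), nabla2 VA)" using 0 by simp
      fix F assume F: "F \<in> Fam m n" "nabD F = 0"
      have tF: "transp F \<in> Fam 0 m" using transp_Fam F(1) 0 by simp
      have F0: "transp F = single 0 0 (transp F 0 0)" using Fam0_eq tF .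
      have "lower w11 w21 (transp F 0 0) = 0" "lower w12 w22 (transp F 0 0) = 0"
        using fun_cong[OF fun_cong[OF trF[OF F(2)], of 1], of 0] fun_cong[OF fun_cong[OF trF[OF F(2)], of 0], of 1]
        by (simp_all add: raise_def)
      then obtain h where h: "h \<in> homog (Suc (Suc (Suc k))) UNIV" "transp F 0 0 = lower w11 w21 (lower w12 w22 h)"
        using sw.P_exact3[of "transp F 0 0" k] homog_in[OF tF, of 0 0] m by auto
      have "transp F = nab2t xxA (single 0 0 (- h))"
        using F0 h(2) by (simp add: nab2t_single sgn_swap(3)[OF pairs(3)] sgn_swap(2)[OF pairs(3)])
      then have "F = nab2 xxA (transp (single 0 0 (- h)))" by (metis nab2_transp transp_transp)
      moreover have "single 0 0 (- h) \<in> Fam 0 (m + 2)" using uminus_homog[OF h(1)] m by (intro single_Fam) simp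
      ultimately show "\<exists>G\<in>Fam (m + 2) 0. F = nab2 xxA G" using transp_Fam by blast
    qed
  qed
qed

lemma zero_D0n: "homology_zero (VD, 0, n)"
proof -
  have out: "outarrow (VD, 0, n) = Some ((VC, 0, n + 2), nabla2t VD)" by simp
  show ?thesis
  proof (cases n)
    case (Suc n')
    show ?thesis
    proof (rule homology_zeroI[OF out arrow_nabla2tD _ arrow_nabla(4)])
      show "outarrow (VD, 1, n') = Some ((VD, 0, n), nabla VD)" using Suc by simp
      fix F assume F: "F \<in> Fam 0 n" "nab2t yyD F = 0"
      have "raise w11 w12 (raise w21 w22 (F 0 0)) = 0"
        using nab2t_eq_zero[OF F(2)] sgn_swap(1)[OF pairs(2)] by simp
      then show "\<exists>G\<in>Fam 1 n'. F = nabD G"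
        using std.D_exact0[of F n'] F(1) Suc by auto
    qed
  next
    case 0
    show ?thesis
    proof (rule homology_zeroI[OF out arrow_nabla2tD _ arrow_nabla2A])
      show "outarrow (VA, 2, 0) = Some ((VD, 0, n), nabla2 VA)" using 0 by simp
      fix F assume F: "F \<in> Fam 0 n" "nab2t yyD F = 0"
      have tF: "transp F \<in> Fam 0 0" using transp_Fam F(1) 0 by simp
      have F0: "transp F = single 0 0 (transp F 0 0)" "transp F 0 0 = single 0 0 (transp F 0 0 0 0)"
        using Fam0_eq[OF tF] homog_0_eq[OF homog_in[OF tF, of 0 0]] by simp_all
      have e: "raise w21 w22 (raise w11 w12 (F 0 0)) i j = 0" for i j using nab2t_eq_zero[OF F(2)] by simp
      have "w21 (w11 (transp F 0 0 0 0)) = 0" "w22 (w12 (transp F 0 0 0 0)) = 0"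
        using e[of 2 0] e[of 0 2] by (simp_all add: raise_def transp_def)
      then obtain h where h: "h \<in> Fam1 (Suc (Suc 0))" "transp F 0 0 0 0 = lower w12 w22 (lower w11 w21 h) 0 0"
        using sw.B00_exact by blast
      have "lower w12 w22 (lower w11 w21 h) \<in> Fam1 0" using h(1) sw.P_fam by simp
      then have "transp F 0 0 = lower w12 w22 (lower w11 w21 h)" using F0(2) h(2) homog_0_eq by metis
      then have "transp F = nab2t xxA (single 0 0 h)"
        using F0(1) by (simp add: nab2t_single sgn_swap(3)[OF pairs(3)])
      then have "F = nab2 xxA (transp (single 0 0 h))" by (metis nab2_transp transp_transp)
      moreover have "single 0 0 h \<in> Fam 0 2" using h(1) by (intro single_Fam) (simp add: numeral_2_eq_2)
      ultimately show "\<exists>G\<in>Fam 2 0. F = nab2 xxA G" using transp_Fam by blast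
    qed
  qed
qed

lemma zero_C:
  assumes "m \<ge> 1" "n \<ge> 1" "(m, n) \<noteq> (1, 1)" shows "homology_zero (VC, m, n)"
proof -
  obtain m' n' where mn: "m = Suc m'" "n = Suc n'" using assms by (cases m; cases n) auto
  show ?thesis
  proof (rule homology_zeroI[OF _ arrow_nabla(3) _ arrow_nabla(3)])
    show "outarrow (VC, m, n) = Some ((VC, m + 1, n + 1), nabla VC)" by simp
    show "outarrow (VC, m', n') = Some ((VC, m, n), nabla VC)" using mn by simp
    fix F assume F: "F \<in> Fam m n" "nabC F = 0"
    consider k where "n' = Suc k" | k where "m' = Suc k" using assms(3) mn by (cases m'; cases n') auto
    then show "\<exists>G\<in>Fam m' n'. F = nabC G"
    proof cases
      case 1 then show ?thesis using std.C_exact[of F m' k] F mn by simp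
    next
      case 2 then show ?thesis using std.C_exact'[of F k n'] F mn by simp
    qed
  qed
qed

lemma zero_Cm0:
  assumes "m \<ge> 2" shows "homology_zero (VC, m, 0)"
proof -
  obtain k where m: "m = Suc (Suc k)" using assms by (metis Suc_le_D numeral_2_eq_2 Suc_le_mono)
  show ?thesis
  proof (rule homology_zeroI[OF _ arrow_nabla(3) _ arrow_nabla2B])
    show "outarrow (VC, m, 0) = Some ((VC, m + 1, 0 + 1), nabla VC)" by simp
    show "outarrow (VB, k, 0) = Some ((VC, m, 0), nabla2 VB)" using m by simp
    fix F assume F: "F \<in> Fam m 0" "nabC F = 0"
    obtain h where h: "h \<in> Fam1 k" "transp F 0 0 = raise w12 w22 (raise w11 w21 h)"
      using std.C20_exact[of F k] F m by auto
    have "transp F = nab2t xxB (single 0 0 h)"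
      using Fam0_eq[OF transp_Fam[OF F(1)]] h(2) by (simp add: nab2t_single sgn_swap(3)[OF pairs(4)])
    then have "F = nab2 xxB (transp (single 0 0 h))" by (metis nab2_transp transp_transp)
    then show "\<exists>G\<in>Fam k 0. F = nab2 xxB G" using transp_Fam[OF single_Fam[OF h(1)]] by blast
  qed
qed

lemma zero_C0n:
  assumes "n \<ge> 2" shows "homology_zero (VC, 0, n)"
proof -
  obtain k where n: "n = Suc (Suc k)" using assms by (metis Suc_le_D numeral_2_eq_2 Suc_le_mono)
  show ?thesis
  proof (rule homology_zeroI[OF _ arrow_nabla(3) _ arrow_nabla2tD])
    show "outarrow (VC, 0, n) = Some ((VC, 0 + 1, n + 1), nabla VC)" by simp
    show "outarrow (VD, 0, k) = Some ((VC, 0, n), nabla2t VD)" using n by simp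
    fix F assume F: "F \<in> Fam 0 n" "nabC F = 0"
    have "raise w11 w12 (F 0 0) = 0" "raise w21 w22 (F 0 0) = 0"
      using fun_cong[OF fun_cong[OF F(2), of 1], of 0] fun_cong[OF fun_cong[OF F(2), of 0], of 1]
      by (simp_all add: raise_def[of "raise w11 w12"])
    then obtain h where h: "h \<in> Fam1 k" "F 0 0 = raise w11 w12 (raise w21 w22 h)"
      using std.R_exact3[of "F 0 0" k] homog_in[OF F(1), of 0 0] n by auto
    have "F = nab2t yyD (single 0 0 (- h))"
      using Fam0_eq[OF F(1)] h(2) by (simp add: nab2t_single sgn_swap(3)[OF pairs(2)] sgn_swap(2)[OF pairs(2)])
    then show "\<exists>G\<in>Fam 0 k. F = nab2t yyD G" using single_Fam[OF uminus_homog[OF h(1)]] by blast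
  qed
qed

lemma zero_C10: "homology_zero (VC, 1, 0)"
proof (rule homology_zeroI[OF _ arrow_nabla(3) _ arrow_nabla3])
  show "outarrow (VC, 1, 0) = Some ((VC, 1 + 1, 0 + 1), nabla VC)" by simp
  show "outarrow (VA, 0, 1) = Some ((VC, 1, 0), nabla3)" by simp
  fix F assume F: "F \<in> Fam 1 0" "nabC F = 0"
  obtain a b where ab: "F 1 0 0 0 = w12 (w21 (w11 a) + (w21 (w12 b) + w22 (w11 b)))"
    "F 0 1 0 0 = w22 (w21 (w11 a) + (w21 (w12 b) + w22 (w11 b)))"
    using std.C10_exact[of F] F by auto
  define G where "G = single 0 0 (single 1 0 a + single 0 1 b)"
  have f1: "F = single 1 0 (F 1 0) + single 0 1 (F 0 1)" using F(1) by (intro homog_1_eq) simp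
  have f2: "F 1 0 = single 0 0 (F 1 0 0 0)" "F 0 1 = single 0 0 (F 0 1 0 0)"
    using homog_in[OF F(1), of 1 0] homog_in[OF F(1), of 0 1] by (auto intro: homog_0_eq)
  have G: "G 0 0 1 0 = a" "G 0 0 0 1 = b" by (simp_all add: G_def single_def)
  have "nab3 G = single 1 0 (single 0 0 (F 1 0 0 0)) + single 0 1 (single 0 0 (F 0 1 0 0))"
    unfolding nab3_def Let_def G ab ..
  then have "F = nab3 G" unfolding f2[symmetric] using f1 by simp
  moreover have "G \<in> Fam 0 1" unfolding G_def
    by (intro single_Fam subgrp_add[OF subgrp_homog] single_homog) auto
  ultimately show "\<exists>G\<in>Fam 0 1. F = nab3 G" by blast
qed

lemma zero_C01: "homology_zero (VC, 0, 1)"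
proof (rule homology_zeroI[OF _ arrow_nabla(3) _ arrow_nabla3t])
  show "outarrow (VC, 0, 1) = Some ((VC, 0 + 1, 1 + 1), nabla VC)" by simp
  show "outarrow (VA, 1, 0) = Some ((VC, 0, 1), nabla3t)" by simp
  fix F assume F: "F \<in> Fam 0 1" "nabC F = 0"
  have "raise (raise w11 w21) (raise w12 w22) (transp F) = 0" using std.transp_nabC[of F] F(2) by (simp add: transp_0)
  then obtain a b where "transp F 1 0 0 0 = w21 (w12 (w11 a) + (w12 (w21 b) + w22 (w11 b)))"
    "transp F 0 1 0 0 = w22 (w12 (w11 a) + (w12 (w21 b) + w22 (w11 b)))"
    using sw.C10_exact[of "transp F"] transp_Fam[OF F(1)] by auto
  then have ab: "F 0 0 1 0 = w21 (w12 (w11 a) + (w12 (w21 b) + w22 (w11 b)))"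
    "F 0 0 0 1 = w22 (w12 (w11 a) + (w12 (w21 b) + w22 (w11 b)))" by (simp_all add: transp_def)
  define G where "G = single 1 0 (single 0 0 a) + single 0 1 (single 0 0 b)"
  have F0: "F = single 0 0 (F 0 0)" using Fam0_eq[OF F(1)] .
  have f1: "F 0 0 = single 1 0 (F 0 0 1 0) + single 0 1 (F 0 0 0 1)" using homog_in[OF F(1), of 0 0] by (intro homog_1_eq) simp
  have G: "G 1 0 0 0 = a" "G 0 1 0 0 = b" by (simp_all add: G_def single_def)
  have "nab3t G = single 0 0 (single 1 0 (F 0 0 1 0) + single 0 1 (F 0 0 0 1))"
    unfolding nab3t_def Let_def G ab ..
  then have "F = nab3t G" unfolding f1[symmetric] using F0 by simp
  moreover have "G \<in> Fam 1 0" unfolding G_def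
    by (intro subgrp_add[OF subgrp_homog] single_homog subgrp_zero[OF subgrp_homog] subgrp_homog) auto
  ultimately show "\<exists>G\<in>Fam 1 0. F = nab3t G" by blast
qed

text \<open>There is no incoming arrow, so the claim is injectivity; two of the four components of
  nabla already give it by \<open>all_w_zero\<close>.\<close>

lemma zero_C00: "homology_zero (VC, 0, 0)"
  unfolding homology_zero_def
proof
  fix f assume "f \<in> Ker (VC, 0, 0)"
  then have f: "f \<in> Mspace (VC, 0, 0)" "genmap (nabla VC) f = (\<lambda>z. 0)" by (auto simp: Ker_def)
  define F where "F = coeffs VC f"
  have F: "F \<in> Fam 0 0" using coeffs_Fam[OF f(1)] by (simp add: F_def)
  have z: "nabC F i j k l = 0" for i j k l
    using Ker_coeffs[OF arrow_nabla(3) f] by (simp add: F_def)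
  have "w11 (F 0 0 0 0) = 0" "w22 (F 0 0 0 0) = 0"
    using z[of 1 0 1 0] z[of 0 1 0 1] by (simp_all add: raise_def)
  then have "F 0 0 0 0 = 0" by (rule std.all_w_zero)
  moreover have "F 0 0 = single 0 0 (F 0 0 0 0)" "F = single 0 0 (F 0 0)"
    using Fam0_eq[OF F] homog_0_eq[OF homog_in[OF F, of 0 0]] by simp_all
  ultimately have F0: "F a b c d = 0" for a b c d by (metis (no_types, lifting) single_def zero_fun_apply)
  have "f = (\<lambda>z. 0)"
  proof
    fix z :: "nat \<times> nat set \<times> mono" obtain k J a1 a2 b1 b2 where zz: "z = (k, J, a1, a2, b1, b2)" by (cases z)
    show "f z = 0" using Rep_coeffs[OF f(1), of a1 a2 b1 b2 k J] F0 by (simp add: zz F_def rep_simps)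
  qed
  then show "f \<in> Img (VC, 0, 0)" by (simp add: Img_def)
qed

lemma homology_zero_all:
  assumes "v \<noteq> (VA, 0, 0)" "v \<noteq> (VC, 1, 1)" shows "homology_zero v"
proof -
  obtain X m n where v: "v = (X, m, n)" by (cases v)
  have c: "k = 0 \<or> k = 1 \<or> k \<ge> 2" for k :: nat by linarith
  show ?thesis
  proof (cases X)
    case VA
    then show ?thesis using assms v c[of m] c[of n] zero_A zero_Am0 zero_A0n zero_A10 zero_A01 by auto
  next
    case VB
    then show ?thesis using v c[of n] zero_B zero_Bm0 by (cases n) auto
  next
    case VC
    then show ?thesis using assms v c[of m] c[of n] zero_C zero_Cm0 zero_C0n zero_C10 zero_C01 zero_C00 by auto
  next
    case VD
    then show ?thesis using v zero_D zero_D0n by (cases m) auto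
  qed
qed

subsection \<open>The two vertices with nonzero homology\<close>

text \<open>Linear combinations are kept as lists, so that the action can be evaluated by rewriting.\<close>
definition vec :: "(complex \<times> 'a) list \<Rightarrow> 'a \<Rightarrow> complex" where
  "vec L = (\<lambda>z. \<Sum>(c, k)\<leftarrow>L. c * dlt k z)"

type_synonym mlist = "(complex \<times> nat \<times> nat set \<times> mono) list"

definition smul :: "complex \<Rightarrow> (complex \<times> 'a) list \<Rightarrow> (complex \<times> 'a) list" where
  "smul c L = map (\<lambda>(d, k). (c * d, k)) L"

definition lbind :: "(complex \<times> 'a) list \<Rightarrow> ('a \<Rightarrow> (complex \<times> 'b) list) \<Rightarrow> (complex \<times> 'b) list" where
  "lbind L g = concat (map (\<lambda>(c, k). smul c (g k)) L)"

lemma vec_simps [simp]: "vec [] = (\<lambda>z. 0)" "vec ((c, k) # L) = (\<lambda>z. c * dlt k z + vec L z)"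
  by (simp_all add: vec_def)

lemma vec_append: "vec (L @ M) = (\<lambda>z. vec L z + vec M z)"
  by (simp add: vec_def)

lemma vec_smul: "vec (smul c L) = (\<lambda>z. c * vec L z)"
  by (induction L) (auto simp: smul_def algebra_simps fun_eq_iff)

lemma smul_simps: "smul c [] = []" "smul c ((d, k) # L) = (c * d, k) # smul c L"
  by (simp_all add: smul_def)

lemma lbind_simps: "lbind [] g = []" "lbind ((c, k) # L) g = smul c (g k) @ lbind L g"
  by (simp_all add: lbind_def)

lemma vec_nz: "vec L b \<noteq> 0 \<Longrightarrow> b \<in> snd ` set L"
  by (induction L) (auto simp: dlt_def split: if_splits)

lemma finite_vec: "finite {b. vec L b \<noteq> 0}"
  by (rule finite_subset[of _ "snd ` set L"]) (auto dest: vec_nz)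

lemma lin_vec: "lin \<phi> (vec L) z = (\<Sum>(c, k)\<leftarrow>L. c * \<phi> k z)"
proof -
  have "(\<Sum>b\<in>A. vec L b * \<phi> b z) = (\<Sum>(c, k)\<leftarrow>L. c * \<phi> k z)"
    if "finite A" "snd ` set L \<subseteq> A" for A
    using that(2)
  proof (induction L)
    case (Cons a L)
    obtain c k where a: "a = (c, k)" by (cases a)
    have "(\<Sum>b\<in>A. c * dlt k b * \<phi> b z) = (\<Sum>b\<in>A. if b = k then c * \<phi> k z else 0)"
      by (intro sum.cong) (auto simp: dlt_def)
    also have "\<dots> = c * \<phi> k z" using that(1) Cons.prems a by simp
    finally show ?case using Cons a by (simp add: distrib_right sum.distrib)
  qed simp
  from this[of "snd ` set L"] show ?thesis
    by (subst lin_sum[of "snd ` set L"]) (auto dest: vec_nz)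
qed

lemma lin_vec_lbind: "(\<And>k. k \<in> snd ` set L \<Longrightarrow> \<phi> k = vec (g k)) \<Longrightarrow> lin \<phi> (vec L) = vec (lbind L g)"
proof (rule ext)
  fix z assume "\<And>k. k \<in> snd ` set L \<Longrightarrow> \<phi> k = vec (g k)"
  then show "lin \<phi> (vec L) z = vec (lbind L g) z"
    unfolding lin_vec by (induction L) (auto simp: lbind_simps vec_append vec_smul)
qed

text \<open>Only brackets with an xi_j occur when the action on a vector with k = 0 is unfolded. The
  coefficient - a is (2 - |I|) b - a (2 - |J|) at b = 0 and |J| = 1.\<close>

fun gbrL :: "gb \<Rightarrow> nat \<Rightarrow> (complex \<times> gb) list" where
  "gbrL (GK a I) j =
     (if j \<in> I then [((-1) ^ card I * (-1) ^ nless I j, GK a (I - {j}))]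
      else if a = 0 then [] else [(- of_nat a * (-1) ^ ngt I j, GK (a - 1) (insert j I))])
     @ (if a = 0 \<and> I = {1..4} - {j} then [(- ((-1) ^ nless {1..4} j), GC)] else [])"
| "gbrL GC j = []"

lemma gsign_single: "gsign I {j} = (-1) ^ ngt I j"
proof -
  have "{(i, j'). i \<in> I \<and> j' \<in> {j} \<and> j' < i} = (\<lambda>i. (i, j)) ` {i \<in> I. j < i}" by auto
  then show ?thesis by (simp add: gsign_def ngt_def card_image inj_on_def)
qed

lemma gsign_empty: "gsign I {} = 1"
  by (simp add: gsign_def)

lemma gbr_vec:
  assumes "j \<in> {1..4}" shows "gbr x (GK 0 {j}) = vec (gbrL x j)"
proof (cases x)
  case (GK a I)
  have n: "nless {j} j = 0" by (simp add: nless_def)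
  have p: "psi (GK a I) (GK 0 {j}) = (if a = 0 \<and> I = {1..4} - {j} then - ((-1) ^ nless {1..4} j) else 0)"
  proof -
    \<comment> \<open>This branch of the cocycle would need a singleton whose complement in {1..4}
      is again a singleton.\<close>
    have n1: "(card I = 1 \<and> I \<subseteq> {1..4} \<and> {j} = {1..4} - I) = False"
    proof
      assume h: "card I = 1 \<and> I \<subseteq> {1..4} \<and> {j} = {1..4} - I"
      then have "finite I" using fin14 by blast
      then have "card ({1..4} - I) = 3" using h card_Diff_subset[of I "{1..4}"] by simp
      moreover have "card ({1..4} - I) = 1" using h by (metis card_1_singleton_iff One_nat_def)
      ultimately show False by simp
    qed simp
    have n2: "{j} \<noteq> {1, 2, 3, 4}"
    proof
      assume "{j} = {1, 2, 3, 4}"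
      then have "1 \<in> {j}" "2 \<in> {j}" by simp_all
      then show False by simp
    qed
    have n3: "{j} \<subseteq> {1..4}" using assms by simp
    have n4: "{j} \<noteq> {}" "card {j} = 1" "Min {j} = j" by simp_all
    show ?thesis unfolding psi.simps
      by (cases "a = 0") (simp_all only: n1 n2 n3 n4 simp_thms if_True if_False)
  qed
  show ?thesis
  proof (rule ext)
    fix z
    have i: "I \<inter> {j} = (if j \<in> I then {j} else {})" by auto
    have c: "(if z = GC then psi (GK a I) (GK 0 {j}) else 0)
        = vec (if a = 0 \<and> I = {1..4} - {j} then [(- ((-1) ^ nless {1..4} j), GC)] else []) z"
      unfolding p by (cases "a = 0 \<and> I = {1..4} - {j}") (auto simp: dlt_def)
    show "gbr x (GK 0 {j}) z = vec (gbrL x j) z"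
      unfolding GK gbr.simps gbrL.simps vec_append c
      by (cases "j \<in> I"; cases "a = 0") (simp_all add: i n gsign_single gsign_empty dlt_def)
  qed
qed simp

fun lm :: "gb \<Rightarrow> mlist \<Rightarrow> mlist" where
  "lm (GK a I) L = map (\<lambda>(c, k, J, \<alpha>). if I = {} then (c, k + 1, J, \<alpha>)
      else if Min I \<in> J then ((-1) ^ nless J (Min I) * (- 1 / 2) * c, k + 1, J - {Min I}, \<alpha>)
      else ((-1) ^ nless J (Min I) * c, k, insert (Min I) J, \<alpha>)) L"
| "lm GC L = []"

lemma ten_lmul: "ten (lmul_eta_mono i (k, J)) (dlt \<alpha>) z =
    (if i \<in> J then (-1) ^ nless J i * (- 1 / 2) * dlt (k + 1, J - {i}, \<alpha>) z
     else (-1) ^ nless J i * dlt (k, insert i J, \<alpha>) z)"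
  by (cases z) (auto simp: lmul_eta_mono_def ten_def dlt_def)

lemma lmulM_vec:
  assumes "y = GK 0 I" shows "lmulM y (vec L) = vec (lm y L)"
proof (cases "I = {}")
  case True
  have "lin (\<lambda>(k, J, \<alpha>). dlt (k + 1, J, \<alpha>)) (vec L) z = vec (lm y L) z" for z
    unfolding lin_vec using True assms by (induction L) (auto simp: vec_def)
  then show ?thesis using True assms by (auto simp: lmulM_def)
next
  case False
  have "lin (\<lambda>(k, J, \<alpha>). ten (lmul_eta_mono (Min I) (k, J)) (dlt \<alpha>)) (vec L) z = vec (lm y L) z" for z
    unfolding lin_vec using False assms
    by (induction L) (auto simp: vec_def ten_lmul mult_ac split: if_splits)
  then show ?thesis using False assms by (auto simp: lmulM_def)
qed

text \<open>The action for the label \<open>VC\<close> only. Where a subtraction in an exponent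
  would be truncated, the coefficient is zero.\<close>

fun g0L :: "gb \<Rightarrow> mono \<Rightarrow> (complex \<times> mono) list" where
  "g0L x (a1, a2, b1, b2) =
   (let ex = (- of_nat a1, (a1 - 1, a2 + 1, b1, b2)); fx = (- of_nat a2, (a1 + 1, a2 - 1, b1, b2));
        hx = (of_nat a2 - of_nat a1, (a1, a2, b1, b2));
        ey = (- of_nat b1, (a1, a2, b1 - 1, b2 + 1)); fy = (- of_nat b2, (a1, a2, b1 + 1, b2 - 1));
        hy = (of_nat b2 - of_nat b1, (a1, a2, b1, b2))
    in if x = GC then [((of_nat (b1 + b2) - of_nat (a1 + a2)) / 2, (a1, a2, b1, b2))]
     else if x = GK 1 {} then [((of_nat (a1 + a2) + of_nat (b1 + b2)) / 2 + 2, (a1, a2, b1, b2))]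
     else if x = GK 0 {1,2} then smul (\<i> / 2) [hx, hy]
     else if x = GK 0 {3,4} then smul (- \<i> / 2) [hx] @ smul (\<i> / 2) [hy]
     else if x = GK 0 {1,3} then smul (- 1 / 2) [ex, ey] @ smul (1 / 2) [fx, fy]
     else if x = GK 0 {2,4} then smul (1 / 2) [ey, fx] @ smul (- 1 / 2) [fy, ex]
     else if x = GK 0 {2,3} then smul (- \<i> / 2) [ex, fx, ey, fy]
     else if x = GK 0 {1,4} then smul (\<i> / 2) [ex, fx] @ smul (- \<i> / 2) [ey, fy]
     else [])"

lemma op_vec:
  "opx VC Ee (a1, a2, b1, b2) z = - of_nat a1 * dlt (a1 - 1, a2 + 1, b1, b2) z"
  "opx VC Ff (a1, a2, b1, b2) z = - of_nat a2 * dlt (a1 + 1, a2 - 1, b1, b2) z"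
  "opx VC Hh (a1, a2, b1, b2) z = (of_nat a2 - of_nat a1) * dlt (a1, a2, b1, b2) z"
  "opy VC Ee (a1, a2, b1, b2) z = - of_nat b1 * dlt (a1, a2, b1 - 1, b2 + 1) z"
  "opy VC Ff (a1, a2, b1, b2) z = - of_nat b2 * dlt (a1, a2, b1 + 1, b2 - 1) z"
  "opy VC Hh (a1, a2, b1, b2) z = (of_nat b2 - of_nat b1) * dlt (a1, a2, b1, b2) z"
  by (cases z; simp add: opx_def opy_def xpoly_def ypoly_def dlt_def)+

lemma g0act_vec: "g0act VC x \<alpha> = vec (g0L x \<alpha>)"
proof -
  obtain a1 a2 b1 b2 where \<alpha>: "\<alpha> = (a1, a2, b1, b2)" by (cases \<alpha>)
  show ?thesis unfolding \<alpha> g0act_def g0L.simps Let_def if_distrib[of vec]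
    by (intro if_cong refl ext)
       (simp_all add: op_vec vec_append smul_simps Exv_def Eyv_def xpoly_def ypoly_def field_simps)
qed

text \<open>The recursion keeps k fixed, so starting at k = 0 never reaches the branch that brackets
  with Theta.\<close>

primrec actL :: "nat \<Rightarrow> gb \<Rightarrow> nat set \<Rightarrow> mono \<Rightarrow> mlist" where
  "actL 0 x J \<alpha> = (if gdeg x < 0 then lm x [(1, 0, J, \<alpha>)]
     else if gdeg x = 0 then map (\<lambda>(c, \<beta>). (c, 0, {}, \<beta>)) (g0L x \<alpha>) else [])"
| "actL (Suc n) x J \<alpha> = (if gdeg x < 0 then lm x [(1, 0, J, \<alpha>)]
     else lbind (gbrL x (Min J)) (\<lambda>b. actL n b (J - {Min J}) \<alpha>)
       @ smul ((-1) ^ gpar x) (lm (GK 0 {Min J}) (actL n x (J - {Min J}) \<alpha>)))"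

lemma gdeg_neg: "gdeg x < 0 \<Longrightarrow> \<exists>I. x = GK 0 I"
  by (cases x) auto

lemma lmulM_dlt:
  assumes "gdeg x < 0" shows "lmulM x (dlt (0, J, \<alpha>)) = vec (lm x [(1, 0, J, \<alpha>)])"
proof -
  obtain I where "x = GK 0 I" using gdeg_neg[OF assms] by blast
  from lmulM_vec[OF this, of "[(1, 0, J, \<alpha>)]"] show ?thesis by simp
qed

lemma actn_vec:
  assumes "J \<subseteq> {1..4}" "card J = n"
  shows "actn n VC x 0 J \<alpha> = vec (actL n x J \<alpha>)"
  using assms
proof (induction n arbitrary: x J)
  case 0
  have d: "dlt (0, {}, b) (k, J', \<beta>) = dlt (0, {}) (k, J') * dlt b \<beta>" for b \<beta> :: mono and k :: nat and J' :: "nat set"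
    by (auto simp: dlt_def)
  have e: "ten (dlt (0, {})) (vec L) (k, J', \<beta>) = vec (map (\<lambda>(c, \<beta>). (c, 0, {}, \<beta>)) L) (k, J', \<beta>)"
    for L :: "(complex \<times> mono) list" and k J' \<beta>
    by (induction L) (auto simp: ten_def d algebra_simps)
  have "ten (dlt (0, {})) (vec L) = vec (map (\<lambda>(c, \<beta>). (c, 0, {}, \<beta>)) L)" for L :: "(complex \<times> mono) list"
  proof
    fix z show "ten (dlt (0, {})) (vec L) z = vec (map (\<lambda>(c, \<beta>). (c, 0, {}, \<beta>)) L) z"
      using e[of L "fst z" "fst (snd z)" "snd (snd z)"] by simp
  qed
  then show ?case by (simp add: g0act_vec lmulM_dlt del: lm.simps)
next
  case (Suc n)
  have fJ: "finite J" using fin14[OF Suc.prems(1)] .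
  have "J \<noteq> {}" using Suc.prems(2) by force
  with fJ have m: "Min J \<in> J" by simp
  then have m4: "Min J \<in> {1..4}" using Suc.prems by blast
  have J': "J - {Min J} \<subseteq> {1..4}" "card (J - {Min J}) = n"
    using Suc.prems(1) card_Diff_singleton[OF m] Suc.prems(2) by (blast, simp)
  have "lin (\<lambda>b. actn n VC b 0 (J - {Min J}) \<alpha>) (gbr x (GK 0 {Min J}))
      = vec (lbind (gbrL x (Min J)) (\<lambda>b. actL n b (J - {Min J}) \<alpha>))"
    unfolding gbr_vec[OF m4] by (rule lin_vec_lbind) (rule Suc.IH[OF J'])
  moreover have "lmulM (GK 0 {Min J}) (actn n VC x 0 (J - {Min J}) \<alpha>)
      = vec (lm (GK 0 {Min J}) (actL n x (J - {Min J}) \<alpha>))"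
    using Suc.IH[OF J'] lmulM_vec by simp
  ultimately show ?case by (simp add: vec_append vec_smul lmulM_dlt del: lm.simps)
qed

text \<open>A bracket with an eta lowers the degree by exactly one, so after at most n of them an
  element of positive degree meets V_X and acts by zero.\<close>

lemma actL_high:
  assumes "gdeg x > int n" "is_gbasis x" "J \<subseteq> {1..4}" "card J = n"
  shows "\<forall>(c, z)\<in>set (actL n x J \<alpha>). c = 0"
  using assms
proof (induction n arbitrary: x J)
  case (Suc n)
  have s: "\<forall>(c, z)\<in>set L. c = 0 \<Longrightarrow> \<forall>(c, z)\<in>set (smul d L). c = 0" for d and L :: "mlist"
    by (auto simp: smul_def)
  have l: "\<forall>(c, z)\<in>set L. c = 0 \<Longrightarrow> \<forall>(c, z)\<in>set (lm y L). c = 0" for y and L :: "mlist"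
    by (cases y) (auto split: if_splits)
  have fJ: "finite J" using fin14[OF Suc.prems(3)] .
  have "J \<noteq> {}" using Suc.prems(4) by force
  with fJ have m: "Min J \<in> J" by simp
  then have m4: "Min J \<in> {1..4}" using Suc.prems(3) by blast
  have J': "J - {Min J} \<subseteq> {1..4}" "card (J - {Min J}) = n"
    using Suc.prems(3) card_Diff_singleton[OF m] Suc.prems(4) by (blast, simp)
  have d: "gdeg b > int n \<and> is_gbasis b" if "(c, b) \<in> set (gbrL x (Min J))" for c b
  proof (cases x)
    case (GK a I)
    then have I: "I \<subseteq> {1..4}" using Suc.prems(2) by (simp add: is_gbasis_def)
    then have fI: "finite I" by (rule fin14)
    have "card ({1..4} - {Min J}) = 3" using m4 by simp
    \<comment> \<open>The central term requires a = 0 and |I| = 3, hence degree 1, which the degree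
      bound excludes.\<close>
    then have GC: "\<not> (a = 0 \<and> I = {1..4} - {Min J})" using Suc.prems(1) GK by auto
    have i: "insert (Min J) I \<subseteq> {1..4}" "I - {Min J} \<subseteq> {1..4}" using I m4 by auto
    show ?thesis
    proof (cases "Min J \<in> I")
      case True
      then have "card I > 0" using fI card_gt_0_iff by blast
      then show ?thesis using that Suc.prems(1) GC True fI i unfolding GK
        by (auto simp: is_gbasis_def card_Diff_singleton of_nat_diff)
    next
      case False
      then show ?thesis using that Suc.prems(1) GC fI i unfolding GK
        by (auto simp: is_gbasis_def of_nat_diff split: if_splits)
    qed
  qed (use that in simp)
  have "\<forall>(c, z)\<in>set (lbind (gbrL x (Min J)) (\<lambda>b. actL n b (J - {Min J}) \<alpha>)). c = 0"
    unfolding lbind_def using d Suc.IH[OF _ _ J'] by (fastforce simp: smul_def)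
  moreover have "\<forall>(c, z)\<in>set (actL n x (J - {Min J}) \<alpha>). c = 0"
    by (rule Suc.IH[OF _ _ J']) (use Suc.prems in simp_all)
  note s[OF l[OF this], of "(-1) ^ gpar x" "GK 0 {Min J}"]
  moreover have "\<not> gdeg x < 0" using Suc.prems(1) by simp
  ultimately show ?case unfolding actL.simps(2) by (simp only: if_False set_append ball_Un simp_thms)
qed auto

abbreviation (input) "tt \<equiv> True"
abbreviation (input) "ff \<equiv> False"

text \<open>Subsets of \<open>{1..4}\<close> by characteristic function: a normal form for rewriting.\<close>
definition Bs :: "bool \<Rightarrow> bool \<Rightarrow> bool \<Rightarrow> bool \<Rightarrow> nat set" where
  "Bs a b c d = {i. i = 1 \<and> a \<or> i = 2 \<and> b \<or> i = 3 \<and> c \<or> i = 4 \<and> d}"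

lemma Bs_mem [simp]: "Suc 0 \<in> Bs a b c d = a" "2 \<in> Bs a b c d = b" "3 \<in> Bs a b c d = c" "4 \<in> Bs a b c d = d"
  by (simp_all add: Bs_def)

lemma Bs_insert [simp]: "insert (Suc 0) (Bs a b c d) = Bs tt b c d" "insert 2 (Bs a b c d) = Bs a tt c d"
  "insert 3 (Bs a b c d) = Bs a b tt d" "insert 4 (Bs a b c d) = Bs a b c tt"
  by (auto simp: Bs_def)

lemma Bs_remove [simp]: "Bs a b c d - {Suc 0} = Bs ff b c d" "Bs a b c d - {2} = Bs a ff c d"
  "Bs a b c d - {3} = Bs a b ff d" "Bs a b c d - {4} = Bs a b c ff"
  by (auto simp: Bs_def)

lemma Bs_eq [simp]: "Bs a b c d = Bs a' b' c' d' \<longleftrightarrow> a = a' \<and> b = b' \<and> c = c' \<and> d = d'"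
proof
  assume e: "Bs a b c d = Bs a' b' c' d'"
  then have "(i \<in> Bs a b c d) = (i \<in> Bs a' b' c' d')" for i by simp
  from this[of 1] this[of 2] this[of 3] this[of 4]
  show "a = a' \<and> b = b' \<and> c = c' \<and> d = d'" by simp
qed simp

lemma Bs_finite [simp]: "finite (Bs a b c d)"
  by (rule finite_subset[of _ "{1..4}"]) (auto simp: Bs_def)

lemma Bs_list: "Bs a b c d = (if a then {1} else {}) \<union> (if b then {2} else {}) \<union> (if c then {3} else {}) \<union> (if d then {4} else {})"
  by (auto simp: Bs_def)

lemma Bs_card [simp]: "card (Bs a b c d) = of_bool a + of_bool b + of_bool c + of_bool d"
  unfolding Bs_list by (cases a; cases b; cases c; cases d) simp_all

lemma Bs_Min [simp]: "Min (Bs tt b c d) = Suc 0" "Min (Bs ff tt c d) = 2"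
  "Min (Bs ff ff tt d) = 3" "Min (Bs ff ff ff tt) = 4"
  unfolding Bs_list by (cases b; cases c; cases d; simp)+

lemma Bs_nless [simp]: "nless (Bs a b c d) (Suc 0) = 0" "nless (Bs a b c d) 2 = of_bool a"
  "nless (Bs a b c d) 3 = of_bool a + of_bool b" "nless (Bs a b c d) 4 = of_bool a + of_bool b + of_bool c"
proof -
  have "{j \<in> Bs a b c d. j < Suc 0} = Bs ff ff ff ff" "{j \<in> Bs a b c d. j < 2} = Bs a ff ff ff"
    "{j \<in> Bs a b c d. j < 3} = Bs a b ff ff" "{j \<in> Bs a b c d. j < 4} = Bs a b c ff"
    by (auto simp: Bs_def)
  then show "nless (Bs a b c d) (Suc 0) = 0" "nless (Bs a b c d) 2 = of_bool a"
  "nless (Bs a b c d) 3 = of_bool a + of_bool b" "nless (Bs a b c d) 4 = of_bool a + of_bool b + of_bool c"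
    by (simp_all add: nless_def)
qed

lemma Bs_ngt [simp]: "ngt (Bs a b c d) (Suc 0) = of_bool b + of_bool c + of_bool d"
  "ngt (Bs a b c d) 2 = of_bool c + of_bool d" "ngt (Bs a b c d) 3 = of_bool d" "ngt (Bs a b c d) 4 = 0"
proof -
  have "{j \<in> Bs a b c d. Suc 0 < j} = Bs ff b c d" "{j \<in> Bs a b c d. 2 < j} = Bs ff ff c d"
    "{j \<in> Bs a b c d. 3 < j} = Bs ff ff ff d" "{j \<in> Bs a b c d. 4 < j} = Bs ff ff ff ff"
    by (auto simp: Bs_def)
  then show "ngt (Bs a b c d) (Suc 0) = of_bool b + of_bool c + of_bool d"
  "ngt (Bs a b c d) 2 = of_bool c + of_bool d" "ngt (Bs a b c d) 3 = of_bool d" "ngt (Bs a b c d) 4 = 0"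
    by (simp_all add: ngt_def)
qed

lemma Bs_lit: "{} = Bs ff ff ff ff" "{1, 2} = Bs tt tt ff ff" "{3, 4} = Bs ff ff tt tt"
  "{1, 3} = Bs tt ff tt ff" "{2, 4} = Bs ff tt ff tt" "{2, 3} = Bs ff tt tt ff"
  "{1, 4} = Bs tt ff ff tt" "{1..4} = Bs tt tt tt tt"
  "{Suc 0} = Bs tt ff ff ff" "{2} = Bs ff tt ff ff" "{3} = Bs ff ff tt ff" "{4} = Bs ff ff ff tt"
  by (auto simp: Bs_def)

lemma Bs_ex: assumes "I \<subseteq> {1..4}" shows "\<exists>a b c d. I = Bs a b c d"
proof -
  have "i \<in> I \<longleftrightarrow> i \<in> Bs (1 \<in> I) (2 \<in> I) (3 \<in> I) (4 \<in> I)" for i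
  proof (cases "i \<in> {1..4}")
    case True
    then have "i = 1 \<or> i = 2 \<or> i = 3 \<or> i = 4" by auto
    then show ?thesis by (auto simp: Bs_def)
  next
    case False
    then have "i \<notin> I" using assms by blast
    then show ?thesis using False by (auto simp: Bs_def)
  qed
  then have "I = Bs (1 \<in> I) (2 \<in> I) (3 \<in> I) (4 \<in> I)" by blast
  then show ?thesis by blast
qed

text \<open>The generator \<open>w\<close> of the homology at \<open>M_C\<^bsup>-1,-1\<^esup>\<close>: \<open>\<Theta> w = \<nabla>(\<eta>\<^sub>1\<eta>\<^sub>2\<eta>\<^sub>3\<eta>\<^sub>4)\<close>.\<close>
definition wL :: "mlist" where
  "wL = [(- 1 / 2, 0, Bs tt ff tt tt, (1, 0, 1, 0)), (\<i> / 2, 0, Bs ff tt tt tt, (1, 0, 1, 0)),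
         (1 / 2, 0, Bs tt tt tt ff, (1, 0, 0, 1)), (\<i> / 2, 0, Bs tt tt ff tt, (1, 0, 0, 1)),
         (- 1 / 2, 0, Bs tt tt tt ff, (0, 1, 1, 0)), (\<i> / 2, 0, Bs tt tt ff tt, (0, 1, 1, 0)),
         (- 1 / 2, 0, Bs tt ff tt tt, (0, 1, 0, 1)), (- \<i> / 2, 0, Bs ff tt tt tt, (0, 1, 0, 1))]"

definition actW :: "gb \<Rightarrow> mlist" where
  "actW x = lbind wL (\<lambda>(k, J, \<alpha>). actL 3 x J \<alpha>)"

definition rl :: "nat \<Rightarrow> complex \<Rightarrow> nat \<Rightarrow> nat set \<Rightarrow> mono \<Rightarrow> complex \<times> nat \<times> nat set \<times> mono" where
  "rl j c k J \<alpha> = (if j \<in> J then (- c * (-1) ^ ngt J j / 2, k + 1, J - {j}, \<alpha>)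
                   else (c * (-1) ^ ngt J j, k, insert j J, \<alpha>))"

text \<open>The image of Theta^k eta_J under the arrow out of M_C^{0,0}, with every w_ab expanded
  into its two eta-terms.\<close>

definition nabL :: "nat \<Rightarrow> nat set \<Rightarrow> mlist" where
  "nabL k J = [rl 2 1 k J (1, 0, 1, 0), rl 1 \<i> k J (1, 0, 1, 0), rl 4 (- 1) k J (1, 0, 0, 1), rl 3 \<i> k J (1, 0, 0, 1),
               rl 4 1 k J (0, 1, 1, 0), rl 3 \<i> k J (0, 1, 1, 0), rl 2 1 k J (0, 1, 0, 1), rl 1 (- \<i>) k J (0, 1, 0, 1)]"

text \<open>As a congruence rule this keeps the simplifier out of the function argument until the
  list is explicit, so the recursion is not unfolded under a binder.\<close>

lemma lbind_weak: "L = L' \<Longrightarrow> lbind L g = lbind L' g" by simp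

lemma Bs_diff [simp]: "Bs a b c d - Bs a' b' c' d' = Bs (a \<and> \<not> a') (b \<and> \<not> b') (c \<and> \<not> c') (d \<and> \<not> d')"
  by (auto simp: Bs_def)

definition lm1 :: "nat set \<Rightarrow> complex \<times> nat \<times> nat set \<times> mono \<Rightarrow> complex \<times> nat \<times> nat set \<times> mono" where
  "lm1 I e = (case e of (c, k, J, \<alpha>) \<Rightarrow> if I = {} then (c, k + 1, J, \<alpha>)
      else if Min I \<in> J then ((-1) ^ nless J (Min I) * (- 1 / 2) * c, k + 1, J - {Min I}, \<alpha>)
      else ((-1) ^ nless J (Min I) * c, k, insert (Min I) J, \<alpha>))"

lemma lm_eval: "lm (GK a I) [] = []" "lm (GK a I) (e # L) = lm1 I e # lm (GK a I) L"
  by (auto simp: lm1_def)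

lemma lm1_eval:
  "lm1 (Bs ff ff ff ff) (c, k, J, \<alpha>) = (c, Suc k, J, \<alpha>)"
  "lm1 (Bs tt ff ff ff) (c, k, J, \<alpha>) = (let s = (-1) ^ nless J 1 * c in if 1 \<in> J then (- s / 2, Suc k, J - {1}, \<alpha>) else (s, k, insert 1 J, \<alpha>))"
  "lm1 (Bs ff tt ff ff) (c, k, J, \<alpha>) = (let s = (-1) ^ nless J 2 * c in if 2 \<in> J then (- s / 2, Suc k, J - {2}, \<alpha>) else (s, k, insert 2 J, \<alpha>))"
  "lm1 (Bs ff ff tt ff) (c, k, J, \<alpha>) = (let s = (-1) ^ nless J 3 * c in if 3 \<in> J then (- s / 2, Suc k, J - {3}, \<alpha>) else (s, k, insert 3 J, \<alpha>))"
  "lm1 (Bs ff ff ff tt) (c, k, J, \<alpha>) = (let s = (-1) ^ nless J 4 * c in if 4 \<in> J then (- s / 2, Suc k, J - {4}, \<alpha>) else (s, k, insert 4 J, \<alpha>))"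
  by (simp_all add: lm1_def Bs_lit(1) Let_def)

definition act0 :: "gb \<Rightarrow> mono \<Rightarrow> mlist" where
  "act0 x \<alpha> = map (\<lambda>(c, \<beta>). (c, 0, {}, \<beta>)) (g0L x \<alpha>)"

lemma actL_0: "actL 0 x J \<alpha> = (if gdeg x < 0 then lm x [(1, 0, J, \<alpha>)] else if gdeg x = 0 then act0 x \<alpha> else [])"
  by (simp add: act0_def)

lemma actL_Suc: "J \<noteq> Bs ff ff ff ff \<Longrightarrow> actL (Suc n) x J \<alpha> =
   (if gdeg x < 0 then lm x [(1, 0, J, \<alpha>)]
    else let j = Min J; J' = J - {j} in
      lbind (gbrL x j) (\<lambda>b. actL n b J' \<alpha>) @ smul ((-1) ^ gpar x) (lm (GK 0 {j}) (actL n x J' \<alpha>)))"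
  by (simp add: Let_def)

lemma act0_eval:
  "act0 GC (a1, a2, b1, b2) = [((of_nat (b1 + b2) - of_nat (a1 + a2)) / 2, 0, Bs ff ff ff ff, (a1, a2, b1, b2))]"
  "act0 (GK (Suc 0) (Bs ff ff ff ff)) (a1, a2, b1, b2) = [((of_nat (a1 + a2) + of_nat (b1 + b2)) / 2 + 2, 0, Bs ff ff ff ff, (a1, a2, b1, b2))]"
  "act0 (GK 0 (Bs tt tt ff ff)) (a1, a2, b1, b2) = [(\<i> / 2 * (of_nat a2 - of_nat a1), 0, Bs ff ff ff ff, (a1, a2, b1, b2)), (\<i> / 2 * (of_nat b2 - of_nat b1), 0, Bs ff ff ff ff, (a1, a2, b1, b2))]"
  "act0 (GK 0 (Bs ff ff tt tt)) (a1, a2, b1, b2) = [(- \<i> / 2 * (of_nat a2 - of_nat a1), 0, Bs ff ff ff ff, (a1, a2, b1, b2)), (\<i> / 2 * (of_nat b2 - of_nat b1), 0, Bs ff ff ff ff, (a1, a2, b1, b2))]"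
  "act0 (GK 0 (Bs tt ff tt ff)) (a1, a2, b1, b2) =
    [(of_nat a1 / 2, 0, Bs ff ff ff ff, (a1 - 1, Suc a2, b1, b2)), (of_nat b1 / 2, 0, Bs ff ff ff ff, (a1, a2, b1 - 1, Suc b2)),
     (- of_nat a2 / 2, 0, Bs ff ff ff ff, (Suc a1, a2 - 1, b1, b2)), (- of_nat b2 / 2, 0, Bs ff ff ff ff, (a1, a2, Suc b1, b2 - 1))]"
  "act0 (GK 0 (Bs ff tt ff tt)) (a1, a2, b1, b2) =
    [(- of_nat b1 / 2, 0, Bs ff ff ff ff, (a1, a2, b1 - 1, Suc b2)), (- of_nat a2 / 2, 0, Bs ff ff ff ff, (Suc a1, a2 - 1, b1, b2)),
     (of_nat b2 / 2, 0, Bs ff ff ff ff, (a1, a2, Suc b1, b2 - 1)), (of_nat a1 / 2, 0, Bs ff ff ff ff, (a1 - 1, Suc a2, b1, b2))]"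
  "act0 (GK 0 (Bs ff tt tt ff)) (a1, a2, b1, b2) =
    [(\<i> * of_nat a1 / 2, 0, Bs ff ff ff ff, (a1 - 1, Suc a2, b1, b2)), (\<i> * of_nat a2 / 2, 0, Bs ff ff ff ff, (Suc a1, a2 - 1, b1, b2)),
     (\<i> * of_nat b1 / 2, 0, Bs ff ff ff ff, (a1, a2, b1 - 1, Suc b2)), (\<i> * of_nat b2 / 2, 0, Bs ff ff ff ff, (a1, a2, Suc b1, b2 - 1))]"
  "act0 (GK 0 (Bs tt ff ff tt)) (a1, a2, b1, b2) =
    [(- \<i> * of_nat a1 / 2, 0, Bs ff ff ff ff, (a1 - 1, Suc a2, b1, b2)), (- \<i> * of_nat a2 / 2, 0, Bs ff ff ff ff, (Suc a1, a2 - 1, b1, b2)),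
     (\<i> * of_nat b1 / 2, 0, Bs ff ff ff ff, (a1, a2, b1 - 1, Suc b2)), (\<i> * of_nat b2 / 2, 0, Bs ff ff ff ff, (a1, a2, Suc b1, b2 - 1))]"
  unfolding act0_def g0L.simps[unfolded Bs_lit(2-7), unfolded Bs_lit(1)]
  by (simp_all add: smul_simps Bs_lit(1) Let_def)

declare actL.simps [simp del] g0L.simps [simp del] gbrL.simps [simp del] lm.simps [simp del]

lemmas list_eval = lbind_simps smul_simps actL_0 actL_Suc gbrL.simps[unfolded Bs_lit(8)] lm_eval lm1_eval Bs_lit(1) Bs_lit(9-12) Let_def



lemmas act_eval = list_eval act0_eval actW_def[unfolded numeral_3_eq_3] wL_def nabL_def rl_def vec_append

lemma actW_m2a:
  "vec (actW (GK 0 (Bs ff ff ff ff))) z = 1 * vec (nabL 0 (Bs tt tt tt tt)) z"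
  by (simp add: act_eval cong: lbind_weak; simp add: field_simps)+

text \<open>The constants are those of eta_j eta_1 eta_2 eta_3 eta_4: moving eta_j to its partner
  gives the sign, and eta_j^2 = - Theta/2 the rest.\<close>

lemma actW_m1a:
  "vec (actW (GK 0 (Bs tt ff ff ff))) z = (- 1 / 2) * vec (nabL 0 (Bs ff tt tt tt)) z"
  "vec (actW (GK 0 (Bs ff tt ff ff))) z = (1 / 2) * vec (nabL 0 (Bs tt ff tt tt)) z"
  "vec (actW (GK 0 (Bs ff ff tt ff))) z = (- 1 / 2) * vec (nabL 0 (Bs tt tt ff tt)) z"
  by (simp add: act_eval cong: lbind_weak; simp add: field_simps)+

lemma actW_m1b:
  "vec (actW (GK 0 (Bs ff ff ff tt))) z = (1 / 2) * vec (nabL 0 (Bs tt tt tt ff)) z"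
  by (simp add: act_eval cong: lbind_weak; simp add: field_simps)+

lemma actW_0a:
  "vec (actW (GK 0 (Bs tt tt ff ff))) z = 0"
  "vec (actW (GK 0 (Bs tt ff tt ff))) z = 0"
  "vec (actW (GK 0 (Bs tt ff ff tt))) z = 0"
  by (simp add: act_eval cong: lbind_weak; simp add: field_simps)+

lemma actW_0b:
  "vec (actW (GK 0 (Bs ff tt tt ff))) z = 0"
  "vec (actW (GK 0 (Bs ff tt ff tt))) z = 0"
  "vec (actW (GK 0 (Bs ff ff tt tt))) z = 0"
  by (simp add: act_eval cong: lbind_weak; simp add: field_simps)+

text \<open>\<open>t\<close> acts as 3 on V_C^{-1,-1} and contributes - 1 for each of the three etas
  in w; C acts as (1 - 1)/2.\<close>

lemma actW_0c:
  "vec (actW (GK (Suc 0) (Bs ff ff ff ff))) z = 0"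
  "vec (actW GC) z = 0"
  by (simp add: act_eval cong: lbind_weak; simp add: field_simps)+

text \<open>A product xi_I with |I| = 3 sends w to a multiple of nabla eta_j, where j is the index
  missing from I.\<close>

lemma actW_1a:
  "vec (actW (GK 0 (Bs tt tt tt ff))) z = (- 1 / 2) * vec (nabL 0 (Bs ff ff ff tt)) z"
  "vec (actW (GK 0 (Bs tt tt ff tt))) z = (1 / 2) * vec (nabL 0 (Bs ff ff tt ff)) z"
  "vec (actW (GK 0 (Bs tt ff tt tt))) z = (- 1 / 2) * vec (nabL 0 (Bs ff tt ff ff)) z"
  by (simp add: act_eval cong: lbind_weak; simp add: field_simps)+

lemma actW_1b:
  "vec (actW (GK 0 (Bs ff tt tt tt))) z = (1 / 2) * vec (nabL 0 (Bs tt ff ff ff)) z"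
  "vec (actW (GK (Suc 0) (Bs tt ff ff ff))) z = 0"
  "vec (actW (GK (Suc 0) (Bs ff tt ff ff))) z = 0"
  by (simp add: act_eval cong: lbind_weak; simp add: field_simps)+

lemma actW_1c:
  "vec (actW (GK (Suc 0) (Bs ff ff tt ff))) z = 0"
  "vec (actW (GK (Suc 0) (Bs ff ff ff tt))) z = 0"
  by (simp add: act_eval cong: lbind_weak; simp add: field_simps)+

lemma actW_2a:
  "vec (actW (GK 0 (Bs tt tt tt tt))) z = (- 1) * vec (nabL 0 (Bs ff ff ff ff)) z"
  "vec (actW (GK (Suc 0) (Bs tt tt ff ff))) z = 0"
  "vec (actW (GK (Suc 0) (Bs tt ff tt ff))) z = 0"
  by (simp add: act_eval cong: lbind_weak; simp add: field_simps)+

lemma actW_2b: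
  "vec (actW (GK (Suc 0) (Bs tt ff ff tt))) z = 0"
  "vec (actW (GK (Suc 0) (Bs ff tt tt ff))) z = 0"
  "vec (actW (GK (Suc 0) (Bs ff tt ff tt))) z = 0"
  by (simp add: act_eval cong: lbind_weak; simp add: field_simps)+

lemma actW_2c:
  "vec (actW (GK (Suc 0) (Bs ff ff tt tt))) z = 0"
  "vec (actW (GK 2 (Bs ff ff ff ff))) z = 0"
  by (simp add: act_eval cong: lbind_weak; simp add: field_simps)+

lemma actW_3a:
  "vec (actW (GK (Suc 0) (Bs tt tt tt ff))) z = 0"
  "vec (actW (GK (Suc 0) (Bs tt tt ff tt))) z = 0"
  "vec (actW (GK (Suc 0) (Bs tt ff tt tt))) z = 0"
  by (simp add: act_eval cong: lbind_weak; simp add: field_simps)+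

lemma actW_3b:
  "vec (actW (GK (Suc 0) (Bs ff tt tt tt))) z = 0"
  "vec (actW (GK 2 (Bs tt ff ff ff))) z = 0"
  "vec (actW (GK 2 (Bs ff tt ff ff))) z = 0"
  by (simp add: act_eval cong: lbind_weak; simp add: field_simps)+

lemma actW_3c:
  "vec (actW (GK 2 (Bs ff ff tt ff))) z = 0"
  "vec (actW (GK 2 (Bs ff ff ff tt))) z = 0"
  by (simp add: act_eval cong: lbind_weak; simp add: field_simps)+

lemmas actW_all = actW_m2a actW_m1a actW_m1b actW_0a actW_0b actW_0c actW_1a actW_1b actW_1c actW_2a actW_2b actW_2c actW_3a actW_3b actW_3c

section \<open>The homology at M_C^{-1,-1}\<close>

definition bdry_coeffs :: "ucl \<Rightarrow> nat \<Rightarrow> nat \<Rightarrow> nat \<Rightarrow> nat \<Rightarrow> ucl" where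
  "bdry_coeffs s = nabC (single 0 0 (single 0 0 s))"

lemma bdry_coeffs_eq: "bdry_coeffs s a1 a2 b1 b2 =
   (if (a1, a2, b1, b2) = (1, 0, 1, 0) then w11 s else if (a1, a2, b1, b2) = (1, 0, 0, 1) then w12 s
    else if (a1, a2, b1, b2) = (0, 1, 1, 0) then w21 s else if (a1, a2, b1, b2) = (0, 1, 0, 1) then w22 s else 0)"
  by (auto simp: bdry_coeffs_def raise_def single_def)

definition boundary :: "ucl \<Rightarrow> me" where
  "boundary s = genmap (nabla VC) (of_coeffs VC (single 0 0 (single 0 0 s)))"

lemma single_Fam00: "single 0 0 (single 0 0 s) \<in> Fam 0 0"
  by (intro single_Fam single_homog) auto

lemma boundary_eval: "boundary s (k, J, a1, a2, b1, b2) = Rep (bdry_coeffs s a1 a2 b1 b2) (k, J)"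
  using arrow_repD[OF arrow_nabla(3) of_coeffs_Mspace[OF single_Fam00[of s]], of a1 a2 b1 b2 k J]
  by (simp add: boundary_def bdry_coeffs_def coeffs_of_coeffs[OF single_Fam00] dp_def xpoly_def ypoly_def)

lemma boundary_Img: "boundary s \<in> Img (VC, 1, 1)"
proof -
  have "outarrow (VC, 0, 0) = Some ((VC, 1, 1), nabla VC)" by simp
  then show ?thesis unfolding Img_def boundary_def using of_coeffs_Mspace[OF single_Fam00, of VC s] by blast
qed

lemma vec_rl:
  assumes "J \<subseteq> {1..4}" "j \<in> {1..4}"
  shows "vec [rl j c k J \<alpha>] (k', J', \<alpha>') = (if \<alpha>' = \<alpha> then c * Rep (rmul j (mon (k, J))) (k', J') else 0)"
proof -
  have "J - {j} \<subseteq> {1..4}" "insert j J \<subseteq> {1..4}" using assms by auto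
  then show ?thesis unfolding rmul_mon[OF assms]
    by (cases "j \<in> J") (simp_all add: rl_def rep_simps Rep_mon dlt_def usgn_def)
qed

lemma vec_Cons: "vec (e # L) z = vec [e] z + vec L z"
  by (simp add: vec_def)

lemma vec_nabL:
  assumes J: "J \<subseteq> {1..4}" shows "vec (nabL k J) = boundary (mon (k, J))"
proof
  fix z :: "nat \<times> nat set \<times> mono"
  obtain k' J' a1 a2 b1 b2 where z: "z = (k', J', a1, a2, b1, b2)" by (cases z)
  define R where "R = (\<lambda>j. Rep (rmul j (mon (k, J))) (k', J'))"
  have v: "vec [rl j c k J \<alpha>] z = (if (a1, a2, b1, b2) = \<alpha> then c * R j else 0)" if "j \<in> {1..4}" for j c \<alpha>
    unfolding z R_def by (rule vec_rl[OF J that])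
  have "vec (nabL k J) z = vec [rl 2 1 k J (1, 0, 1, 0)] z + (vec [rl 1 \<i> k J (1, 0, 1, 0)] z
     + (vec [rl 4 (- 1) k J (1, 0, 0, 1)] z + (vec [rl 3 \<i> k J (1, 0, 0, 1)] z + (vec [rl 4 1 k J (0, 1, 1, 0)] z
     + (vec [rl 3 \<i> k J (0, 1, 1, 0)] z + (vec [rl 2 1 k J (0, 1, 0, 1)] z + vec [rl 1 (- \<i>) k J (0, 1, 0, 1)] z))))))"
    unfolding nabL_def by (simp only: vec_Cons[of _ "_ # _"])
  also have "\<dots> = Rep (bdry_coeffs (mon (k, J)) a1 a2 b1 b2) (k', J')"
    by (subst v, simp)+ (auto simp: bdry_coeffs_eq w11_def w12_def w21_def w22_def rep_simps R_def)
  finally show "vec (nabL k J) z = boundary (mon (k, J)) z" by (simp add: z boundary_eval)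
qed

lemma Bs_sub: "Bs a b c d \<subseteq> {1..4}"
  by (auto simp: Bs_def)

abbreviation wvec :: me where "wvec \<equiv> vec wL"

lemma wL_shape: "(e, t) \<in> set wL \<Longrightarrow> \<exists>J \<alpha>. t = (0, J, \<alpha>) \<and> J \<subseteq> {1..4} \<and> card J = 3"
  using Bs_sub by (auto simp: wL_def)

lemma act_wvec: "act VC x wvec = vec (actW x)"
  unfolding act_def actW_def
proof (rule lin_vec_lbind)
  fix t assume "t \<in> snd ` set wL"
  then obtain J \<alpha> where t: "t = (0, J, \<alpha>)" "J \<subseteq> {1..4}" "card J = 3"
    using wL_shape by force
  then show "(case t of (k, J, \<alpha>) \<Rightarrow> actn (k + card J) VC x k J \<alpha>) = vec (case t of (k, J, \<alpha>) \<Rightarrow> actL 3 x J \<alpha>)"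
    using actn_vec[of J 3] by simp
qed

lemma boundary_scl: "boundary (scl c s) = (\<lambda>z. c * boundary s z)"
proof
  fix z :: "nat \<times> nat set \<times> mono"
  obtain k' J' a1 a2 b1 b2 where z: "z = (k', J', a1, a2, b1, b2)" by (cases z)
  show "boundary (scl c s) z = c * boundary s z" by (simp add: z boundary_eval bdry_coeffs_eq w_scl rep_simps)
qed

lemma zero_Img: "(\<lambda>z. 0) \<in> Img v"
  by (simp add: Img_def)

lemma scaled_nabL_Img: "(\<lambda>z. c * vec (nabL k (Bs a b d e)) z) \<in> Img (VC, 1, 1)"
  unfolding vec_nabL[OF Bs_sub] boundary_scl[symmetric] by (rule boundary_Img)

lemma vec_zero: "\<forall>(c, z)\<in>set L. c = 0 \<Longrightarrow> vec L = (\<lambda>z. 0)"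
  by (induction L) auto

text \<open>Since w has three etas, \<open>actL_high\<close> disposes of the degrees above 3; the
  finitely many other basis elements are those listed in \<open>actW_all\<close>.\<close>

lemma act_wvec_Img:
  assumes "is_gbasis x" shows "act VC x wvec \<in> Img (VC, 1, 1)"
proof (cases "gdeg x > 3")
  case True
  have "c = 0" if "(c, z) \<in> set (actW x)" for c z
  proof -
    from that obtain e t where et: "(e, t) \<in> set wL" "(c, z) \<in> set (smul e (case t of (k, J, \<alpha>) \<Rightarrow> actL 3 x J \<alpha>))"
      by (auto simp: actW_def lbind_def)
    obtain J \<alpha> where t: "t = (0, J, \<alpha>)" "J \<subseteq> {1..4}" "card J = 3" using wL_shape[OF et(1)] by blast
    have "\<forall>(d, z)\<in>set (actL 3 x J \<alpha>). d = 0" by (rule actL_high) (use True assms t in simp_all)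
    then show ?thesis using et(2) t(1) by (auto simp: smul_def)
  qed
  then have "\<forall>(c, z)\<in>set (actW x). c = 0" by blast
  then have "vec (actW x) = (\<lambda>z. 0)"
    by (rule vec_zero)
  then show ?thesis by (simp add: act_wvec zero_Img)
next
  case False
  show ?thesis
  proof (cases x)
    case GC
    have "vec (actW x) = (\<lambda>z. 0)" unfolding GC by (rule ext) (rule actW_all)
    then show ?thesis by (simp add: act_wvec zero_Img)
  next
    case (GK m I)
    then have "I \<subseteq> {1..4}" using assms by (simp add: is_gbasis_def)
    then obtain a b c d where I: "I = Bs a b c d" using Bs_ex by blast
    have "m \<le> 2" using False GK by simp
    then consider "m = 0" | "m = Suc 0" | "m = 2" by linarith
    then have "(\<exists>e k a' b' c' d'. \<forall>z. vec (actW x) z = e * vec (nabL k (Bs a' b' c' d')) z) \<or> (\<forall>z. vec (actW x) z = 0)"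
    proof cases
      case 1 show ?thesis unfolding GK I 1
        by (cases a; cases b; cases c; cases d; simp only: actW_all simp_thms; blast)
    next
      case 2 show ?thesis using False unfolding GK I 2
        by (cases a; cases b; cases c; cases d; simp add: actW_all del: vec_simps)
    next
      case 3 show ?thesis using False unfolding GK I 3
        by (cases a; cases b; cases c; cases d; simp add: actW_all del: vec_simps)
    qed
    then show ?thesis
    proof
      assume "\<exists>e k a' b' c' d'. \<forall>z. vec (actW x) z = e * vec (nabL k (Bs a' b' c' d')) z"
      then obtain e k a' b' c' d' where "vec (actW x) = (\<lambda>z. e * vec (nabL k (Bs a' b' c' d')) z)" by blast
      then show ?thesis using scaled_nabL_Img by (simp add: act_wvec)
    next
      assume "\<forall>z. vec (actW x) z = 0"
      then have "vec (actW x) = (\<lambda>z. 0)" by blast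
      then show ?thesis by (simp add: act_wvec zero_Img)
    qed
  qed
qed

lemma wvec_Mspace: "wvec \<in> Mspace (VC, 1, 1)"
proof -
  have "J \<subseteq> {1..4} \<and> a1 + a2 = 1 \<and> b1 + b2 = 1" if nz: "wvec (k, J, a1, a2, b1, b2) \<noteq> 0" for k J a1 a2 b1 b2
  proof
    obtain e where "(e, k, J, a1, a2, b1, b2) \<in> set wL" using vec_nz[OF nz] by auto
    then show "J \<subseteq> {1..4}" using wL_shape by blast
    show "a1 + a2 = 1 \<and> b1 + b2 = 1" using vec_nz[OF nz] by (auto simp: wL_def)
  qed
  then show ?thesis using finite_vec[of wL] by (simp add: Mspace_def)
qed

definition w_coeffs :: "nat \<Rightarrow> nat \<Rightarrow> nat \<Rightarrow> nat \<Rightarrow> ucl" where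
  "w_coeffs = coeffs VC wvec"

lemma Rep_w_coeffs: "Rep (w_coeffs a1 a2 b1 b2) (k, J) = wvec (k, J, a1, a2, b1, b2)"
  using Rep_coeffs[OF wvec_Mspace] by (simp add: w_coeffs_def dp_def xpoly_def ypoly_def)

abbreviation omega :: ucl where "omega \<equiv> mon (0, {1..4})"

lemma theta_w_coeffs: "theta (w_coeffs a1 a2 b1 b2) = bdry_coeffs omega a1 a2 b1 b2"
proof (rule ucl_eqI)
  fix k :: nat and J :: "nat set"
  have 1: "nabL 0 (Bs tt tt tt tt) = map (\<lambda>(c, k, J, \<alpha>). (c, Suc k, J, \<alpha>)) wL"
    by (simp add: nabL_def rl_def wL_def)
  have 2: "vec (map (\<lambda>(c, k, J, \<alpha>). (c, Suc k, J, \<alpha>)) L) (k, J, \<alpha>) = (if k = 0 then 0 else vec L (k - 1, J, \<alpha>))" for L and \<alpha> :: mono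
    by (induction L) (auto simp: dlt_def)
  have "Rep (bdry_coeffs omega a1 a2 b1 b2) (k, J) = vec (nabL 0 {1..4}) (k, J, a1, a2, b1, b2)"
    by (simp only: boundary_eval vec_nabL[OF subset_refl])
  also have "\<dots> = (if k = 0 then 0 else wvec (k - 1, J, a1, a2, b1, b2))"
    unfolding Bs_lit(8) 1 2 ..
  finally show "Rep (theta (w_coeffs a1 a2 b1 b2)) (k, J) = Rep (bdry_coeffs omega a1 a2 b1 b2) (k, J)"
    by (simp add: theta.rep_eq Rep_w_coeffs)
qed

lemma theta_lin: "theta (x + y) = theta x + theta y" "theta (x - y) = theta x - theta y" "theta (- x) = - theta x" "theta 0 = 0" "theta (scl c x) = scl c (theta x)"
  by (rule ucl_eqI; simp add: rep_simps theta.rep_eq)+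

lemma theta_w: "theta (w11 x) = w11 (theta x)" "theta (w12 x) = w12 (theta x)" "theta (w21 x) = w21 (theta x)" "theta (w22 x) = w22 (theta x)"
  by (simp_all add: w11_def w12_def w21_def w22_def theta_lin theta_rmul)

lemma theta_inj: "theta x = 0 \<Longrightarrow> x = 0"
proof (rule ucl_eqI)
  fix k J assume "theta x = 0"
  then have "Rep (theta x) (Suc k, J) = Rep 0 (Suc k, J)" by simp
  then show "Rep x (k, J) = Rep 0 (k, J)" by (simp add: theta.rep_eq rep_simps)
qed

lemma raise_theta: "nabC (\<lambda>a1 a2 b1 b2. theta (F a1 a2 b1 b2))
    = (\<lambda>a1 a2 b1 b2. theta (nabC F a1 a2 b1 b2))"
  by (intro ext) (simp add: raise_def theta_w theta_lin)

text \<open>Theta w is a boundary, and Theta is injective and commutes with nabla.\<close>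

lemma w_coeffs_cycle: "nabC w_coeffs = 0"
proof -
  interpret anticomm_pair "raise w11 w12" "raise w21 w22" by (rule std.pair_R)
  have "(\<lambda>a1 a2 b1 b2. theta (w_coeffs a1 a2 b1 b2)) = nabC (single 0 0 (single 0 0 omega))"
    by (intro ext) (simp add: theta_w_coeffs bdry_coeffs_def)
  then have "theta (nabC w_coeffs a1 a2 b1 b2) = 0" for a1 a2 b1 b2
    using raise_theta[of w_coeffs] raise_raise[of "single 0 0 (single 0 0 omega)"] by (simp add: fun_eq_iff)
  then show ?thesis by (intro ext) (simp add: theta_inj)
qed

text \<open>If w were nabla s, injectivity of nabla would give eta_1 eta_2 eta_3 eta_4 = Theta s;
  but this product is a basis element without a factor Theta.\<close>

lemma w_coeffs_not_boundary: "w_coeffs \<noteq> bdry_coeffs s"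
proof
  assume e: "w_coeffs = bdry_coeffs s"
  have "bdry_coeffs omega a b c d = theta (bdry_coeffs s a b c d)" for a b c d using theta_w_coeffs[of a b c d] e by simp
  from this[of 1 0 1 0] this[of 0 1 0 1] have "w11 (omega - theta s) = 0" "w22 (omega - theta s) = 0"
    by (simp_all add: bdry_coeffs_eq theta_w)
  then have "omega - theta s = 0" by (rule std.all_w_zero)
  then have "Rep (omega - theta s) (0, {1..4}) = 0" by (simp add: rep_simps)
  then show False by (simp add: rep_simps theta.rep_eq Rep_mon dlt_def)
qed

lemma wvec_Ker: "wvec \<in> Ker (VC, 1, 1)"
proof -
  have "genmap (nabla VC) wvec z = 0" for z
  proof -
    obtain k J a1 a2 b1 b2 where z: "z = (k, J, a1, a2, b1, b2)" by (cases z)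
    show ?thesis
      using arrow_repD[OF arrow_nabla(3) wvec_Mspace, of a1 a2 b1 b2 k J] w_coeffs_cycle
      by (simp add: z dp_def xpoly_def ypoly_def rep_simps flip: w_coeffs_def)
  qed
  then show ?thesis using wvec_Mspace by (auto simp: Ker_def)
qed

lemma outarrow_C11: "outarrow v = Some ((VC, 1, 1), ts) \<Longrightarrow> v = (VC, 0, 0) \<and> ts = nabla VC"
  by (cases v; cases "fst v") (auto split: if_splits)

lemma wvec_not_Img: "wvec \<notin> Img (VC, 1, 1)"
proof
  assume "wvec \<in> Img (VC, 1, 1)"
  then consider "wvec = (\<lambda>z. 0)" | g where "g \<in> Mspace (VC, 0, 0)" "wvec = genmap (nabla VC) g"
    unfolding Img_def using outarrow_C11 by blast
  then show False
  proof cases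
    case 1
    then have "wvec (0, Bs tt ff tt tt, 1, 0, 1, 0) = 0" by simp
    then show False by (simp add: wL_def dlt_def)
  next
    case 2
    define s where "s = coeffs VC g 0 0 0 0"
    have G: "coeffs VC g \<in> Fam 0 0" using coeffs_Fam[OF 2(1)] .
    have "coeffs VC g = single 0 0 (coeffs VC g 0 0)" "coeffs VC g 0 0 = single 0 0 s"
      using Fam0_eq[OF G] homog_0_eq[OF homog_in[OF G, of 0 0]] by (simp_all add: s_def)
    then have Gs: "coeffs VC g = single 0 0 (single 0 0 s)" by simp
    have "w_coeffs = bdry_coeffs s"
    proof (intro ext ucl_eqI)
      fix a1 a2 b1 b2 k J
      show "Rep (w_coeffs a1 a2 b1 b2) (k, J) = Rep (bdry_coeffs s a1 a2 b1 b2) (k, J)"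
        using arrow_repD[OF arrow_nabla(3) 2(1), of a1 a2 b1 b2 k J]
        by (simp add: Rep_w_coeffs 2(2) bdry_coeffs_def Gs dp_def xpoly_def ypoly_def)
    qed
    then show False using w_coeffs_not_boundary by blast
  qed
qed

text \<open>The four w's span the same space as the four etas, and every PBW monomial other than 1
  is a multiple of something times an eta on the right.\<close>

lemma augmentation: "\<exists>a b c d. u = scl (Rep u (0, {})) one + (w11 a + w12 b + w21 c + w22 d)"
proof -
  define A where "A = {u. \<exists>a b c d. u = w11 a + w12 b + w21 c + w22 d}"
  have A0: "0 \<in> A" unfolding A_def by (auto intro!: exI[of _ 0])
  have Aadd: "x + y \<in> A" if xy: "x \<in> A" "y \<in> A" for x y
  proof -
    obtain a b c d a' b' c' d' where "x = w11 a + w12 b + w21 c + w22 d" "y = w11 a' + w12 b' + w21 c' + w22 d'"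
      using xy unfolding A_def by blast
    then have "x + y = w11 (a + a') + w12 (b + b') + w21 (c + c') + w22 (d + d')" by (simp add: add_ac)
    then show ?thesis unfolding A_def by blast
  qed
  have Ascl: "scl c x \<in> A" if x: "x \<in> A" for c x
  proof -
    obtain a b e d where "x = w11 a + w12 b + w21 e + w22 d" using x unfolding A_def by blast
    then have "scl c x = w11 (scl c a) + w12 (scl c b) + w21 (scl c e) + w22 (scl c d)" by (simp add: w_scl scl_simps)
    then show ?thesis unfolding A_def by blast
  qed
  have AW: "w11 x \<in> A" "w12 x \<in> A" "w21 x \<in> A" "w22 x \<in> A" for x
  proof -
    have "w11 x = w11 x + w12 0 + w21 0 + w22 0" "w12 x = w11 0 + w12 x + w21 0 + w22 0"
      "w21 x = w11 0 + w12 0 + w21 x + w22 0" "w22 x = w11 0 + w12 0 + w21 0 + w22 x" by simp_all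
    then show "w11 x \<in> A" "w12 x \<in> A" "w21 x \<in> A" "w22 x \<in> A" unfolding A_def by blast+
  qed
  have Arr: "rmul j x \<in> A" if "j \<in> {1..4}" for j x
  proof -
    have "rmul 1 x = scl (1 / (2 * \<i>)) (w11 x + scl (- 1) (w22 x))" "rmul 2 x = scl (1 / 2) (w11 x + w22 x)"
      "rmul 3 x = scl (1 / (2 * \<i>)) (w12 x + w21 x)" "rmul 4 x = scl (1 / 2) (w21 x + scl (- 1) (w12 x))"
      by (rule ucl_eqI; simp add: w11_def w12_def w21_def w22_def rep_simps field_simps)+
    then have "rmul 1 x \<in> A" "rmul 2 x \<in> A" "rmul 3 x \<in> A" "rmul 4 x \<in> A"
      using Ascl Aadd AW by metis+
    moreover have "j = 1 \<or> j = 2 \<or> j = 3 \<or> j = 4" using that by auto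
    ultimately show ?thesis by auto
  qed
  have Adl: "mon (k, J) \<in> A" if J: "J \<subseteq> {1..4}" and nz: "(k, J) \<noteq> (0, {})" for k J
  proof (cases "J = {}")
    case False
    then obtain j where j: "j \<in> J" by blast
    then have j4: "j \<in> {1..4}" using J by blast
    have "rmul j (mon (k, J - {j})) = scl (usgn J j) (mon (k, J))"
      using J j j4 by (subst rmul_mon) (auto simp: insert_absorb usgn_def ngt_diff)
    then have "mon (k, J) = scl (usgn J j) (rmul j (mon (k, J - {j})))" by (simp add: scl_simps)
    then show ?thesis using Ascl[OF Arr[OF j4]] by metis
  next
    case True
    then obtain k' where k: "k = Suc k'" using nz by (cases k) auto
    \<comment> \<open>Powers of Theta are reached through Theta = - 2 eta_1 eta_1.\<close>
    have "rmul 1 (mon (k', {1})) = scl (- usgn {1} 1 / 2) (mon (k, J))"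
      using True k by (subst rmul_mon) auto
    moreover have "{j \<in> {1 :: nat}. 1 < j} = {}" by auto
    then have "usgn {1} 1 = 1" by (simp only: usgn_def ngt_def card.empty power_0)
    ultimately have "mon (k, J) = scl (- 2) (rmul 1 (mon (k', {1})))" by (simp add: scl_simps)
    then show ?thesis using Ascl[OF Arr[of 1]] by simp
  qed
  have Asum: "sum g P \<in> A" if "\<And>p. p \<in> P \<Longrightarrow> g p \<in> A" for g and P :: "(nat \<times> nat set) set"
    using that by (induction P rule: infinite_finite_induct) (auto intro: A0 Aadd)
  let ?S = "{p. Rep u p \<noteq> 0}"
  have "(\<Sum>p\<in>?S - {(0, {})}. scl (Rep u p) (mon p)) \<in> A"
  proof (rule Asum)
    fix p assume p: "p \<in> ?S - {(0, {})}"
    then have "snd p \<subseteq> {1..4}" using Rep_supp[of u p] by simp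
    then have "mon (fst p, snd p) \<in> A" using p by (intro Adl) auto
    then show "scl (Rep u p) (mon p) \<in> A" by (intro Ascl) simp
  qed
  moreover have "u = scl (Rep u (0, {})) one + (\<Sum>p\<in>?S - {(0, {})}. scl (Rep u p) (mon p))"
  proof (cases "(0, {}) \<in> ?S")
    case True
    show ?thesis by (subst ucl_decomp[of u]) (rule sum.remove[OF finite_Rep True])
  next
    case False
    then have "Rep u (0, {}) = 0" "?S - {(0, {})} = ?S" by auto
    then show ?thesis using ucl_decomp[of u] by (simp add: scl_simps)
  qed
  ultimately obtain v where "v \<in> A" "u = scl (Rep u (0, {})) one + v" by blast
  then show ?thesis unfolding A_def by blast
qed

text \<open>What prolongation leaves over at \<open>M_C\<^bsup>-1,-1\<^esup>\<close>.\<close>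
definition extra_cycle :: "ucl \<Rightarrow> nat \<Rightarrow> nat \<Rightarrow> nat \<Rightarrow> nat \<Rightarrow> ucl" where
  "extra_cycle r = single 0 1 (single 1 0 (w11 (w22 (w21 r))) + single 0 1 (w12 (w22 (w21 r))))"

lemma extra_cycle_add: "extra_cycle (r + r') = extra_cycle r + extra_cycle r'"
  by (intro ext) (simp add: extra_cycle_def single_def)

lemma extra_cycle_scl: "extra_cycle (scl c r) i j k l = scl c (extra_cycle r i j k l)"
  by (simp add: extra_cycle_def single_def w_scl scl_simps)

lemma bdry_coeffs_add: "bdry_coeffs (s + s') = bdry_coeffs s + bdry_coeffs s'"
  by (intro ext) (simp add: bdry_coeffs_eq)

text \<open>The element r left over by \<open>C11_cycle\<close> matters only up to the images of the
  w's, by \<open>C11_boundary\<close>; by \<open>augmentation\<close> it may thus be taken to be a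
  scalar.\<close>

lemma C11_class:
  assumes "F \<in> Fam 1 1" "nabC F = 0"
  shows "\<exists>s c. F = bdry_coeffs s + extra_cycle (scl c one)"
proof -
  obtain s r where F: "F = bdry_coeffs s + extra_cycle r"
    using std.C11_cycle[of F] assms unfolding bdry_coeffs_def extra_cycle_def by auto
  obtain a b c d where r: "r = scl (Rep r (0, {})) one + (w11 a + w12 b + w21 c + w22 d)"
    using augmentation by blast
  obtain s' where "extra_cycle (w11 a + w12 b + w21 c + w22 d) = bdry_coeffs s'"
    using std.C11_boundary[OF refl] unfolding extra_cycle_def bdry_coeffs_def by blast
  then have "extra_cycle r = extra_cycle (scl (Rep r (0, {})) one) + bdry_coeffs s'" by (subst r) (simp only: extra_cycle_add)
  then have "F = bdry_coeffs (s + s') + extra_cycle (scl (Rep r (0, {})) one)" unfolding F bdry_coeffs_add by (simp add: add_ac)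
  then show ?thesis by blast
qed

text \<open>The class of w is never computed. Both f and w are boundaries plus scalar multiples of
  one extra cycle; the scalar of w is nonzero because w is no boundary, so f is a multiple of w up
  to a boundary.\<close>

lemma trivial_C11: "homology_trivial1 (VC, 1, 1)"
  unfolding homology_trivial1_def
proof (intro bexI[OF _ wvec_Ker] conjI allI ballI impI)
  show "wvec \<notin> Img (VC, 1, 1)" by (rule wvec_not_Img)
  show "act (fst (VC, 1, 1)) x wvec \<in> Img (VC, 1, 1)" if "is_gbasis x" for x using act_wvec_Img[OF that] by simp
  fix f assume "f \<in> Ker (VC, 1, 1)"
  then have f: "f \<in> Mspace (VC, 1, 1)" "genmap (nabla VC) f = (\<lambda>z. 0)" by (auto simp: Ker_def)
  obtain s c where F: "coeffs VC f = bdry_coeffs s + extra_cycle (scl c one)"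
    using C11_class[OF coeffs_Fam[OF f(1)] Ker_coeffs[OF arrow_nabla(3) f]] by blast
  obtain s0 c0 where F0: "w_coeffs = bdry_coeffs s0 + extra_cycle (scl c0 one)"
    using C11_class[OF coeffs_Fam[OF wvec_Mspace]] w_coeffs_cycle by (auto simp flip: w_coeffs_def)
  have "c0 \<noteq> 0"
  proof
    assume "c0 = 0"
    then have "extra_cycle (scl c0 one) = 0" by (intro ext) (simp add: extra_cycle_def single_def scl_simps)
    then show False using F0 w_coeffs_not_boundary[of s0] by simp
  qed
  define e where "e = c / c0"
  have fz: "f z = e * wvec z + boundary (s - scl e s0) z" for z
  proof -
    obtain k J a1 a2 b1 b2 where z: "z = (k, J, a1, a2, b1, b2)" by (cases z)
    have "f z = Rep (coeffs VC f a1 a2 b1 b2) (k, J)"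
      using Rep_coeffs[OF f(1)] by (simp add: z dp_def xpoly_def ypoly_def)
    also have "\<dots> = Rep (bdry_coeffs s a1 a2 b1 b2) (k, J) + c * Rep (extra_cycle one a1 a2 b1 b2) (k, J)"
      unfolding F by (simp add: rep_simps extra_cycle_scl)
    finally have 1: "f z = Rep (bdry_coeffs s a1 a2 b1 b2) (k, J) + c * Rep (extra_cycle one a1 a2 b1 b2) (k, J)" .
    have "wvec z = Rep (w_coeffs a1 a2 b1 b2) (k, J)" by (simp add: z Rep_w_coeffs)
    also have "\<dots> = Rep (bdry_coeffs s0 a1 a2 b1 b2) (k, J) + c0 * Rep (extra_cycle one a1 a2 b1 b2) (k, J)"
      unfolding F0 by (simp add: rep_simps extra_cycle_scl)
    finally have 2: "wvec z = Rep (bdry_coeffs s0 a1 a2 b1 b2) (k, J) + c0 * Rep (extra_cycle one a1 a2 b1 b2) (k, J)" .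
    have 3: "boundary (s - scl e s0) z = Rep (bdry_coeffs s a1 a2 b1 b2) (k, J) - e * Rep (bdry_coeffs s0 a1 a2 b1 b2) (k, J)"
      by (simp add: z boundary_eval bdry_coeffs_eq w_scl rep_simps)
    show ?thesis unfolding 1 2 3 using \<open>c0 \<noteq> 0\<close> by (simp add: e_def field_simps)
  qed
  then show "\<exists>c g. g \<in> Img (VC, 1, 1) \<and> f = (\<lambda>z. c * wvec z + g z)"
    using boundary_Img by blast
qed

section \<open>The homology at M_A^{0,0}\<close>

lemma outarrow_A00: "outarrow v = Some ((VA, 0, 0), ts) \<Longrightarrow> v = (VA, 1, 1) \<and> ts = nabla VA"
  by (cases v; cases "fst v") (auto split: if_splits)

lemma Rep_w_one: "Rep (w11 x) (0, {}) = 0" "Rep (w12 x) (0, {}) = 0" "Rep (w21 x) (0, {}) = 0" "Rep (w22 x) (0, {}) = 0"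
  by (simp_all add: w11_def w12_def w21_def w22_def rep_simps rmul.rep_eq rop_def)

text \<open>The coefficients of a family in M_A^{1,1} are four arbitrary elements a, b, c, d, so the
  image of nabla is the sum of the images of the w's, which by \<open>augmentation\<close> contains
  every element with zero constant term.\<close>

lemma A00_Img:
  assumes f: "f \<in> Mspace (VA, 0, 0)" and z: "f (0, {}, 0, 0, 0, 0) = 0"
  shows "f \<in> Img (VA, 0, 0)"
proof -
  define u where "u = coeffs VA f 0 0 0 0"
  have F: "coeffs VA f \<in> Fam 0 0" using coeffs_Fam[OF f] .
  have Fu: "coeffs VA f = single 0 0 (single 0 0 u)"
    using Fam0_eq[OF F] homog_0_eq[OF homog_in[OF F, of 0 0]] by (simp add: u_def)
  have "Rep u (0, {}) = 0" using Rep_coeffs[OF f] z by (simp add: u_def)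
  then obtain a b c d where u: "u = w11 a + w12 b + w21 c + w22 d"
    using augmentation[of u] by (auto simp: scl_simps)
  define G where "G = single 1 0 (single 1 0 a + single 0 1 b) + single 0 1 (single 1 0 c + single 0 1 d)"
  have G: "G \<in> Fam 1 1" unfolding G_def
    by (intro subgrp_add[OF subgrp_homog] single_homog subgrp_zero subgrp_homog) auto
  have dG: "nabA G \<in> Fam 0 0"
    using anticomm_pair.lower_homog[OF std.pair_P _ subgrp_homog[OF subgrp_UNIV] std.P_fam] G by simp
  have "nabA G 0 0 0 0 = u" by (simp add: lower_def G_def single_def u add_ac)
  then have "coeffs VA f = nabA G"
    unfolding Fu using Fam0_eq[OF dG] homog_0_eq[OF homog_in[OF dG, of 0 0]] by simp
  moreover have "outarrow (VA, 1, 1) = Some ((VA, 0, 0), nabla VA)" by simp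
  ultimately show ?thesis using Img_of_coeffs[OF _ arrow_nabla(1) f G] by blast
qed

lemma dlt_Mspace: "J \<subseteq> {1..4} \<Longrightarrow> dlt (k, J, 0, 0, 0, 0) \<in> Mspace (X, 0, 0)"
proof -
  have "{z. dlt (k, J, 0, 0, 0, 0) z \<noteq> 0} = {(k, J, 0, 0, 0, 0 :: nat)}" by (auto simp: dlt_def)
  then show "J \<subseteq> {1..4} \<Longrightarrow> dlt (k, J, 0, 0, 0, 0) \<in> Mspace (X, 0, 0)"
    by (auto simp: Mspace_def dlt_def split: if_splits)
qed

lemma dlt_vec: "dlt x = vec [(1, x)]"
  by simp

text \<open>The class of 1 generates. Elements of nonnegative degree kill it, since all weights of
  V_A^{0,0} are zero; those of negative degree send it to PBW monomials with zero constant
  term.\<close>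

lemma trivial_A00: "homology_trivial1 (VA, 0, 0)"
  unfolding homology_trivial1_def
proof (intro bexI conjI allI ballI impI)
  let ?wvec = "dlt (0, {}, 0, 0, 0, 0) :: me"
  show wK: "?wvec \<in> Ker (VA, 0, 0)" using dlt_Mspace[of "{}" 0 VA] by (simp add: Ker_def)
  show "?wvec \<notin> Img (VA, 0, 0)"
  proof
    assume "?wvec \<in> Img (VA, 0, 0)"
    moreover have "?wvec \<noteq> (\<lambda>z. 0)" by (auto simp: dlt_def fun_eq_iff)
    ultimately obtain g where g: "g \<in> Mspace (VA, 1, 1)" "?wvec = genmap (nabla VA) g"
      unfolding Img_def using outarrow_A00 by blast
    have "?wvec (0, {}, 0, 0, 0, 0) = 0"
      using arrow_repD[OF arrow_nabla(1) g(1), of 0 0 0 0 0 "{}"]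
      by (simp add: g(2) lower_def rep_simps Rep_w_one)
    then show False by (simp add: dlt_def)
  qed
  show "\<exists>c g. g \<in> Img (VA, 0, 0) \<and> f = (\<lambda>z. c * ?wvec z + g z)" if "f \<in> Ker (VA, 0, 0)" for f
  proof -
    have f: "f \<in> Mspace (VA, 0, 0)" using that by (simp add: Ker_def)
    define c where "c = f (0, {}, 0, 0, 0, 0)"
    define g where "g = (\<lambda>z. f z - c * ?wvec z)"
    have "{z. g z \<noteq> 0} \<subseteq> insert (0, {}, 0, 0, 0, 0) {z. f z \<noteq> 0}"
    proof
      fix z assume "z \<in> {z. g z \<noteq> 0}"
      then show "z \<in> insert (0, {}, 0, 0, 0, 0) {z. f z \<noteq> 0}"
        by (cases "z = (0, {}, 0, 0, 0, 0)") (simp_all add: g_def dlt_def)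
    qed
    then have "finite {z. g z \<noteq> 0}" using Mspace_finite[OF f] finite_subset by blast
    moreover have "J \<subseteq> {1..4} \<and> a1 + a2 = 0 \<and> b1 + b2 = 0" if "g (k, J, a1, a2, b1, b2) \<noteq> 0" for k J a1 a2 b1 b2
    proof (cases "(k, J, a1, a2, b1, b2) = (0, {}, 0, 0, 0, 0)")
      case False
      then have "?wvec (k, J, a1, a2, b1, b2) = 0" unfolding dlt_def by (rule if_not_P)
      then have "f (k, J, a1, a2, b1, b2) \<noteq> 0" using that by (simp add: g_def)
      then show ?thesis using f by (simp add: Mspace_def)
    qed simp
    ultimately have "g \<in> Mspace (VA, 0, 0)" by (simp add: Mspace_def)
    moreover have "g (0, {}, 0, 0, 0, 0) = 0" by (simp add: g_def c_def dlt_def)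
    ultimately have "g \<in> Img (VA, 0, 0)" by (rule A00_Img)
    moreover have "f = (\<lambda>z. c * ?wvec z + g z)" by (simp add: g_def)
    ultimately show ?thesis by blast
  qed
  show "act (fst (VA, 0, 0)) x ?wvec \<in> Img (VA, 0, 0)" if x: "is_gbasis x" for x
  proof -
    have a: "act VA x ?wvec = actn 0 VA x 0 {} (0, 0, 0, 0)"
    proof
      fix z show "act VA x ?wvec z = actn 0 VA x 0 {} (0, 0, 0, 0) z"
        unfolding act_def dlt_vec lin_vec by simp
    qed
    have "g0act VA x (0, 0, 0, 0) = (\<lambda>z. 0)"
      by (auto simp: g0act_def Exv_def Eyv_def opx_def opy_def xpoly_def ypoly_def fun_eq_iff)
    then have t: "ten (dlt (0, {})) (g0act VA x (0, 0, 0, 0)) = (\<lambda>z. 0)" by (auto simp: ten_def)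
    show ?thesis
    proof (cases "gdeg x < 0")
      case False
      then show ?thesis using a t zero_Img by simp
    next
      case True
      then obtain I where I: "x = GK 0 I" using gdeg_neg by blast
      then have I4: "I \<subseteq> {1..4}" "card I < 2" using x True by (auto simp: is_gbasis_def)
      then have "finite I" using fin14 by blast
      with I4(2) consider "I = {}" | j where "I = {j}"
        by (metis One_nat_def card_0_eq card_1_singletonE less_2_cases)
      then have "\<exists>k J. J \<subseteq> {1..4} \<and> (k, J) \<noteq> (0, {}) \<and> lmulM x ?wvec = dlt (k, J, 0, 0, 0, 0)"
      proof cases
        case 1
        then show ?thesis using lmulM_dlt[OF True, of "{}" "(0, 0, 0, 0)"] I
          by (intro exI[of _ 1] exI[of _ "{}"]) (simp add: lm.simps)
      next
        case 2
        have "nless {} j = 0" by (simp add: nless_def)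
        then show ?thesis using lmulM_dlt[OF True, of "{}" "(0, 0, 0, 0)"] I 2 I4(1)
          by (intro exI[of _ 0] exI[of _ "{j}"]) (simp add: lm.simps)
      qed
      then obtain k J where kJ: "J \<subseteq> {1..4}" "(k, J) \<noteq> (0, {})" "lmulM x ?wvec = dlt (k, J, 0, 0, 0, 0)" by blast
      have "dlt (k, J, 0, 0, 0, 0) \<in> Img (VA, 0, 0)"
        using kJ(2) by (intro A00_Img dlt_Mspace kJ(1)) (auto simp: dlt_def)
      then show ?thesis using a True kJ(3) by simp
    qed
  qed
qed

theorem theorem6p1:
  shows "\<forall>v :: vertex.
           (if v = (VA, 0, 0) \<or> v = (VC, 1, 1) then homology_trivial1 v else homology_zero v)"
  using trivial_A00 trivial_C11 homology_zero_all by auto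

end
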